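(* Let $X = X_{n,p}$ denote the number of additive quadruples in $[n]_p$, i.e. the number of $4$-element subsets $\{x_1,x_2,y_1,y_2\} \subseteq [n]_p$ satisfying $x_1 + x_2 = y_1 + y_2$, and let $\mu = \mathbb{E} X$. Then for every $\varepsilon > 0$ there are constants $c, C > 0$ and $n_0$ (depending only on $\varepsilon$) such that for all $n \ge n_0$ and all $p \in (0,1]$ satisfying $1 \le (1+\varepsilon)\mu \le X_{n,1}$ we have $$\exp\Bigl(-C\min\bigl\{\mu,\; \mu^{1/3}\log(1/p)\bigr\}\Bigr) \le \mathbb{P}(X \ge (1+\varepsilon)\mu) \le \exp\Bigl(-c\min\bigl\{\mu,\; \mu^{1/3}\log(1/p)\bigr\}\Bigr).$$
   Context: $[n] = \{1,\dots,n\}$, and $[n]_p$ is the binomial random subset of $[n]$ in which each integer is included independently with probability $p$. A $4$-element subset is counted (once) if its elements can be labelled $x_1,x_2,y_1,y_2$ so that the given equation holds. $X_{n,1}$ is the (deterministic) value for $p=1$, i.e. the total number of such $4$-element subsets of $[n]$. *)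

theory Defs
  imports "HOL-Probability.Probability"
begin

definition binomial_subset :: "nat \<Rightarrow> real \<Rightarrow> nat set pmf" where
  "binomial_subset n p =
     map_pmf (\<lambda>b. {i \<in> {1..n}. b i}) (Pi_pmf {1..n} False (\<lambda>_. bernoulli_pmf p))"

text \<open>Since \<open>card Q = 4\<close>, the four labelled elements are pairwise distinct; each set \<open>Q\<close> is
  counted once, no matter how many labellings satisfy the equation.\<close>

definition additive_quadruples :: "nat set \<Rightarrow> nat set set" where
  "additive_quadruples A =
     {Q. Q \<subseteq> A \<and> card Q = 4 \<and>
         (\<exists>x1 x2 y1 y2. Q = {x1, x2, y1, y2} \<and> x1 + x2 = y1 + y2)}"

definition num_quadruples :: "nat set \<Rightarrow> nat" where
  "num_quadruples A = card (additive_quadruples A)"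

definition mean_quadruples :: "nat \<Rightarrow> real \<Rightarrow> real" where
  "mean_quadruples n p =
     measure_pmf.expectation (binomial_subset n p) (\<lambda>A. real (num_quadruples A))"

end

(* Upper bound: let X count the quadruples and let Phi be the minimum in the exponent. A core is
   a set I of at most K = c Phi elements, spanning a constant fraction of mu quadruples, in which
   every element lies in at least const * mu / K quadruples. If U has at most K elements and
   contains no core, then the mean of X given that U is contained in the random set is at most
   (1 + eps/2) mu, since quadruples meeting U in one, two or three elements are negligible and
   deleting low-degree elements from U would otherwise produce a core. Expanding the l-th moment
   of X on the event "no core", one quadruple at a time, bounds it by ((1 + eps/2) mu)^l, and
   Markov's inequality with l of order Phi gives the exponential bound (the method of Harel,
   Mousset and Samotij). Cores are excluded by a union bound. If mu < log(1/p)^6, a core is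
   explored by adding quadruples (or overlapping pairs of quadruples), and each step multiplies the
   weight by a power of p. If mu >= log(1/p)^6, a random half S of a core I typically determines
   at least a third of the elements of I up to a factor polylogarithmic in 1/p, because an
   element of I outside S completes a triple of S in many ways, and few elements of {1..n} do.

   Lower bound: either the random set contains an initial interval of about mu^(1/3) elements,
   or, when mu < mu^(1/3) log(1/p), the elements of three short intervals typically produce order
   mu / p distinct sums x1 + x2 - y1 in a fourth interval, whose independent random elements hit
   sufficiently many of these sums with probability exp(- O(mu)). *)

theory Submission
  imports Defs "HOL-Real_Asymp.Real_Asymp"
begin

subsection \<open>Expectations over a binomial random subset\<close>

text \<open>Since \<open>n * p\<close> has order \<mu>^(1/3) p^(-1/3), the exponents in the union
  bound over cores are forced. A core has at least a constant times \<mu>^(1/3) elements, so a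
  freely chosen element contributes a factor p^(-1/3) up to constants and counting all sets
  diverges. An element determined by the others contributes p up to powers of L = log(1/p). The
  break-even share of determined elements is a quarter; a third gives p^(-2/9 + 1/3) = p^(1/9) per
  element, which leaves room for the logarithms. Determining a third needs degrees, of order
  \<mu>/K, above a large multiple of K. With K at most c \<mu>^(1/3) L this means L^2 \<le>
  \<mu>^(1/3), hence the threshold L^6. Below it, n is at most p^(-4/3) up to logarithms. A
  quadruple meeting the explored set has weight at most n^2 p^3, about p^(1/3), but a disjoint one
  has weight n^3 p^4, which is not small; so disjoint quadruples are taken in overlapping pairs, and
  every element of a core must lie in two quadruples. The bound K \<le> c \<mu> provides this, and K
  \<le> c \<mu>^(1/3) L keeps the partial overlaps small.\<close>

definition bexp :: "real \<Rightarrow> 'a set \<Rightarrow> ('a set \<Rightarrow> real) \<Rightarrow> real" where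
  "bexp p V f = (\<Sum>A\<in>Pow V. p ^ card A * (1 - p) ^ card (V - A) * f A)"

lemma bexp_cong: "(\<And>A. A \<subseteq> V \<Longrightarrow> f A = g A) \<Longrightarrow> bexp p V f = bexp p V g"
  unfolding bexp_def by (rule sum.cong) auto

lemma bexp_mono:
  assumes "0 \<le> p" "p \<le> 1" "\<And>A. A \<subseteq> V \<Longrightarrow> f A \<le> g A"
  shows "bexp p V f \<le> bexp p V g"
  unfolding bexp_def by (rule sum_mono) (use assms in \<open>auto intro!: mult_left_mono\<close>)

lemma bexp_nonneg:
  assumes "0 \<le> p" "p \<le> 1" "\<And>A. A \<subseteq> V \<Longrightarrow> 0 \<le> f A"
  shows "0 \<le> bexp p V f"
  unfolding bexp_def by (rule sum_nonneg) (use assms in auto)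

lemma bexp_cmult: "bexp p V (\<lambda>A. c * f A) = c * bexp p V f"
  unfolding bexp_def by (simp add: sum_distrib_left mult_ac)

lemma bexp_add: "bexp p V (\<lambda>A. f A + g A) = bexp p V f + bexp p V g"
  unfolding bexp_def by (simp add: sum.distrib distrib_left)

lemma bexp_diff: "bexp p V (\<lambda>A. f A - g A) = bexp p V f - bexp p V g"
  unfolding bexp_def by (simp add: sum_subtractf right_diff_distrib)

lemma bexp_sum: "bexp p V (\<lambda>A. \<Sum>i\<in>J. f i A) = (\<Sum>i\<in>J. bexp p V (f i))"
  unfolding bexp_def by (simp add: sum_distrib_left) (rule sum.swap)

text \<open>This is independence of the random set on disjoint ground sets, and the reason why
  \<open>bexp\<close> takes the ground set as an argument: conditioning on part of the random set
  becomes an iterated finite sum.\<close>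

lemma bexp_union:
  assumes "finite V" "finite W" "V \<inter> W = {}"
  shows "bexp p (V \<union> W) f = bexp p V (\<lambda>A. bexp p W (\<lambda>B. f (A \<union> B)))"
proof -
  have "bexp p (V \<union> W) f =
      (\<Sum>(A,B)\<in>Pow V \<times> Pow W. p ^ card (A \<union> B) * (1 - p) ^ card ((V \<union> W) - (A \<union> B)) * f (A \<union> B))"
    unfolding bexp_def
    by (rule sum.reindex_bij_witness[where j = "\<lambda>X. (X \<inter> V, X \<inter> W)" and i = "\<lambda>(A,B). A \<union> B"])
      (use assms(3) in \<open>auto simp: Int_Un_distrib[symmetric] intro!: arg_cong2[where f = "(*)"] arg_cong[where f = f]
        arg_cong[where f = card] arg_cong2[where f = "power"]\<close>)
  also have "\<dots> = (\<Sum>(A,B)\<in>Pow V \<times> Pow W. (p ^ card A * (1 - p) ^ card (V - A)) *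
      (p ^ card B * (1 - p) ^ card (W - B) * f (A \<union> B)))"
  proof (rule sum.cong, goal_cases)
    case (2 x)
    obtain A B where x: "x = (A, B)" "A \<subseteq> V" "B \<subseteq> W" using 2 by auto
    have "finite A" using x(2) assms(1) by (rule finite_subset)
    moreover have "finite B" using x(3) assms(2) by (rule finite_subset)
    ultimately
    have "card (A \<union> B) = card A + card B" using x assms by (intro card_Un_disjoint) auto
    moreover have "(V \<union> W) - (A \<union> B) = (V - A) \<union> (W - B)" using x assms by auto
    then have "card ((V \<union> W) - (A \<union> B)) = card (V - A) + card (W - B)"
      using x assms by (simp add: card_Un_disjoint disjoint_iff)
    ultimately show ?case using x by (simp add: power_add)
  qed simp
  finally show ?thesis
    unfolding bexp_def by (simp add: sum.cartesian_product[symmetric] sum_distrib_left)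
qed

lemma bexp_const: "finite V \<Longrightarrow> bexp p V (\<lambda>_. c) = c"
  using prod_add[of V "\<lambda>_. p" "\<lambda>_. 1 - p"]
  by (simp add: bexp_def sum_distrib_right[symmetric])

lemma bexp_superset:
  assumes "finite V" "U \<subseteq> V"
  shows "bexp p V (\<lambda>A. of_bool (U \<subseteq> A)) = p ^ card U"
proof -
  have fU: "finite U" using assms finite_subset by auto
  have "bexp p V (\<lambda>A. of_bool (U \<subseteq> A)) = bexp p (U \<union> (V - U)) (\<lambda>A. of_bool (U \<subseteq> A))"
    using assms by (simp add: Un_absorb1)
  also have "\<dots> = bexp p U (\<lambda>A. bexp p (V - U) (\<lambda>B. of_bool (U \<subseteq> A \<union> B)))"
    using assms fU by (intro bexp_union) auto
  also have "\<dots> = bexp p U (\<lambda>A. bexp p (V - U) (\<lambda>B. of_bool (A = U)))"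
    by (intro bexp_cong) auto
  also have "\<dots> = bexp p U (\<lambda>A. of_bool (A = U))" using assms by (simp add: bexp_const)
  also have "\<dots> = p ^ card U"
    using fU by (simp add: bexp_def of_bool_def if_distrib[of "\<lambda>x. _ * x"] sum.delta cong: if_cong)
  finally show ?thesis .
qed

section \<open>Transfer from the probability measure to finite sums\<close>

lemma set_pmf_binomial_subset: "set_pmf (binomial_subset n p) \<subseteq> Pow {1..n}"
  unfolding binomial_subset_def by auto

lemma pmf_binomial_subset:
  assumes "0 \<le> p" "p \<le> 1" "A \<subseteq> {1..n}"
  shows "pmf (binomial_subset n p) A = p ^ card A * (1 - p) ^ card ({1..n} - A)"
proof -
  let ?P = "Pi_pmf {1..n} False (\<lambda>_. bernoulli_pmf p)"
  let ?f = "\<lambda>b. {i \<in> {1..n}. b i}"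
  have inj: "inj_on ?f (set_pmf ?P)"
  proof (rule inj_onI)
    fix b b' assume "b \<in> set_pmf ?P" "b' \<in> set_pmf ?P" and eq: "?f b = ?f b'"
    then have *: "\<And>i. i \<notin> {1..n} \<Longrightarrow> b i = b' i"
      using set_Pi_pmf_subset'[of "{1..n}" False] by (fastforce simp: PiE_dflt_def)
    have "\<And>i. b i = b' i"
      using eq * by blast
    then show "b = b'" by auto
  qed
  have fA: "?f (\<lambda>i. i \<in> A) = A" using assms by auto
  \<comment> \<open>\<open>pmf_map_inj\<close> speaks only about points of the support. For p = 0 or
    p = 1 the indicator of \<open>A\<close> may lie outside it, and then both masses vanish.\<close>
  have "pmf (binomial_subset n p) A = pmf ?P (\<lambda>i. i \<in> A)"
  proof (cases "(\<lambda>i. i \<in> A) \<in> set_pmf ?P")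
    case True
    then show ?thesis unfolding binomial_subset_def
      using pmf_map_inj[OF inj True] fA by simp
  next
    case False
    have "A \<notin> ?f ` set_pmf ?P"
    proof
      assume "A \<in> ?f ` set_pmf ?P"
      then obtain b where b: "b \<in> set_pmf ?P" "A = ?f b" by blast
      have "b \<in> PiE_dflt {1..n} False (set_pmf \<circ> (\<lambda>_. bernoulli_pmf p))"
        using set_Pi_pmf_subset'[of "{1..n}" False] b(1) by blast
      then have *: "i \<notin> {1..n} \<Longrightarrow> \<not> b i" for i
        unfolding PiE_dflt_def by blast
      have "b i = (i \<in> A)" for i using *[of i] unfolding b(2) by (cases "i \<in> {1..n}") simp_all
      then have "b = (\<lambda>i. i \<in> A)" by (rule ext)
      then show False using b(1) False by metis
    qed
    then have "pmf (map_pmf ?f ?P) A = 0" unfolding set_map_pmf[symmetric] pmf_eq_0_set_pmf .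
    moreover have "pmf ?P (\<lambda>i. i \<in> A) = 0" using False unfolding pmf_eq_0_set_pmf .
    ultimately show ?thesis unfolding binomial_subset_def by simp
  qed
  also have "\<dots> = (\<Prod>i\<in>{1..n}. pmf (bernoulli_pmf p) (i \<in> A))"
    using assms by (intro pmf_Pi') auto
  also have "\<dots> = (\<Prod>i\<in>A \<union> ({1..n} - A). pmf (bernoulli_pmf p) (i \<in> A))"
    using assms by (simp add: Un_absorb1)
  also have "\<dots> = (\<Prod>i\<in>A. pmf (bernoulli_pmf p) (i \<in> A)) * (\<Prod>i\<in>{1..n} - A. pmf (bernoulli_pmf p) (i \<in> A))"
    using assms finite_subset by (intro prod.union_disjoint) auto
  also have "\<dots> = (\<Prod>i\<in>A. p) * (\<Prod>i\<in>{1..n} - A. 1 - p)"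
    using assms by (intro arg_cong2[where f = "(*)"] prod.cong) auto
  finally show ?thesis by simp
qed

lemma expectation_binomial_subset:
  assumes "0 \<le> p" "p \<le> 1"
  shows "measure_pmf.expectation (binomial_subset n p) f = bexp p {1..n} f"
proof -
  have "measure_pmf.expectation (binomial_subset n p) f
      = (\<Sum>A\<in>Pow {1..n}. f A * pmf (binomial_subset n p) A)"
    by (rule integral_measure_pmf_real) (use set_pmf_binomial_subset in auto)
  also have "\<dots> = bexp p {1..n} f"
    unfolding bexp_def by (rule sum.cong) (use assms in \<open>auto simp: pmf_binomial_subset\<close>)
  finally show ?thesis .
qed

lemma prob_binomial_subset:
  assumes "0 \<le> p" "p \<le> 1"
  shows "measure_pmf.prob (binomial_subset n p) {A. P A} = bexp p {1..n} (\<lambda>A. of_bool (P A))"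
proof -
  have "measure_pmf.prob (binomial_subset n p) {A. P A}
      = measure_pmf.expectation (binomial_subset n p) (indicator {A. P A})"
    by simp
  also have "\<dots> = bexp p {1..n} (\<lambda>A. of_bool (P A))"
    by (subst expectation_binomial_subset[OF assms]) (auto simp: indicator_def intro!: bexp_cong)
  finally show ?thesis .
qed

section \<open>Elementary counting of quadruples\<close>

lemma finite_additive_quadruples: "finite A \<Longrightarrow> finite (additive_quadruples A)"
  unfolding additive_quadruples_def by (rule finite_subset[of _ "Pow A"]) auto

lemma additive_quadruples_subset:
  "U \<subseteq> V \<Longrightarrow> additive_quadruples U = {Q \<in> additive_quadruples V. Q \<subseteq> U}"
  unfolding additive_quadruples_def by auto

lemma num_quadruples_sum:
  assumes "finite V" "A \<subseteq> V"
  shows "real (num_quadruples A) = (\<Sum>Q\<in>additive_quadruples V. of_bool (Q \<subseteq> A))"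
  using assms finite_additive_quadruples[of V] unfolding num_quadruples_def
  by (simp add: additive_quadruples_subset[OF assms(2)] of_bool_def sum.If_cases Int_def)

lemma additive_quadrupleD:
  "Q \<in> additive_quadruples V \<Longrightarrow> Q \<subseteq> V \<and> card Q = 4 \<and> finite Q"
  unfolding additive_quadruples_def by (auto intro: card_ge_0_finite)

lemma mean_quadruples_eq:
  assumes "0 \<le> p" "p \<le> 1"
  shows "mean_quadruples n p = real (num_quadruples {1..n}) * p ^ 4"
proof -
  have "mean_quadruples n p = bexp p {1..n} (\<lambda>A. \<Sum>Q\<in>additive_quadruples {1..n}. of_bool (Q \<subseteq> A))"
    unfolding mean_quadruples_def expectation_binomial_subset[OF assms]
    by (rule bexp_cong) (simp add: num_quadruples_sum[of "{1..n}"])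
  also have "\<dots> = (\<Sum>Q\<in>additive_quadruples {1..n}. p ^ 4)"
    unfolding bexp_sum
  proof (rule sum.cong[OF refl])
    fix Q assume "Q \<in> additive_quadruples {1..n}"
    then have "Q \<subseteq> {1..n}" "card Q = 4" using additive_quadrupleD by blast+
    then show "bexp p {1..n} (\<lambda>A. of_bool (Q \<subseteq> A)) = p ^ 4"
      using bexp_superset[of "{1..n}" Q p] by simp
  qed
  finally show ?thesis by (simp add: num_quadruples_def)
qed

text \<open>Three elements of a quadruple leave three choices for the fourth, which is the sum of
  two of them minus the third; \<open>j\<close> in \<open>?f\<close> records which one is
  subtracted.\<close>

lemma card_quadruples_meeting_le:
  assumes "finite U1" "finite U2" "finite U3"
  shows "card {Q \<in> additive_quadruples V. \<exists>a\<in>U1. \<exists>b\<in>U2. \<exists>c\<in>U3. a \<in> Q \<and> b \<in> Q \<and> c \<in> Q \<and> card {a,b,c} = 3}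
      \<le> 3 * card U1 * card U2 * card U3" (is "card ?L \<le> _")
proof -
  let ?f = "\<lambda>(a,b,c,j). {a, b, c, if j = 0 then a + b - c else if j = (1::nat) then a + c - b else b + c - a}"
  have "?L \<subseteq> ?f ` (U1 \<times> U2 \<times> U3 \<times> {0,1,2})"
  proof
    fix Q assume "Q \<in> ?L"
    then obtain a b c where Q: "Q \<in> additive_quadruples V" "a \<in> U1" "b \<in> U2" "c \<in> U3"
      "a \<in> Q" "b \<in> Q" "c \<in> Q" "card {a,b,c} = 3" by auto
    obtain x1 x2 y1 y2 where x: "Q = {x1,x2,y1,y2}" "x1 + x2 = y1 + y2" "card Q = 4" "finite Q"
      using Q(1) additive_quadrupleD[OF Q(1)] unfolding additive_quadruples_def by auto
    have "card (Q - {a,b,c}) = 1" using x Q by (subst card_Diff_subset) auto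
    then obtain d where d: "Q - {a,b,c} = {d}" by (auto simp: card_1_singleton_iff)
    then have Qd: "Q = {a,b,c,d}" using Q by auto
    have dist: "a \<noteq> b" "a \<noteq> c" "b \<noteq> c" using Q(8) by (auto simp: card_insert_if split: if_splits)
    have distx: "x1 \<noteq> x2" "x1 \<noteq> y1" "x1 \<noteq> y2" "x2 \<noteq> y1" "x2 \<noteq> y2" "y1 \<noteq> y2"
      using x by (auto simp: card_insert_if split: if_splits)
    have dd: "d \<noteq> a" "d \<noteq> b" "d \<noteq> c" using d by auto
    \<comment> \<open>The total of the quadruple is twice \<open>x1 + x2\<close>, so two of a, b, c,
      d sum to half the total. This yields the equation for \<open>d\<close> without matching the
      labels x1, x2, y1, y2 to a, b, c, d.\<close>
    have "\<Sum>{a,b,c,d} = \<Sum>{x1,x2,y1,y2}" using Qd x(1) by simp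
    then have "a + (b + (c + d)) = x1 + (x2 + (y1 + y2))" using dist dd distx by (simp add: eq_commute)
    then have "a + b + c + d = (x1 + x2) + (x1 + x2)" using x(2) by (simp add: add.assoc)
    moreover have "x1 \<in> {a,b,c,d}" "x2 \<in> {a,b,c,d}"
      using Qd x(1) by auto
    ultimately have "a + b = c + d \<or> a + c = b + d \<or> b + c = a + d"
      using distx(1) by (elim insertE emptyE; linarith)
    then have "d = a + b - c \<or> d = a + c - b \<or> d = b + c - a" by auto
    then have "Q = ?f (a,b,c,0) \<or> Q = ?f (a,b,c,1) \<or> Q = ?f (a,b,c,2)" using Qd by auto
    then show "Q \<in> ?f ` (U1 \<times> U2 \<times> U3 \<times> {0,1,2})" using Q by blast
  qed
  then have "card ?L \<le> card (U1 \<times> U2 \<times> U3 \<times> {0,1,2::nat})"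
    using assms by (intro surj_card_le) auto
  then show ?thesis by (simp add: card_cartesian_product algebra_simps)
qed

subsection \<open>Restricted moments and dense cores\<close>

text \<open>Choose \<open>i\<close> elements of the quadruple in \<open>U\<close> and
  \<open>3 - i\<close> further ones in \<open>V\<close>; the fourth then has three possible values.
  The claim \<open>**\<close> leaves the three ranges open so that each \<open>i\<close> only has to
  name them.\<close>

lemma card_quadruples_inter_ge:
  assumes "U \<subseteq> V" "finite V" "i \<le> 3"
  shows "card {Q \<in> additive_quadruples V. i \<le> card (Q \<inter> U)} \<le> 3 * card U ^ i * card V ^ (3 - i)"
proof -
  have fU: "finite U" using assms finite_subset by auto
  have **: "card {Q \<in> additive_quadruples V. i \<le> card (Q \<inter> U)} \<le> 3 * card U1 * card U2 * card U3"
    if fin: "finite U1" "finite U2" "finite U3"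
      and *: "\<And>Q W W'. Q \<subseteq> V \<Longrightarrow> W \<subseteq> Q \<inter> U \<Longrightarrow> W' \<subseteq> Q - W \<Longrightarrow> card W = i \<Longrightarrow> card W' = 3 - i
        \<Longrightarrow> \<exists>a\<in>U1. \<exists>b\<in>U2. \<exists>c\<in>U3. W \<union> W' = {a, b, c}"
    for U1 U2 U3
  proof -
    have sub: "{Q \<in> additive_quadruples V. i \<le> card (Q \<inter> U)} \<subseteq> {Q \<in> additive_quadruples V.
        \<exists>a\<in>U1. \<exists>b\<in>U2. \<exists>c\<in>U3. a \<in> Q \<and> b \<in> Q \<and> c \<in> Q \<and> card {a,b,c} = 3}"
    proof
      fix Q assume "Q \<in> {Q \<in> additive_quadruples V. i \<le> card (Q \<inter> U)}"
      then have Q: "Q \<in> additive_quadruples V" "i \<le> card (Q \<inter> U)" by auto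
      then have Q4: "Q \<subseteq> V" "card Q = 4" "finite Q" using additive_quadrupleD by blast+
      obtain W where W: "W \<subseteq> Q \<inter> U" "card W = i" "finite W"
        using obtain_subset_with_card_n[OF Q(2)] by metis
      have "card (Q - W) = 4 - i" using W Q4 by (subst card_Diff_subset) auto
      then obtain W' where W': "W' \<subseteq> Q - W" "card W' = 3 - i" "finite W'"
        using obtain_subset_with_card_n[of "3 - i" "Q - W"] diff_le_mono[of 3 4 i] by auto
      obtain a b c where abc: "a \<in> U1" "b \<in> U2" "c \<in> U3" "W \<union> W' = {a, b, c}"
        using *[OF Q4(1) W(1) W'(1) W(2) W'(2)] by blast
      have "card (W \<union> W') = 3" using W W' assms(3) by (subst card_Un_disjoint) auto
      then have "card {a, b, c} = 3" using abc by simp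
      moreover have "{a, b, c} \<subseteq> Q" using abc W W' by blast
      ultimately show "Q \<in> {Q \<in> additive_quadruples V.
        \<exists>a\<in>U1. \<exists>b\<in>U2. \<exists>c\<in>U3. a \<in> Q \<and> b \<in> Q \<and> c \<in> Q \<and> card {a,b,c} = 3}"
        using abc Q(1) by blast
    qed
    show ?thesis
      by (rule order.trans[OF card_mono[OF _ sub] card_quadruples_meeting_le[OF fin]])
        (use finite_additive_quadruples[OF assms(2)] in auto)
  qed
  consider "i = 0" | "i = 1" | "i = 2" | "i = 3" using assms(3) by linarith
  then show ?thesis
  proof cases
    case 1
    have "card {Q \<in> additive_quadruples V. i \<le> card (Q \<inter> U)} \<le> 3 * card V * card V * card V"
    proof (rule **)
      fix Q W W' assume "Q \<subseteq> V" "W \<subseteq> Q \<inter> U" "W' \<subseteq> Q - W" "card W = i" "card W' = 3 - i"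
      moreover have "W = {}" using 1 calculation assms fU finite_subset by (metis card_0_eq le_infE)
      moreover obtain a b c where "W' = {a, b, c}"
        using 1 \<open>card W' = 3 - i\<close> by (auto simp: card_3_iff)
      ultimately have "a \<in> V" "b \<in> V" "c \<in> V" "W \<union> W' = {a, b, c}" by auto
      then show "\<exists>a\<in>V. \<exists>b\<in>V. \<exists>c\<in>V. W \<union> W' = {a, b, c}" by blast
    qed (use assms in auto)
    then show ?thesis using 1 by (simp add: power3_eq_cube mult.assoc)
  next
    case 2
    have "card {Q \<in> additive_quadruples V. i \<le> card (Q \<inter> U)} \<le> 3 * card U * card V * card V"
    proof (rule **)
      fix Q W W' assume "Q \<subseteq> V" "W \<subseteq> Q \<inter> U" "W' \<subseteq> Q - W" "card W = i" "card W' = 3 - i"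
      moreover obtain a where "W = {a}" using 2 \<open>card W = i\<close> by (auto simp: card_1_singleton_iff)
      moreover have "card W' = 2" using 2 \<open>card W' = 3 - i\<close> by simp
      then obtain b c where "W' = {b, c}" unfolding card_2_iff by blast
      ultimately have "a \<in> U" "b \<in> V" "c \<in> V" "W \<union> W' = {a, b, c}" by auto
      then show "\<exists>a\<in>U. \<exists>b\<in>V. \<exists>c\<in>V. W \<union> W' = {a, b, c}" by blast
    qed (use assms fU in auto)
    then show ?thesis using 2 by (simp add: power2_eq_square mult.assoc numeral_2_eq_2[symmetric])
  next
    case 3
    have "card {Q \<in> additive_quadruples V. i \<le> card (Q \<inter> U)} \<le> 3 * card U * card U * card V"
    proof (rule **)
      fix Q W W' assume "Q \<subseteq> V" "W \<subseteq> Q \<inter> U" "W' \<subseteq> Q - W" "card W = i" "card W' = 3 - i"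
      moreover obtain a b where "W = {a, b}" using 3 \<open>card W = i\<close> by (auto simp: card_2_iff)
      moreover obtain c where "W' = {c}" using 3 \<open>card W' = 3 - i\<close> by (auto simp: card_1_singleton_iff)
      ultimately have "a \<in> U" "b \<in> U" "c \<in> V" "W \<union> W' = {a, b, c}" by auto
      then show "\<exists>a\<in>U. \<exists>b\<in>U. \<exists>c\<in>V. W \<union> W' = {a, b, c}" by blast
    qed (use assms fU in auto)
    then show ?thesis using 3 by (simp add: power2_eq_square mult.assoc)
  next
    case 4
    have "card {Q \<in> additive_quadruples V. i \<le> card (Q \<inter> U)} \<le> 3 * card U * card U * card U"
    proof (rule **)
      fix Q W W' assume "Q \<subseteq> V" "W \<subseteq> Q \<inter> U" "W' \<subseteq> Q - W" "card W = i" "card W' = 3 - i"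
      moreover have "W' = {}"
        using 4 calculation assms by (metis card_0_eq diff_self_eq_0 finite_Diff finite_subset)
      moreover obtain a b c where "W = {a, b, c}"
        using 4 \<open>card W = i\<close> by (auto simp: card_3_iff)
      ultimately have "a \<in> U" "b \<in> U" "c \<in> U" "W \<union> W' = {a, b, c}" by auto
      then show "\<exists>a\<in>U. \<exists>b\<in>U. \<exists>c\<in>U. W \<union> W' = {a, b, c}" by blast
    qed (use fU in auto)
    then show ?thesis using 4 by (simp add: power3_eq_cube mult.assoc)
  qed
qed

lemma num_quadruples_le: "finite V \<Longrightarrow> num_quadruples V \<le> 3 * card V ^ 3"
  using card_quadruples_inter_ge[of V V 0] unfolding num_quadruples_def by simp

lemma sum_of_bool_card:
  "finite S \<Longrightarrow> (\<Sum>x\<in>S. of_bool (P x)) = real (card {x \<in> S. P x})"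
  by (simp add: of_bool_def sum.If_cases Int_def)

text \<open>The sum on the left is the conditional mean of the number of quadruples given that the
  random set contains \<open>U\<close>.\<close>

lemma conditional_mean_le:
  fixes p :: real
  assumes "U \<subseteq> {1..n}" "0 \<le> p" "p \<le> 1"
  shows "(\<Sum>Q\<in>additive_quadruples {1..n}. p ^ card (Q - U)) \<le> real (num_quadruples {1..n}) * p ^ 4
    + 3 * (card U * n ^ 2 * p ^ 3 + card U ^ 2 * n * p ^ 2 + card U ^ 3 * p) + real (num_quadruples U)"
proof -
  let ?H = "additive_quadruples {1..n}"
  have fH: "finite ?H" by (simp add: finite_additive_quadruples)
  have "(\<Sum>Q\<in>?H. p ^ card (Q - U)) \<le> (\<Sum>Q\<in>?H. p ^ 4 + p ^ 3 * of_bool (1 \<le> card (Q \<inter> U))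
      + p ^ 2 * of_bool (2 \<le> card (Q \<inter> U)) + p * of_bool (3 \<le> card (Q \<inter> U)) + of_bool (Q \<subseteq> U))"
  proof (rule sum_mono)
    fix Q assume "Q \<in> ?H"
    then have Q4: "Q \<subseteq> {1..n}" "card Q = 4" "finite Q" using additive_quadrupleD by blast+
    have c: "card (Q - U) = 4 - card (Q \<inter> U)" using Q4 by (simp add: card_Diff_subset_Int)
    have le4: "card (Q \<inter> U) \<le> 4" using Q4 by (metis card_mono inf_le1)
    have sub: "Q \<subseteq> U" if "card (Q \<inter> U) = 4"
      using Q4 that by (metis card_subset_eq inf.absorb_iff1 inf_le1)
    consider "card (Q \<inter> U) = 0" | "card (Q \<inter> U) = 1" | "card (Q \<inter> U) = 2" | "card (Q \<inter> U) = 3" | "card (Q \<inter> U) = 4"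
      using le4 by linarith
    then show "p ^ card (Q - U) \<le> p ^ 4 + p ^ 3 * of_bool (1 \<le> card (Q \<inter> U))
      + p ^ 2 * of_bool (2 \<le> card (Q \<inter> U)) + p * of_bool (3 \<le> card (Q \<inter> U)) + of_bool (Q \<subseteq> U)"
      by cases (use c sub assms in simp_all)
  qed
  also have "\<dots> = real (card ?H) * p ^ 4 + p ^ 3 * card {Q\<in>?H. 1 \<le> card (Q \<inter> U)}
      + p ^ 2 * card {Q\<in>?H. 2 \<le> card (Q \<inter> U)} + p * card {Q\<in>?H. 3 \<le> card (Q \<inter> U)} + card {Q\<in>?H. Q \<subseteq> U}"
    by (simp only: sum.distrib sum_distrib_left[symmetric] sum_of_bool_card[OF fH]) simp
  also have "\<dots> \<le> real (card ?H) * p ^ 4 + p ^ 3 * (3 * card U * n ^ 2)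
      + p ^ 2 * (3 * card U ^ 2 * n) + p * (3 * card U ^ 3) + card {Q\<in>?H. Q \<subseteq> U}"
  proof -
    have "card {Q\<in>?H. 1 \<le> card (Q \<inter> U)} \<le> 3 * card U * n ^ 2"
      using card_quadruples_inter_ge[OF assms(1), of 1] by simp
    moreover have "card {Q\<in>?H. 2 \<le> card (Q \<inter> U)} \<le> 3 * card U ^ 2 * n"
      using card_quadruples_inter_ge[OF assms(1), of 2] by simp
    moreover have "card {Q\<in>?H. 3 \<le> card (Q \<inter> U)} \<le> 3 * card U ^ 3"
      using card_quadruples_inter_ge[OF assms(1), of 3] by simp
    ultimately show ?thesis
      using assms by (intro add_mono mult_left_mono of_nat_mono) auto
  qed
  finally show ?thesis
    by (simp add: num_quadruples_def additive_quadruples_subset[OF assms(1)] algebra_simps)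
qed

text \<open>Deleting elements of degree below \<open>D\<close> one at a time destroys at most
  \<open>card U * D \<le> E\<close> quadruples altogether, so half of the \<open>2 * E\<close>
  survive. The deletion process is replaced by a minimal set: \<open>?P\<close> allows a loss of
  \<open>D\<close> per deleted element, and a smallest set with \<open>?P\<close> has no element of
  low degree left.\<close>

lemma exists_min_degree_subset:
  fixes D E :: real
  assumes "finite U" "2 * E \<le> real (num_quadruples U)" "real (card U) * D \<le> E" "0 \<le> D"
  shows "\<exists>I\<subseteq>U. E \<le> real (num_quadruples I) \<and> (\<forall>v\<in>I. D \<le> real (card {Q \<in> additive_quadruples I. v \<in> Q}))"
proof -
  let ?P = "\<lambda>I. I \<subseteq> U \<and> real (num_quadruples U) - D * card (U - I) \<le> real (num_quadruples I)"
  have "?P U" by simp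
  then obtain I where I: "?P I" and min: "\<And>J. ?P J \<Longrightarrow> card I \<le> card J"
    using ex_has_least_nat[of ?P U card] by blast
  have fI: "finite I" using I assms finite_subset by auto
  have "D * card (U - I) \<le> D * card U" using assms by (intro mult_left_mono of_nat_mono card_mono) auto
  then have 1: "E \<le> real (num_quadruples I)" using I assms(2,3) by (simp add: mult.commute)
  have "D \<le> real (card {Q \<in> additive_quadruples I. v \<in> Q})" if v: "v \<in> I" for v
  proof (rule ccontr)
    assume less: "\<not> ?thesis"
    have "additive_quadruples I = additive_quadruples (I - {v}) \<union> {Q \<in> additive_quadruples I. v \<in> Q}"
      unfolding additive_quadruples_def by auto
    then have "card (additive_quadruples I) \<le> card (additive_quadruples (I - {v})) + card {Q \<in> additive_quadruples I. v \<in> Q}"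
      by (metis card_Un_le)
    then have "real (num_quadruples I) \<le> real (num_quadruples (I - {v})) + D"
      using less unfolding num_quadruples_def by linarith
    moreover have "U - (I - {v}) = insert v (U - I)" using I v by auto
    then have "card (U - (I - {v})) = Suc (card (U - I))" using assms(1) v by simp
    ultimately have "?P (I - {v})" using I by (auto simp: algebra_simps)
    then have "card I \<le> card (I - {v})" by (rule min)
    then show False using v fI by (metis card_Diff1_less leD)
  qed
  then show ?thesis using I 1 by blast
qed

text \<open>One factor of the power is written as a sum over quadruples \<open>Q\<close>, and
  \<open>Q\<close> is absorbed into the planted set \<open>U\<close>, which costs
  \<open>p ^ card (Q - U)\<close>. Since \<open>Z\<close> passes to subsets, a planted set violating
  \<open>Z\<close> contributes nothing, so \<open>mean\<close> applies to every set that occurs. The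
  condition \<open>card U + 4 * l \<le> K\<close> keeps the planted set within the size allowed by
  \<open>mean\<close> throughout the induction.\<close>

lemma restricted_moment_le:
  fixes p B :: real
  assumes p: "0 \<le> p" "p \<le> 1" and B: "0 \<le> B"
    and dec: "\<And>U A. U \<subseteq> A \<Longrightarrow> Z A \<Longrightarrow> Z U"
    and mean: "\<And>U. U \<subseteq> {1..n} \<Longrightarrow> Z U \<Longrightarrow> card U \<le> K
      \<Longrightarrow> (\<Sum>Q\<in>additive_quadruples {1..n}. p ^ card (Q - U)) \<le> B"
  shows "U \<subseteq> {1..n} \<Longrightarrow> card U + 4 * l \<le> K \<Longrightarrow>
    bexp p {1..n} (\<lambda>A. of_bool (U \<subseteq> A \<and> Z A) * real (num_quadruples A) ^ l) \<le> p ^ card U * B ^ l"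
proof (induction l arbitrary: U)
  case 0
  have "bexp p {1..n} (\<lambda>A. of_bool (U \<subseteq> A \<and> Z A) * real (num_quadruples A) ^ 0) \<le> bexp p {1..n} (\<lambda>A. of_bool (U \<subseteq> A))"
    by (rule bexp_mono[OF p]) auto
  then show ?case using bexp_superset[of "{1..n}" U p] 0 by simp
next
  case (Suc l)
  let ?H = "additive_quadruples {1..n}"
  show ?case
  proof (cases "Z U")
    case False
    then have *: "(of_bool (U \<subseteq> A \<and> Z A) :: real) = 0" for A using dec by auto
    show ?thesis unfolding * using p B by (simp add: bexp_def)
  next
    case True
    have "bexp p {1..n} (\<lambda>A. of_bool (U \<subseteq> A \<and> Z A) * real (num_quadruples A) ^ Suc l)
        = bexp p {1..n} (\<lambda>A. \<Sum>Q\<in>?H. of_bool (U \<union> Q \<subseteq> A \<and> Z A) * real (num_quadruples A) ^ l)"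
    proof (rule bexp_cong)
      fix A assume A: "A \<subseteq> {1..n}"
      have "of_bool (U \<subseteq> A \<and> Z A) * real (num_quadruples A) ^ Suc l
          = (\<Sum>Q\<in>?H. of_bool (Q \<subseteq> A)) * (of_bool (U \<subseteq> A \<and> Z A) * real (num_quadruples A) ^ l)"
        using num_quadruples_sum[OF _ A] by simp
      also have "\<dots> = (\<Sum>Q\<in>?H. of_bool (U \<union> Q \<subseteq> A \<and> Z A) * real (num_quadruples A) ^ l)"
        unfolding sum_distrib_right by (rule sum.cong) (auto simp: of_bool_def)
      finally show "of_bool (U \<subseteq> A \<and> Z A) * real (num_quadruples A) ^ Suc l
        = (\<Sum>Q\<in>?H. of_bool (U \<union> Q \<subseteq> A \<and> Z A) * real (num_quadruples A) ^ l)" .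
    qed
    also have "\<dots> \<le> (\<Sum>Q\<in>?H. p ^ card (U \<union> Q) * B ^ l)"
      unfolding bexp_sum
    proof (rule sum_mono)
      fix Q assume "Q \<in> ?H"
      then have Q4: "Q \<subseteq> {1..n}" "card Q = 4" using additive_quadrupleD by blast+
      then have "card (U \<union> Q) + 4 * l \<le> K" using card_Un_le[of U Q] Suc.prems by simp
      then show "bexp p {1..n} (\<lambda>A. of_bool (U \<union> Q \<subseteq> A \<and> Z A) * real (num_quadruples A) ^ l) \<le> p ^ card (U \<union> Q) * B ^ l"
        using Suc.prems Q4 by (intro Suc.IH) auto
    qed
    also have "\<dots> = p ^ card U * B ^ l * (\<Sum>Q\<in>?H. p ^ card (Q - U))"
      unfolding sum_distrib_left
    proof (rule sum.cong[OF refl])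
      fix Q assume "Q \<in> ?H"
      then have "finite Q" using additive_quadrupleD by blast
      moreover have "finite U" using Suc.prems finite_subset by auto
      ultimately have "card (U \<union> Q) = card U + card (Q - U)"
        using card_Un_disjoint[of U "Q - U"] by simp
      then show "p ^ card (U \<union> Q) * B ^ l = p ^ card U * B ^ l * p ^ card (Q - U)"
        by (simp add: power_add)
    qed
    also have "\<dots> \<le> p ^ card U * B ^ l * B"
      using Suc.prems True p B by (intro mult_left_mono mean) auto
    finally show ?thesis by (simp add: mult_ac)
  qed
qed

lemma restricted_upper_tail_le:
  fixes p B :: real
  assumes p: "0 \<le> p" "p \<le> 1" and B: "0 \<le> B" and lam: "0 < \<theta>" and "4 * l \<le> K"
    and dec: "\<And>U A. U \<subseteq> A \<Longrightarrow> Z A \<Longrightarrow> Z U"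
    and mean: "\<And>U. U \<subseteq> {1..n} \<Longrightarrow> Z U \<Longrightarrow> card U \<le> K
      \<Longrightarrow> (\<Sum>Q\<in>additive_quadruples {1..n}. p ^ card (Q - U)) \<le> B"
  shows "bexp p {1..n} (\<lambda>A. of_bool (\<theta> \<le> real (num_quadruples A))) \<le>
    (B / \<theta>) ^ l + bexp p {1..n} (\<lambda>A. of_bool (\<not> Z A))"
proof -
  have "bexp p {1..n} (\<lambda>A. of_bool (\<theta> \<le> real (num_quadruples A))) \<le>
      bexp p {1..n} (\<lambda>A. (1 / \<theta>) ^ l * (of_bool ({} \<subseteq> A \<and> Z A) * real (num_quadruples A) ^ l) + of_bool (\<not> Z A))"
  proof (rule bexp_mono[OF p])
    fix A assume "A \<subseteq> {1..n}"
    have "1 \<le> (1 / \<theta>) ^ l * real (num_quadruples A) ^ l" if "\<theta> \<le> real (num_quadruples A)"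
      unfolding power_mult_distrib[symmetric] using that lam by (intro one_le_power) (simp add: field_simps)
    then show "(of_bool (\<theta> \<le> real (num_quadruples A)) :: real)
      \<le> (1 / \<theta>) ^ l * (of_bool ({} \<subseteq> A \<and> Z A) * real (num_quadruples A) ^ l) + of_bool (\<not> Z A)"
      using lam by (auto simp: of_bool_def)
  qed
  also have "\<dots> = (1 / \<theta>) ^ l * bexp p {1..n} (\<lambda>A. of_bool ({} \<subseteq> A \<and> Z A) * real (num_quadruples A) ^ l)
      + bexp p {1..n} (\<lambda>A. of_bool (\<not> Z A))"
    by (simp only: bexp_add bexp_cmult)
  also have "\<dots> \<le> (1 / \<theta>) ^ l * (p ^ card ({} :: nat set) * B ^ l) + bexp p {1..n} (\<lambda>A. of_bool (\<not> Z A))"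
    using restricted_moment_le[OF p B dec mean, where U = "{}" and l = l] assms(5) lam
    by (intro add_right_mono mult_left_mono) auto
  finally show ?thesis by (simp add: power_divide)
qed

subsection \<open>Cores when the mean is polylogarithmic in \<open>1/p\<close>\<close>

lemma bexp_union_bound:
  fixes p :: real
  assumes "0 \<le> p" "p \<le> 1" "finite V" "finite \<F>" "\<And>I. I \<in> \<F> \<Longrightarrow> I \<subseteq> V"
  shows "bexp p V (\<lambda>A. of_bool (\<exists>I\<in>\<F>. I \<subseteq> A)) \<le> (\<Sum>I\<in>\<F>. p ^ card I)"
proof -
  have "bexp p V (\<lambda>A. of_bool (\<exists>I\<in>\<F>. I \<subseteq> A)) \<le> bexp p V (\<lambda>A. \<Sum>I\<in>\<F>. of_bool (I \<subseteq> A))"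
  proof (rule bexp_mono[OF assms(1,2)])
    fix A
    show "(of_bool (\<exists>I\<in>\<F>. I \<subseteq> A) :: real) \<le> (\<Sum>I\<in>\<F>. of_bool (I \<subseteq> A))"
    proof (cases "\<exists>I\<in>\<F>. I \<subseteq> A")
      case True
      then obtain I where "I \<in> \<F>" "I \<subseteq> A" by auto
      then show ?thesis using member_le_sum[of I \<F> "\<lambda>I. of_bool (I \<subseteq> A) :: real"] assms(4) by simp
    qed (simp add: sum_nonneg)
  qed
  also have "\<dots> = (\<Sum>I\<in>\<F>. p ^ card I)"
    unfolding bexp_sum using assms by (intro sum.cong) (auto simp: bexp_superset)
  finally show ?thesis .
qed

text \<open>Overlaps 0 and 4 are left out because they are the ones without gain: a disjoint
  quadruple has total weight of order \<open>n ^ 3 * q ^ 4\<close>, and a contained one adds no new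
  element. Used both for the explored set and, with \<open>U\<close> a quadruple, for overlapping
  pairs.\<close>

lemma sum_quadruples_meeting_le:
  fixes q :: real
  assumes "U \<subseteq> {1..n}" "0 \<le> q"
  shows "(\<Sum>Q | Q \<in> additive_quadruples {1..n} \<and> card (Q \<inter> U) \<in> {1,2,3}. q ^ card (Q - U))
    \<le> 3 * (card U * n ^ 2 * q ^ 3 + card U ^ 2 * n * q ^ 2 + card U ^ 3 * q)"
proof -
  let ?H = "additive_quadruples {1..n}"
  have fH: "finite ?H" by (simp add: finite_additive_quadruples)
  have "(\<Sum>Q | Q \<in> ?H \<and> card (Q \<inter> U) \<in> {1,2,3}. q ^ card (Q - U))
    \<le> (\<Sum>Q | Q \<in> ?H \<and> card (Q \<inter> U) \<in> {1,2,3}. q ^ 3 * of_bool (1 \<le> card (Q \<inter> U))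
      + q ^ 2 * of_bool (2 \<le> card (Q \<inter> U)) + q * of_bool (3 \<le> card (Q \<inter> U)))"
  proof (rule sum_mono)
    fix Q assume Q: "Q \<in> {Q. Q \<in> ?H \<and> card (Q \<inter> U) \<in> {1,2,3}}"
    then have Q4: "card Q = 4" "finite Q" using additive_quadrupleD by blast+
    have c: "card (Q - U) = 4 - card (Q \<inter> U)" using Q4 by (simp add: card_Diff_subset_Int)
    consider "card (Q \<inter> U) = 1" | "card (Q \<inter> U) = 2" | "card (Q \<inter> U) = 3" using Q by auto
    then show "q ^ card (Q - U) \<le> q ^ 3 * of_bool (1 \<le> card (Q \<inter> U))
      + q ^ 2 * of_bool (2 \<le> card (Q \<inter> U)) + q * of_bool (3 \<le> card (Q \<inter> U))"
      by cases (use c assms in simp_all)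
  qed
  also have "\<dots> \<le> (\<Sum>Q\<in>?H. q ^ 3 * of_bool (1 \<le> card (Q \<inter> U))
      + q ^ 2 * of_bool (2 \<le> card (Q \<inter> U)) + q * of_bool (3 \<le> card (Q \<inter> U)))"
    using fH assms by (intro sum_mono2) auto
  also have "\<dots> = q ^ 3 * card {Q\<in>?H. 1 \<le> card (Q \<inter> U)}
      + q ^ 2 * card {Q\<in>?H. 2 \<le> card (Q \<inter> U)} + q * card {Q\<in>?H. 3 \<le> card (Q \<inter> U)}"
    by (simp only: sum.distrib sum_distrib_left[symmetric] sum_of_bool_card[OF fH])
  also have "\<dots> \<le> q ^ 3 * (3 * card U * n ^ 2) + q ^ 2 * (3 * card U ^ 2 * n) + q * (3 * card U ^ 3)"
  proof -
    have "card {Q\<in>?H. 1 \<le> card (Q \<inter> U)} \<le> 3 * card U * n ^ 2"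
      using card_quadruples_inter_ge[OF assms(1), of 1] by simp
    moreover have "card {Q\<in>?H. 2 \<le> card (Q \<inter> U)} \<le> 3 * card U ^ 2 * n"
      using card_quadruples_inter_ge[OF assms(1), of 2] by simp
    moreover have "card {Q\<in>?H. 3 \<le> card (Q \<inter> U)} \<le> 3 * card U ^ 3"
      using card_quadruples_inter_ge[OF assms(1), of 3] by simp
    ultimately show ?thesis
      using assms by (intro add_mono mult_left_mono of_nat_mono) auto
  qed
  finally show ?thesis by (simp add: algebra_simps)
qed

text \<open>The degree condition is imposed only outside \<open>J\<close>. Hence a member that
  contains \<open>C\<close> is still a member after \<open>J\<close> is replaced by
  \<open>J \<union> C\<close>, which makes the recursion possible.\<close>

definition degree_two_extensions :: "nat \<Rightarrow> nat \<Rightarrow> nat set \<Rightarrow> nat set set" where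
  "degree_two_extensions n M J = {I. J \<subseteq> I \<and> I \<subseteq> {1..n} \<and> card I \<le> M \<and>
     (\<forall>v\<in>I - J. 2 \<le> card {Q \<in> additive_quadruples I. v \<in> Q})}"

lemma finite_degree_two_extensions [simp]: "finite (degree_two_extensions n M J)"
  by (rule finite_subset[of _ "Pow {1..n}"]) (auto simp: degree_two_extensions_def)

text \<open>The set \<open>C\<close> is either a quadruple meeting \<open>J\<close>, or the union of two
  overlapping quadruples outside \<open>J\<close>. In both cases adding \<open>C\<close> to \<open>J\<close> involves fewer
  degrees of freedom than new elements, by a margin that makes its weight small; a single
  quadruple disjoint from \<open>J\<close> would not suffice.\<close>

lemma degree_two_extension_step:
  assumes I: "I \<in> degree_two_extensions n M J" "I \<noteq> J"
  shows "\<exists>C. C \<subseteq> I \<and> (C \<in> {Q \<in> additive_quadruples {1..n}. card (Q \<inter> J) \<in> {1,2,3}} \<or>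
    (\<exists>Q\<in>additive_quadruples {1..n}. \<exists>Q'\<in>additive_quadruples {1..n}.
       C = Q \<union> Q' \<and> Q \<inter> J = {} \<and> Q' \<inter> J = {} \<and> card (Q' \<inter> Q) \<in> {1,2,3}))"
proof -
  have I': "J \<subseteq> I" "I \<subseteq> {1..n}" "\<forall>v\<in>I - J. 2 \<le> card {Q \<in> additive_quadruples I. v \<in> Q}"
    using I by (auto simp: degree_two_extensions_def)
  have aq: "Q \<in> additive_quadruples {1..n}" "Q \<subseteq> I" "card Q = 4" "finite Q" if "Q \<in> additive_quadruples I" for Q
    using that additive_quadruples_subset[OF I'(2)] additive_quadrupleD by blast+
  obtain v where v: "v \<in> I" "v \<notin> J" using I' I(2) by auto
  have "2 \<le> card {Q \<in> additive_quadruples I. v \<in> Q}" using I' v by auto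
  then obtain Y where Y: "Y \<subseteq> {Q \<in> additive_quadruples I. v \<in> Q}" "card Y = 2"
    by (metis obtain_subset_with_card_n)
  then obtain Q Q' where Q: "Q \<in> additive_quadruples I" "v \<in> Q" "Q' \<in> additive_quadruples I" "v \<in> Q'" "Q \<noteq> Q'"
    by (auto simp: card_2_iff)
  have lt4: "card (R \<inter> S) \<in> {1,2,3} \<or> R \<inter> S = {}" if "card R = 4" "finite R" "\<not> R \<subseteq> S" for R S :: "nat set"
  proof -
    have "card (R \<inter> S) < 4" using that by (metis psubset_card_mono inf_le1 inf.absorb_iff1 psubsetI)
    moreover have "R \<inter> S = {}" if "card (R \<inter> S) = 0" using that \<open>finite R\<close> by auto
    ultimately show ?thesis by fastforce
  qed
  have c1: "card (Q \<inter> J) \<in> {1,2,3} \<or> Q \<inter> J = {}" using aq[OF Q(1)] Q(2) v by (intro lt4) auto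
  have c2: "card (Q' \<inter> J) \<in> {1,2,3} \<or> Q' \<inter> J = {}" using aq[OF Q(3)] Q(4) v by (intro lt4) auto
  have "\<not> Q' \<subseteq> Q" using aq[OF Q(1)] aq[OF Q(3)] Q(5) by (metis card_subset_eq)
  then have c3: "card (Q' \<inter> Q) \<in> {1,2,3}" using lt4[of Q' Q] aq[OF Q(3)] Q(2,4) by blast
  have s: "Q \<subseteq> I" "Q' \<subseteq> I" "Q \<union> Q' \<subseteq> I" using aq[OF Q(1)] aq[OF Q(3)] by auto
  show ?thesis
  proof (cases "Q \<inter> J = {} \<and> Q' \<inter> J = {}")
    case True
    then show ?thesis using s(3) c3 aq(1)[OF Q(1)] aq(1)[OF Q(3)] by blast
  next
    case False
    then have "card (Q \<inter> J) \<in> {1,2,3} \<or> card (Q' \<inter> J) \<in> {1,2,3}" using c1 c2 by blast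
    then show ?thesis using s aq(1)[OF Q(1)] aq(1)[OF Q(3)] by blast
  qed
qed

text \<open>The bound 2 reproduces itself: I = J contributes 1, and every other member contains some
  \<open>C\<close> from \<open>degree_two_extension_step\<close>, so the rest is at most the sum
  over \<open>C\<close> of \<open>q ^ card (C - J)\<close> times the same sum for
  \<open>J \<union> C\<close>. The induction bounds the latter by 2, and \<open>small\<close> says
  that the total weight of all \<open>C\<close> is at most 1/2.\<close>

lemma sum_degree_two_extensions_le:
  fixes q :: real
  assumes q: "0 \<le> q"
    and small: "3 * (real M * n ^ 2 * q ^ 3 + real M ^ 2 * n * q ^ 2 + real M ^ 3 * q)
      + 3 * n ^ 3 * q ^ 4 * (3 * (4 * n ^ 2 * q ^ 3 + 16 * n * q ^ 2 + 64 * q)) \<le> 1 / 2"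
  shows "J \<subseteq> {1..n} \<Longrightarrow> (\<Sum>I\<in>degree_two_extensions n M J. q ^ card (I - J)) \<le> 2"
proof (induction "M - card J" arbitrary: J rule: less_induct)
  case less
  let ?H = "additive_quadruples {1..n}"
  let ?T = "\<lambda>J. \<Sum>I\<in>degree_two_extensions n M J. q ^ card (I - J)"
  have fH: "finite ?H" by (simp add: finite_additive_quadruples)
  have fJ: "finite J" using less.prems finite_subset by auto
  define X where "X = {Q \<in> ?H. card (Q \<inter> J) \<in> {1,2,3}}"
  define Y where "Y = {(Q,Q'). Q \<in> ?H \<and> Q' \<in> ?H \<and> Q \<inter> J = {} \<and> Q' \<inter> J = {} \<and> card (Q' \<inter> Q) \<in> {1,2,3}}"
  define YY where "YY = (\<lambda>(Q,Q'). Q \<union> Q') ` Y"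
  have "Y \<subseteq> ?H \<times> ?H" unfolding Y_def by auto
  then have "finite Y" by (rule finite_subset) (intro finite_cartesian_product fH)
  then have fin: "finite X" "finite Y" "finite YY"
    using fH unfolding X_def YY_def by auto
  show ?case
  proof (cases "card J \<le> M")
    case False
    have "degree_two_extensions n M J = {}"
    proof (rule equals0I)
      fix I assume "I \<in> degree_two_extensions n M J"
      then have I: "J \<subseteq> I" "I \<subseteq> {1..n}" "card I \<le> M" by (auto simp: degree_two_extensions_def)
      have "card J \<le> card I" using card_mono[OF finite_subset[OF I(2)] I(1)] by simp
      then show False using False I(3) by simp
    qed
    then show ?thesis by simp
  next
    case True
    have C: "C \<subseteq> {1..n}" "\<not> C \<subseteq> J" if "C \<in> X \<union> YY" for C
    proof -
      consider "C \<in> ?H" | Q Q' where "C = Q \<union> Q'" "Q \<in> ?H" "Q' \<in> ?H"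
        using \<open>C \<in> X \<union> YY\<close>
      proof
        assume "C \<in> YY"
        then obtain y where "y \<in> Y" "C = (\<lambda>(Q,Q'). Q \<union> Q') y" unfolding YY_def by (rule imageE)
        then show ?thesis using that(2) unfolding Y_def by (cases y) simp
      qed (use that(1) in \<open>simp add: X_def\<close>)
      then show "C \<subseteq> {1..n}" using additive_quadrupleD by cases blast+
      show "\<not> C \<subseteq> J"
      proof
        assume sub: "C \<subseteq> J"
        show False
        proof (cases "C \<in> X")
          case True
          then have "card (C \<inter> J) = 4" using sub additive_quadrupleD unfolding X_def
            by (metis (no_types, lifting) inf.absorb1 mem_Collect_eq)
          with True show False by (simp add: X_def)
        next
          case False
          then have "C \<in> YY" using \<open>C \<in> X \<union> YY\<close> by simp
          then obtain y where "y \<in> Y" "C = (\<lambda>(Q,Q'). Q \<union> Q') y" unfolding YY_def by (rule imageE)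
          then obtain Q Q' where "C = Q \<union> Q'" "Q \<in> ?H" "Q \<inter> J = {}"
            unfolding Y_def by (cases y) simp
          then have "Q = {}" "card Q = 4" using sub additive_quadrupleD by blast+
          then show False by simp
        qed
      qed
    qed
    have step: "(\<Sum>I | I \<in> degree_two_extensions n M J \<and> C \<subseteq> I. q ^ card (I - J)) \<le> q ^ card (C - J) * 2"
      if "C \<in> X \<union> YY" for C
    proof -
      have fC: "finite C" using C(1)[OF that] finite_subset by auto
      have "card J < card (J \<union> C)" using C(2)[OF that] fC fJ by (intro psubset_card_mono) auto
      \<comment> \<open>The measure \<open>M - card J\<close> is truncated and fails to decrease
        when \<open>card J = M\<close>; then \<open>J \<union> C\<close> is too large to have any
        extension and the sum is empty.\<close>
      have "?T (J \<union> C) \<le> 2"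
      proof (cases "M - card (J \<union> C) < M - card J")
        case True
        then show ?thesis using less.hyps[of "J \<union> C"] less.prems C(1)[OF that] by simp
      next
        case False
        then have "card J = M" using \<open>card J < card (J \<union> C)\<close> True by linarith
        have "degree_two_extensions n M (J \<union> C) = {}"
        proof (rule equals0I)
          fix I assume "I \<in> degree_two_extensions n M (J \<union> C)"
          then have I: "J \<union> C \<subseteq> I" "I \<subseteq> {1..n}" "card I \<le> M" by (auto simp: degree_two_extensions_def)
          have "card (J \<union> C) \<le> card I" using card_mono[OF finite_subset[OF I(2)] I(1)] by simp
          then show False using \<open>card J = M\<close> \<open>card J < card (J \<union> C)\<close> I(3) by simp
        qed
        then show ?thesis by simp
      qed
      have "(\<Sum>I | I \<in> degree_two_extensions n M J \<and> C \<subseteq> I. q ^ card (I - J))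
          \<le> (\<Sum>I\<in>degree_two_extensions n M (J \<union> C). q ^ card (I - J))"
        using q by (intro sum_mono2) (auto simp: degree_two_extensions_def)
      also have "\<dots> = (\<Sum>I\<in>degree_two_extensions n M (J \<union> C). q ^ card (C - J) * q ^ card (I - (J \<union> C)))"
      proof (rule sum.cong[OF refl])
        fix I assume "I \<in> degree_two_extensions n M (J \<union> C)"
        then have I: "J \<union> C \<subseteq> I" "finite I" unfolding degree_two_extensions_def using finite_subset by auto
        then have "I - J = (C - J) \<union> (I - (J \<union> C))" by auto
        then have "card (I - J) = card (C - J) + card (I - (J \<union> C))"
          using I fC card_Un_disjoint[of "C - J" "I - (J \<union> C)"] by force
        then show "q ^ card (I - J) = q ^ card (C - J) * q ^ card (I - (J \<union> C))" by (simp add: power_add)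
      qed
      also have "\<dots> = q ^ card (C - J) * ?T (J \<union> C)" by (simp add: sum_distrib_left)
      also have "\<dots> \<le> q ^ card (C - J) * 2" using \<open>?T (J \<union> C) \<le> 2\<close> q by (intro mult_left_mono) auto
      finally show ?thesis .
    qed
    have "?T J = (\<Sum>I\<in>{J} \<union> (degree_two_extensions n M J - {J}). q ^ card (I - J))"
      using True less.prems by (intro sum.cong) (auto simp: degree_two_extensions_def)
    also have "\<dots> = 1 + (\<Sum>I\<in>degree_two_extensions n M J - {J}. q ^ card (I - J))"
      by (subst sum.union_disjoint) auto
    also have "(\<Sum>I\<in>degree_two_extensions n M J - {J}. q ^ card (I - J))
        \<le> (\<Sum>I\<in>degree_two_extensions n M J. \<Sum>C\<in>X \<union> YY. of_bool (C \<subseteq> I) * q ^ card (I - J))"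
    proof (rule order.trans[OF sum_mono sum_mono2], goal_cases)
      case (1 I)
      then have "I \<in> degree_two_extensions n M J" "I \<noteq> J" by auto
      from degree_two_extension_step[OF this] obtain C where "C \<subseteq> I" and disj: "C \<in> X \<or>
          (\<exists>Q\<in>?H. \<exists>Q'\<in>?H. C = Q \<union> Q' \<and> Q \<inter> J = {} \<and> Q' \<inter> J = {} \<and> card (Q' \<inter> Q) \<in> {1,2,3})"
        unfolding X_def by blast
      from disj have "C \<in> X \<union> YY"
      proof
        assume "\<exists>Q\<in>?H. \<exists>Q'\<in>?H. C = Q \<union> Q' \<and> Q \<inter> J = {} \<and> Q' \<inter> J = {} \<and> card (Q' \<inter> Q) \<in> {1,2,3}"
        then obtain Q Q' where "C = Q \<union> Q'" "(Q, Q') \<in> Y" unfolding Y_def by blast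
        then have "C \<in> YY" unfolding YY_def by (intro image_eqI[of _ _ "(Q,Q')"]) simp_all
        then show ?thesis by simp
      qed simp
      then have "of_bool (C \<subseteq> I) * q ^ card (I - J) \<le> (\<Sum>C\<in>X \<union> YY. of_bool (C \<subseteq> I) * q ^ card (I - J))"
        using fin q by (intro member_le_sum) auto
      then show ?case using \<open>C \<subseteq> I\<close> by (simp only: of_bool_eq(2) mult_1_left)
    qed (use q in \<open>auto intro!: sum_nonneg\<close>)
    also have "\<dots> = (\<Sum>C\<in>X \<union> YY. \<Sum>I | I \<in> degree_two_extensions n M J \<and> C \<subseteq> I. q ^ card (I - J))"
      by (subst sum.swap) (simp add: of_bool_def if_distrib[of "\<lambda>x. x * _"] sum.If_cases Int_def cong: if_cong)
    also have "\<dots> \<le> (\<Sum>C\<in>X \<union> YY. q ^ card (C - J) * 2)"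
      by (rule sum_mono) (rule step)
    also have "\<dots> = 2 * (\<Sum>C\<in>X \<union> YY. q ^ card (C - J))" by (simp add: sum_distrib_left mult.commute)
    also have "(\<Sum>C\<in>X \<union> YY. q ^ card (C - J)) \<le> (\<Sum>C\<in>X. q ^ card (C - J)) + (\<Sum>C\<in>YY. q ^ card (C - J))"
      using fin q by (subst sum.union_inter[symmetric]) (auto intro!: sum_nonneg)
    also have "(\<Sum>C\<in>X. q ^ card (C - J)) \<le> 3 * (card J * n ^ 2 * q ^ 3 + card J ^ 2 * n * q ^ 2 + card J ^ 3 * q)"
      using sum_quadruples_meeting_le[OF less.prems q] unfolding X_def by simp
    also have "3 * (card J * n ^ 2 * q ^ 3 + card J ^ 2 * n * q ^ 2 + card J ^ 3 * q)
        \<le> 3 * (real M * n ^ 2 * q ^ 3 + real M ^ 2 * n * q ^ 2 + real M ^ 3 * q)"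
      using True q by (auto intro!: add_mono mult_right_mono power_mono)
    also have "(\<Sum>C\<in>YY. q ^ card (C - J)) \<le> (\<Sum>(Q,Q')\<in>Y. q ^ card ((Q \<union> Q') - J))"
      unfolding YY_def by (rule order.trans[OF sum_image_le]) (use fin q in \<open>auto simp: case_prod_unfold\<close>)
    \<comment> \<open>The pair is revealed in order. The first quadruple is disjoint from
      \<open>J\<close> and has weight \<open>q ^ 4\<close> with at most \<open>3 * n ^ 3\<close>
      choices; the second is summed over its overlap with the first, where the powers 4, 16, 64 of
      \<open>card Q = 4\<close> arise. The gain comes only from the second.\<close>
    also have "\<dots> \<le> (\<Sum>(Q,Q')\<in>(SIGMA Q:?H. {Q' \<in> ?H. card (Q' \<inter> Q) \<in> {1,2,3}}). q ^ 4 * q ^ card (Q' - Q))"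
    proof (rule order.trans[OF sum_mono sum_mono2], goal_cases)
      case (1 x)
      then obtain Q Q' where x: "x = (Q, Q')" "Q \<in> ?H" "Q' \<in> ?H" "Q \<inter> J = {}" "Q' \<inter> J = {}" unfolding Y_def by auto
      have f: "finite Q" "finite Q'" "card Q = 4" using x additive_quadrupleD by blast+
      have "(Q \<union> Q') - J = Q \<union> (Q' - Q)" using x by auto
      then have "card ((Q \<union> Q') - J) = 4 + card (Q' - Q)"
        using f card_Un_disjoint[of Q "Q' - Q"] by simp
      then have "q ^ card ((Q \<union> Q') - J) = q ^ 4 * q ^ card (Q' - Q)" by (simp only: power_add)
      then show ?case using x by simp
    next
      case 2 then show ?case using fH by (auto intro!: finite_SigmaI)
    next
      case 3 then show ?case unfolding Y_def by auto
    next
      case (4 b) then show ?case using q by (auto simp: case_prod_unfold)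
    qed
    also have "\<dots> = (\<Sum>Q\<in>?H. q ^ 4 * (\<Sum>Q' | Q' \<in> ?H \<and> card (Q' \<inter> Q) \<in> {1,2,3}. q ^ card (Q' - Q)))"
      using fH by (subst sum.Sigma[symmetric]) (auto simp: sum_distrib_left)
    also have "\<dots> \<le> (\<Sum>Q\<in>?H. q ^ 4 * (3 * (4 * n ^ 2 * q ^ 3 + 16 * n * q ^ 2 + 64 * q)))"
    proof (rule sum_mono)
      fix Q assume "Q \<in> ?H"
      then have "Q \<subseteq> {1..n}" "card Q = 4" using additive_quadrupleD by blast+
      then show "q ^ 4 * (\<Sum>Q' | Q' \<in> ?H \<and> card (Q' \<inter> Q) \<in> {1,2,3}. q ^ card (Q' - Q))
        \<le> q ^ 4 * (3 * (4 * n ^ 2 * q ^ 3 + 16 * n * q ^ 2 + 64 * q))"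
        using sum_quadruples_meeting_le[of Q n q] q by (intro mult_left_mono) auto
    qed
    also have "\<dots> = real (card ?H) * (q ^ 4 * (3 * (4 * n ^ 2 * q ^ 3 + 16 * n * q ^ 2 + 64 * q)))" by simp
    also have "\<dots> \<le> (3 * n ^ 3) * (q ^ 4 * (3 * (4 * n ^ 2 * q ^ 3 + 16 * n * q ^ 2 + 64 * q)))"
    proof (rule mult_right_mono)
      have "card ?H \<le> 3 * n ^ 3" using num_quadruples_le[of "{1..n}"] by (simp add: num_quadruples_def)
      then show "real (card ?H) \<le> (3 * n ^ 3)" by (metis of_nat_mono)
    qed (use q in auto)
    finally have bound: "?T J \<le> 1 + 2 * (3 * (real M * n ^ 2 * q ^ 3 + real M ^ 2 * n * q ^ 2 + real M ^ 3 * q)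
      + 3 * n ^ 3 * q ^ 4 * (3 * (4 * n ^ 2 * q ^ 3 + 16 * n * q ^ 2 + 64 * q)))"
      by (simp add: mult.assoc)
    have "1 + 2 * x \<le> 2" if "x \<le> 1 / 2" for x :: real using that by simp
    from order.trans[OF bound[unfolded of_nat_mult of_nat_power of_nat_numeral] this[OF small]]
    show ?thesis .
  qed
qed

subsection \<open>Cores when the mean is large\<close>

text \<open>A second moment computation: for a random half \<open>S\<close> each quadruple through
  \<open>v\<close> survives with probability 1/8. Two of them that share only \<open>v\<close> are
  independent, and their 1/64 cancels against the squared mean. What is left are pairs sharing a
  second element; for a given quadruple there are at most \<open>9 * card I\<close> of these, since
  \<open>v\<close>, the shared element and a third element determine the other quadruple up to three
  choices.\<close>

lemma deviation_from_mean_half_le: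
  assumes "finite I" "v \<in> I"
  defines "\<Q> \<equiv> {Q \<in> additive_quadruples I. v \<in> Q}"
  shows "bexp (1/2) I (\<lambda>S. (real (card {Q \<in> \<Q>. Q - {v} \<subseteq> S}) - card \<Q> / 8) ^ 2) \<le> 9 * real (card I) * card \<Q>"
proof -
  have f\<Q>: "finite \<Q>" using assms finite_additive_quadruples by auto
  have Q: "Q \<subseteq> I" "card (Q - {v}) = 3" "finite Q" "v \<in> Q" if "Q \<in> \<Q>" for Q
    using that additive_quadrupleD[of Q I] unfolding \<Q>_def by auto
  have "bexp (1/2) I (\<lambda>S. (real (card {Q \<in> \<Q>. Q - {v} \<subseteq> S}) - card \<Q> / 8) ^ 2)
      = bexp (1/2) I (\<lambda>S. (\<Sum>Q\<in>\<Q>. \<Sum>Q'\<in>\<Q>. of_bool ((Q - {v}) \<union> (Q' - {v}) \<subseteq> S))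
          - (card \<Q> / 4) * (\<Sum>Q\<in>\<Q>. of_bool (Q - {v} \<subseteq> S)) + (real (card \<Q>))^2 / 64)"
  proof (rule bexp_cong)
    fix S
    have sq: "(x - c / 8) ^ 2 = x * x - c / 4 * x + c ^ 2 / 64" for x c :: real
      by (simp add: power2_eq_square field_simps)
    have e: "real (card {Q \<in> \<Q>. Q - {v} \<subseteq> S}) = (\<Sum>Q\<in>\<Q>. of_bool (Q - {v} \<subseteq> S))"
      by (simp only: sum_of_bool_card[OF f\<Q>])
    have "(\<Sum>Q\<in>\<Q>. \<Sum>Q'\<in>\<Q>. of_bool ((Q - {v}) \<union> (Q' - {v}) \<subseteq> S))
        = (\<Sum>Q\<in>\<Q>. of_bool (Q - {v} \<subseteq> S)) * (\<Sum>Q\<in>\<Q>. of_bool (Q - {v} \<subseteq> S) :: real)"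
      unfolding sum_product by (intro sum.cong refl) (auto simp: of_bool_def)
    then show "(real (card {Q \<in> \<Q>. Q - {v} \<subseteq> S}) - card \<Q> / 8) ^ 2
      = (\<Sum>Q\<in>\<Q>. \<Sum>Q'\<in>\<Q>. of_bool ((Q - {v}) \<union> (Q' - {v}) \<subseteq> S))
          - (card \<Q> / 4) * (\<Sum>Q\<in>\<Q>. of_bool (Q - {v} \<subseteq> S)) + (real (card \<Q>))^2 / 64"
      unfolding e sq by simp
  qed
  also have "\<dots> = (\<Sum>Q\<in>\<Q>. \<Sum>Q'\<in>\<Q>. (1/2) ^ card ((Q - {v}) \<union> (Q' - {v})))
      - (card \<Q> / 4) * (\<Sum>Q\<in>\<Q>. 1/8) + (real (card \<Q>))^2 / 64"
  proof -
    have 1: "(\<Sum>Q\<in>\<Q>. \<Sum>Q'\<in>\<Q>. bexp (1/2) I (\<lambda>S. of_bool ((Q - {v}) \<union> (Q' - {v}) \<subseteq> S)))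
        = (\<Sum>Q\<in>\<Q>. \<Sum>Q'\<in>\<Q>. (1/2) ^ card ((Q - {v}) \<union> (Q' - {v})))"
      using assms(1) Q by (intro sum.cong refl bexp_superset) blast+
    have 2: "(\<Sum>Q\<in>\<Q>. bexp (1/2) I (\<lambda>S. of_bool (Q - {v} \<subseteq> S))) = (\<Sum>Q\<in>\<Q>. 1/8)"
    proof (rule sum.cong[OF refl])
      fix R assume "R \<in> \<Q>"
      then show "bexp (1/2) I (\<lambda>S. of_bool (R - {v} \<subseteq> S)) = 1/8"
        using Q[of R] assms(1) bexp_superset[of I "R - {v}" "1/2"] by (auto simp: power_divide)
    qed
    show ?thesis
      unfolding bexp_add bexp_diff bexp_cmult bexp_sum bexp_const[OF assms(1)] 1 2 ..
  qed
  also have "(\<Sum>Q\<in>\<Q>. \<Sum>Q'\<in>\<Q>. (1/2) ^ card ((Q - {v}) \<union> (Q' - {v})))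
      \<le> (\<Sum>Q\<in>\<Q>. card \<Q> / 64 + 9 * real (card I))"
  proof (rule sum_mono)
    fix R assume R: "R \<in> \<Q>"
    have "(\<Sum>Q'\<in>\<Q>. (1/2) ^ card ((R - {v}) \<union> (Q' - {v})))
        \<le> (\<Sum>Q'\<in>\<Q>. 1/64 + of_bool ((R - {v}) \<inter> (Q' - {v}) \<noteq> {}) :: real)"
    proof (rule sum_mono)
      fix Q' assume Q': "Q' \<in> \<Q>"
      show "(1/2) ^ card ((R - {v}) \<union> (Q' - {v})) \<le> (1/64 + of_bool ((R - {v}) \<inter> (Q' - {v}) \<noteq> {}) :: real)"
      proof (cases "(R - {v}) \<inter> (Q' - {v}) = {}")
        case True
        then have "card ((R - {v}) \<union> (Q' - {v})) = 6"
          using Q[OF R] Q[OF Q'] by (subst card_Un_disjoint) auto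
        then show ?thesis by (simp add: power_divide)
      next
        case False
        have "(1/2 :: real) ^ card ((R - {v}) \<union> (Q' - {v})) \<le> 1" by (intro power_le_one) auto
        then show ?thesis using False by simp
      qed
    qed
    also have "\<dots> = card \<Q> / 64 + real (card {Q' \<in> \<Q>. (R - {v}) \<inter> (Q' - {v}) \<noteq> {}})"
      by (simp add: sum.distrib sum_of_bool_card[OF f\<Q>])
    also have "card {Q' \<in> \<Q>. (R - {v}) \<inter> (Q' - {v}) \<noteq> {}} \<le> 3 * card {v} * card (R - {v}) * card I"
    proof (rule order.trans[OF card_mono card_quadruples_meeting_le])
      show "{Q' \<in> \<Q>. (R - {v}) \<inter> (Q' - {v}) \<noteq> {}} \<subseteq> {Q \<in> additive_quadruples I.
          \<exists>a\<in>{v}. \<exists>b\<in>R - {v}. \<exists>c\<in>I. a \<in> Q \<and> b \<in> Q \<and> c \<in> Q \<and> card {a,b,c} = 3}"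
      proof
        fix Q' assume "Q' \<in> {Q' \<in> \<Q>. (R - {v}) \<inter> (Q' - {v}) \<noteq> {}}"
        then obtain b where b: "Q' \<in> \<Q>" "b \<in> R" "b \<noteq> v" "b \<in> Q'" by auto
        have "card (Q' - {v} - {b}) = 2" using Q[OF b(1)] b by (subst card_Diff_singleton) auto
        then have "Q' - {v} - {b} \<noteq> {}" by (metis card.empty zero_neq_numeral)
        then obtain c where c: "c \<in> Q' - {v} - {b}" by blast
        have "card {v, b, c} = 3" using b c by auto
        then show "Q' \<in> {Q \<in> additive_quadruples I.
          \<exists>a\<in>{v}. \<exists>b\<in>R - {v}. \<exists>c\<in>I. a \<in> Q \<and> b \<in> Q \<and> c \<in> Q \<and> card {a,b,c} = 3}"
          using b c Q[OF b(1)] unfolding \<Q>_def by blast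
      qed
    qed (use assms(1) finite_additive_quadruples Q[OF R] in auto)
    also have "3 * card {v} * card (R - {v}) * card I = 9 * card I" using Q[OF R] by simp
    finally show "(\<Sum>Q'\<in>\<Q>. (1/2) ^ card ((R - {v}) \<union> (Q' - {v}))) \<le> card \<Q> / 64 + 9 * real (card I)" by simp
  qed
  finally show ?thesis by (simp add: algebra_simps power2_eq_square)
qed

text \<open>For a random half \<open>S\<close>, an element is outside \<open>S\<close> with
  probability 1/2. Its degree into \<open>S\<close> has mean at least D/8 and falls below D/16 with
  probability at most 1/8 by Chebyshev, whose bound is \<open>2304 * card I / d\<close>; this is
  where 18432 = 8 * 2304 comes from. So in expectation 3/8 of the elements are good, and some
  \<open>S\<close> has more than a third. Passing from \<open>S\<close> to the larger set
  \<open>I - T\<close> only increases the degrees.\<close>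

lemma exists_determined_third:
  fixes D :: real
  assumes "finite I" "I \<noteq> {}" and D: "18432 * real (card I) \<le> D"
    and deg: "\<And>v. v \<in> I \<Longrightarrow> D \<le> real (card {Q \<in> additive_quadruples I. v \<in> Q})"
  shows "\<exists>T\<subseteq>I. card T = (card I + 2) div 3 \<and>
    (\<forall>v\<in>T. D / 16 \<le> real (card {Q \<in> additive_quadruples I. v \<in> Q \<and> Q - {v} \<subseteq> I - T}))"
proof -
  define f where "f v S = real (card {Q \<in> additive_quadruples I. v \<in> Q \<and> Q - {v} \<subseteq> S})" for v S
  define g where "g S = (\<Sum>v\<in>I. of_bool (v \<notin> S \<and> D / 16 \<le> f v S) :: real)" for S
  have m: "card I > 0" using assms by (simp add: card_gt_0_iff)
  have Dpos: "D > 0" using D m by (smt (verit) of_nat_0_less_iff mult_pos_pos)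
  have low: "bexp (1/2) I (\<lambda>S. of_bool (f v S < D / 16)) \<le> 1/8" if v: "v \<in> I" for v
  proof -
    define d where "d = real (card {Q \<in> additive_quadruples I. v \<in> Q})"
    have d: "D \<le> d" "d > 0" using deg[OF v] Dpos unfolding d_def by auto
    have eq: "{Q \<in> {Q \<in> additive_quadruples I. v \<in> Q}. Q - {v} \<subseteq> S}
        = {Q \<in> additive_quadruples I. v \<in> Q \<and> Q - {v} \<subseteq> S}" for S by auto
    have "bexp (1/2) I (\<lambda>S. of_bool (f v S < D / 16)) \<le> bexp (1/2) I (\<lambda>S. (256 / d^2) * (f v S - d / 8) ^ 2)"
    proof (rule bexp_mono)
      fix S
      show "(of_bool (f v S < D / 16) :: real) \<le> (256 / d^2) * (f v S - d / 8) ^ 2"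
      proof (cases "f v S < D / 16")
        case True
        then have "d / 16 \<le> d / 8 - f v S" using d by simp
        then have "(d / 16)^2 \<le> (d / 8 - f v S)^2" using d by (intro power_mono) auto
        then have "1 \<le> (256 / d^2) * (d / 8 - f v S)^2" using d by (simp add: field_simps)
        then show ?thesis using True by (simp add: power2_commute)
      qed simp
    qed auto
    also have "\<dots> = (256 / d^2) * bexp (1/2) I (\<lambda>S. (f v S - d / 8) ^ 2)" by (rule bexp_cmult)
    also have "\<dots> \<le> (256 / d^2) * (9 * real (card I) * d)"
      using deviation_from_mean_half_le[OF assms(1) v] unfolding f_def d_def eq
      by (intro mult_left_mono) auto
    also have "(256 / d^2) * (9 * real (card I) * d) = 2304 * real (card I) / d"
      using d by (simp add: field_simps power2_eq_square)
    also have "\<dots> \<le> 1/8" using D d by (simp add: field_simps)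
    finally show ?thesis .
  qed
  have "(\<Sum>v\<in>I. 3/8) \<le> (\<Sum>v\<in>I. bexp (1/2) I (\<lambda>S. of_bool (v \<notin> S \<and> D / 16 \<le> f v S)))"
  proof (rule sum_mono)
    fix v assume v: "v \<in> I"
    have "1 - 1/2 - 1/8 \<le> bexp (1/2) I (\<lambda>S. 1 - of_bool ({v} \<subseteq> S) - of_bool (f v S < D / 16))"
    proof -
      have "bexp (1/2) I (\<lambda>S. of_bool ({v} \<subseteq> S)) = 1/2"
        by (subst bexp_superset) (use v assms(1) in auto)
      then show ?thesis unfolding bexp_diff bexp_const[OF assms(1)] using low[OF v] by linarith
    qed
    also have "\<dots> \<le> bexp (1/2) I (\<lambda>S. of_bool (v \<notin> S \<and> D / 16 \<le> f v S))"
      by (rule bexp_mono) (auto simp: of_bool_def)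
    finally show "3/8 \<le> bexp (1/2) I (\<lambda>S. of_bool (v \<notin> S \<and> D / 16 \<le> f v S))" by simp
  qed
  then have Eg: "3/8 * real (card I) \<le> bexp (1/2) I g" unfolding g_def bexp_sum by simp
  have "\<exists>S\<subseteq>I. real (card I) / 3 < g S"
  proof (rule ccontr)
    assume "\<not> ?thesis"
    then have "bexp (1/2) I g \<le> bexp (1/2) I (\<lambda>_. real (card I) / 3)"
      by (intro bexp_mono) (auto simp: not_less)
    then show False using Eg m assms(1) by (simp add: bexp_const)
  qed
  then obtain S where S: "S \<subseteq> I" "real (card I) / 3 < g S" by auto
  have "g S = real (card {v \<in> I. v \<notin> S \<and> D / 16 \<le> f v S})" unfolding g_def by (rule sum_of_bool_card[OF assms(1)])
  then have "card I < 3 * card {v \<in> I. v \<notin> S \<and> D / 16 \<le> f v S}" using S(2) by linarith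
  then have "(card I + 2) div 3 \<le> card {v \<in> I. v \<notin> S \<and> D / 16 \<le> f v S}" by linarith
  then obtain T where T: "T \<subseteq> {v \<in> I. v \<notin> S \<and> D / 16 \<le> f v S}" "card T = (card I + 2) div 3"
    by (rule obtain_subset_with_card_n)
  have "D / 16 \<le> f v (I - T)" if "v \<in> T" for v
  proof -
    have "S \<subseteq> I - T" using S T by auto
    then have "f v S \<le> f v (I - T)" unfolding f_def
      using finite_additive_quadruples[OF assms(1)] by (intro of_nat_mono card_mono) auto
    then show ?thesis using T that by force
  qed
  then show ?thesis using T unfolding f_def by (intro exI[of _ T]) auto
qed

text \<open>Double counting: a quadruple with exactly one element outside \<open>S\<close> is
  counted for that element only, and there are at most \<open>3 * card S ^ 3\<close> quadruples with
  three elements in \<open>S\<close>.\<close>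

lemma card_determined_elements_le:
  fixes \<theta> :: real
  assumes "S \<subseteq> {1..n}"
  shows "real (card {v \<in> {1..n} - S. \<theta> \<le> real (card {Q \<in> additive_quadruples {1..n}. v \<in> Q \<and> Q - {v} \<subseteq> S})}) * \<theta>
    \<le> 3 * real (card S) ^ 3"
proof -
  let ?H = "additive_quadruples {1..n}"
  define W where "W = {v \<in> {1..n} - S. \<theta> \<le> real (card {Q \<in> ?H. v \<in> Q \<and> Q - {v} \<subseteq> S})}"
  have fH: "finite ?H" by (simp add: finite_additive_quadruples)
  have fW: "finite W" unfolding W_def by auto
  have "real (card W) * \<theta> = (\<Sum>v\<in>W. \<theta>)" by simp
  also have "\<dots> \<le> (\<Sum>v\<in>W. real (card {Q \<in> ?H. v \<in> Q \<and> Q - {v} \<subseteq> S}))"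
    by (rule sum_mono) (simp add: W_def)
  also have "\<dots> = real (card (\<Union>v\<in>W. {Q \<in> ?H. v \<in> Q \<and> Q - {v} \<subseteq> S}))"
  proof (subst card_UN_disjoint)
    show "\<forall>i\<in>W. \<forall>j\<in>W. i \<noteq> j \<longrightarrow> {Q \<in> ?H. i \<in> Q \<and> Q - {i} \<subseteq> S} \<inter> {Q \<in> ?H. j \<in> Q \<and> Q - {j} \<subseteq> S} = {}"
      unfolding W_def by blast
  qed (use fH fW in auto)
  also have "card (\<Union>v\<in>W. {Q \<in> ?H. v \<in> Q \<and> Q - {v} \<subseteq> S}) \<le> card {Q \<in> ?H. 3 \<le> card (Q \<inter> S)}"
  proof (rule card_mono)
    show "(\<Union>v\<in>W. {Q \<in> ?H. v \<in> Q \<and> Q - {v} \<subseteq> S}) \<subseteq> {Q \<in> ?H. 3 \<le> card (Q \<inter> S)}"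
    proof
      fix Q assume "Q \<in> (\<Union>v\<in>W. {Q \<in> ?H. v \<in> Q \<and> Q - {v} \<subseteq> S})"
      then obtain v where v: "Q \<in> ?H" "v \<in> Q" "Q - {v} \<subseteq> S" by auto
      have "card Q = 4" "finite Q" using v additive_quadrupleD by blast+
      then have "card (Q - {v}) = 3" using v by simp
      moreover have "card (Q - {v}) \<le> card (Q \<inter> S)" using v \<open>finite Q\<close> by (intro card_mono) auto
      ultimately show "Q \<in> {Q \<in> ?H. 3 \<le> card (Q \<inter> S)}" using v by simp
    qed
  qed (use fH in auto)
  also have "card {Q \<in> ?H. 3 \<le> card (Q \<inter> S)} \<le> 3 * card S ^ 3"
    using card_quadruples_inter_ge[OF assms, of 3] by simp
  finally show ?thesis unfolding W_def by simp
qed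

lemma binomial_le_power_3:
  assumes "t > 0"
  shows "real (N choose t) \<le> (3 * real N / real t) ^ t"
proof -
  have "real t ^ t / fact t \<le> exp (real t)"
  proof -
    have "(\<lambda>k. real t ^ k / fact k) sums exp (real t)"
      using exp_converges[of "real t"] by (simp add: divide_inverse mult.commute)
    then show ?thesis using sum_le_suminf[of "\<lambda>k. real t ^ k / fact k" "{t}"] by (simp add: sums_iff)
  qed
  also have "exp (real t) = exp 1 ^ t" by (simp add: exp_of_nat_mult[symmetric])
  also have "\<dots> \<le> 3 ^ t" using exp_le by (intro power_mono) auto
  finally have f: "real t ^ t / 3 ^ t \<le> fact t" by (simp add: field_simps)
  have "real (N choose t) * fact t \<le> real N ^ t"
    by (metis binomial_fact_pow of_nat_fact of_nat_le_iff of_nat_mult of_nat_power)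
  then have "real (N choose t) * (real t ^ t / 3 ^ t) \<le> real N ^ t"
    using f by (meson mult_left_mono of_nat_0_le_iff order.trans)
  then show ?thesis using assms by (simp add: field_simps power_mult_distrib power_divide)
qed

text \<open>The set is encoded by the pair \<open>(I - T, T)\<close>. The first part is arbitrary;
  the second is chosen among the elements determined by the first, of which there are at most
  \<open>48 * s ^ 3 / D\<close>. The factor 144 is 48 times the 3 of
  \<open>binomial_le_power_3\<close>.\<close>

lemma card_high_degree_sets_le:
  fixes D :: real
  assumes "m \<ge> 2" and D: "18432 * real m \<le> D"
  defines "t \<equiv> (m + 2) div 3"
  defines "s \<equiv> m - t"
  shows "real (card {I. I \<subseteq> {1..n} \<and> card I = m \<and> (\<forall>v\<in>I. D \<le> real (card {Q \<in> additive_quadruples I. v \<in> Q}))})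
    \<le> (3 * real n / s) ^ s * (144 * real s ^ 3 / (D * t)) ^ t"
proof -
  let ?H = "additive_quadruples {1..n}"
  let ?W = "\<lambda>S. {v \<in> {1..n} - S. D / 16 \<le> real (card {Q \<in> ?H. v \<in> Q \<and> Q - {v} \<subseteq> S})}"
  let ?C = "{I. I \<subseteq> {1..n} \<and> card I = m \<and> (\<forall>v\<in>I. D \<le> real (card {Q \<in> additive_quadruples I. v \<in> Q}))}"
  let ?SS = "{S. S \<subseteq> {1..n} \<and> card S = s}"
  let ?TT = "\<lambda>S. {T. T \<subseteq> ?W S \<and> card T = t}"
  have t: "t > 0" "s > 0" "t \<le> m" using assms(1) unfolding t_def s_def by linarith+
  have Dpos: "D > 0" using D assms(1) by (smt (verit) of_nat_0_less_iff mult_pos_pos less_le_trans zero_less_numeral)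
  have fSS: "finite ?SS" by (rule finite_subset[of _ "Pow {1..n}"]) auto
  have fTT: "finite (?TT S)" for S by (rule finite_subset[of _ "Pow {1..n}"]) auto
  have fin: "finite (SIGMA S:?SS. ?TT S)" using fSS fTT by (rule finite_SigmaI)
  have "?C \<subseteq> (\<lambda>(S,T). S \<union> T) ` (SIGMA S:?SS. ?TT S)"
  proof
    fix I assume I: "I \<in> ?C"
    then have fI: "finite I" using finite_subset by auto
    have "I \<noteq> {}" using I assms(1) by auto
    then obtain T where T: "T \<subseteq> I" "card T = t"
      "\<And>v. v \<in> T \<Longrightarrow> D / 16 \<le> real (card {Q \<in> additive_quadruples I. v \<in> Q \<and> Q - {v} \<subseteq> I - T})"
      using exists_determined_third[of I D] I D fI unfolding t_def by blast
    have fT: "finite T" using T fI finite_subset by auto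
    have "D / 16 \<le> real (card {Q \<in> ?H. v \<in> Q \<and> Q - {v} \<subseteq> I - T})" if "v \<in> T" for v
    proof -
      have "card {Q \<in> additive_quadruples I. v \<in> Q \<and> Q - {v} \<subseteq> I - T} \<le> card {Q \<in> ?H. v \<in> Q \<and> Q - {v} \<subseteq> I - T}"
        using I additive_quadruples_subset[of I "{1..n}"]
        by (intro card_mono) (auto simp: finite_additive_quadruples)
      then show ?thesis using T(3)[OF that] by linarith
    qed
    moreover have "v \<in> {1..n} - (I - T)" if "v \<in> T" for v using T I that by auto
    ultimately have "T \<in> ?TT (I - T)" using T(2) by blast
    moreover have "I - T \<in> ?SS" using I T fT by (auto simp: s_def card_Diff_subset)
    ultimately have "(I - T, T) \<in> (SIGMA S:?SS. ?TT S)" by (rule SigmaI[rotated])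
    moreover have "I = (\<lambda>(S,T). S \<union> T) (I - T, T)" using T by auto
    ultimately show "I \<in> (\<lambda>(S,T). S \<union> T) ` (SIGMA S:?SS. ?TT S)" by (rule rev_image_eqI)
  qed
  then have "card ?C \<le> card (SIGMA S:?SS. ?TT S)" using fin by (rule surj_card_le[rotated])
  also have "\<dots> = (\<Sum>S\<in>?SS. card (?TT S))"
    using fSS fTT by (intro card_SigmaI ballI)
  finally have "real (card ?C) \<le> (\<Sum>S\<in>?SS. real (card (?TT S)))"
    unfolding of_nat_sum[symmetric] of_nat_le_iff .
  also have "\<dots> \<le> (\<Sum>S\<in>?SS. (144 * real s ^ 3 / (D * t)) ^ t)"
  proof (rule sum_mono)
    fix S assume S: "S \<in> ?SS"
    have "card (?TT S) = card (?W S) choose t" by (rule n_subsets) auto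
    then have "real (card (?TT S)) \<le> (3 * real (card (?W S)) / t) ^ t" using binomial_le_power_3[OF t(1)] by simp
    also have "\<dots> \<le> (144 * real s ^ 3 / (D * t)) ^ t"
    proof (rule power_mono)
      have "real (card (?W S)) * (D / 16) \<le> 3 * real s ^ 3"
        using card_determined_elements_le[of S n "D / 16"] S by simp
      then have "3 * real (card (?W S)) \<le> 144 * real s ^ 3 / D" using Dpos by (simp add: field_simps)
      then show "3 * real (card (?W S)) / t \<le> 144 * real s ^ 3 / (D * t)"
        using t by (simp add: divide_right_mono flip: divide_divide_eq_left)
    qed auto
    finally show "real (card (?TT S)) \<le> (144 * real s ^ 3 / (D * t)) ^ t" .
  qed
  also have "\<dots> = real (n choose s) * (144 * real s ^ 3 / (D * t)) ^ t" using n_subsets[of "{1..n}" s] by simp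
  also have "\<dots> \<le> (3 * real n / s) ^ s * (144 * real s ^ 3 / (D * t)) ^ t"
    using binomial_le_power_3[OF t(2)] Dpos by (intro mult_right_mono) auto
  finally show ?thesis .
qed

subsection \<open>Lower bound by disjoint ranges\<close>

lemma num_quadruples_mono: "finite B \<Longrightarrow> A \<subseteq> B \<Longrightarrow> num_quadruples A \<le> num_quadruples B"
  unfolding num_quadruples_def
  by (intro card_mono finite_additive_quadruples) (auto simp: additive_quadruples_def)

lemma bexp_domain_mono:
  assumes p: "0 \<le> p" "p \<le> 1" and V: "finite V'" "V \<subseteq> V'"
    and mono: "\<And>A B. A \<subseteq> B \<Longrightarrow> B \<subseteq> V' \<Longrightarrow> f A \<le> f B"
  shows "bexp p V f \<le> bexp p V' f"
proof -
  have fV: "finite V" using V finite_subset by auto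
  have "bexp p V f = bexp p V (\<lambda>A. bexp p (V' - V) (\<lambda>B. f A))" using V by (simp add: bexp_const)
  also have "\<dots> \<le> bexp p V (\<lambda>A. bexp p (V' - V) (\<lambda>B. f (A \<union> B)))"
    using V by (intro bexp_mono[OF p] mono) auto
  also have "\<dots> = bexp p (V \<union> (V' - V)) f" using V fV by (intro bexp_union[symmetric]) auto
  also have "V \<union> (V' - V) = V'" using V by auto
  finally show ?thesis .
qed

lemma upper_tail_ge_planted:
  fixes p :: real
  assumes "0 \<le> p" "p \<le> 1" "m \<le> n" "\<theta> \<le> real (num_quadruples {1..m})"
  shows "p ^ m \<le> bexp p {1..n} (\<lambda>A. of_bool (\<theta> \<le> real (num_quadruples A)))"
proof -
  have "p ^ m = bexp p {1..n} (\<lambda>A. of_bool ({1..m} \<subseteq> A))"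
    using bexp_superset[of "{1..n}" "{1..m}" p] assms(3) by simp
  also have "\<dots> \<le> bexp p {1..n} (\<lambda>A. of_bool (\<theta> \<le> real (num_quadruples A)))"
  proof (rule bexp_mono[OF assms(1,2)])
    fix A assume A: "A \<subseteq> {1..n}"
    have "\<theta> \<le> real (num_quadruples A)" if "{1..m} \<subseteq> A"
      using num_quadruples_mono[OF finite_subset[OF A] that] assms(4) by simp
    then show "(of_bool ({1..m} \<subseteq> A) :: real) \<le> of_bool (\<theta> \<le> real (num_quadruples A))" by auto
  qed
  finally show ?thesis .
qed

text \<open>With \<open>x1 \<in> {1..h}\<close>, \<open>x2 \<in> {6h+1..7h}\<close> and \<open>y1 \<in> {2h+1..3h}\<close>, the fourth
  element \<open>x1 + x2 - y1\<close> lies in \<open>{3h+1..6h}\<close>, so the four ranges are disjoint.\<close>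

lemma separated_quadruple:
  assumes "x1 \<in> {1..h}" "x2 \<in> {6*h+1..7*h}" "y \<in> {2*h+1..3*h}" "x1 + x2 = y + z"
  shows "z \<in> {3*h+1..6*h}" "{x1,x2,y,z} \<in> additive_quadruples UNIV"
proof -
  show z: "z \<in> {3*h+1..6*h}" using assms by auto
  have "card {x1,x2,y,z} = 4" using assms z by auto
  then show "{x1,x2,y,z} \<in> additive_quadruples UNIV"
    using assms(4) unfolding additive_quadruples_def by blast
qed

text \<open>Because the four ranges are disjoint, the set reveals which element plays which role, so
  distinct triples give distinct quadruples.\<close>

lemma num_quadruples_ge_cube:
  assumes "7 * h \<le> n"
  shows "h ^ 3 \<le> num_quadruples {1..n}"
proof -
  let ?T = "{1..h} \<times> {6*h+1..7*h} \<times> {2*h+1..3*h}"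
  let ?q = "\<lambda>(x1,x2,y). {x1,x2,y,x1+x2-y}"
  have inj: "inj_on ?q ?T"
  proof (rule inj_onI)
    fix \<tau> \<tau>' assume a: "\<tau> \<in> ?T" "\<tau>' \<in> ?T" "?q \<tau> = ?q \<tau>'"
    obtain x1 x2 y where t: "\<tau> = (x1,x2,y)" by (cases \<tau>)
    obtain x1' x2' y' where t': "\<tau>' = (x1',x2',y')" by (cases \<tau>')
    let ?z = "x1 + x2 - y" and ?z' = "x1' + x2' - y'"
    have b: "x1 \<in> {1..h}" "x2 \<in> {6*h+1..7*h}" "y \<in> {2*h+1..3*h}"
      "x1' \<in> {1..h}" "x2' \<in> {6*h+1..7*h}" "y' \<in> {2*h+1..3*h}" using a t t' by auto
    then have z: "?z \<in> {3*h+1..6*h}" "?z' \<in> {3*h+1..6*h}"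
      by (auto intro!: separated_quadruple(1)[of x1 h x2 y] separated_quadruple(1)[of x1' h x2' y'])
    have eq: "{x1,x2,y,?z} = {x1',x2',y',?z'}" using a(3) t t' by simp
    have "x1 \<in> {x1',x2',y',?z'}" "x2 \<in> {x1',x2',y',?z'}" "y \<in> {x1',x2',y',?z'}" using eq by blast+
    then have "x1 = x1'" "x2 = x2'" "y = y'" using b z by auto
    then show "\<tau> = \<tau>'" using t t' by simp
  qed
  have "?q ` ?T \<subseteq> additive_quadruples {1..n}"
  proof
    fix Q assume "Q \<in> ?q ` ?T"
    then obtain x1 x2 y where b: "x1 \<in> {1..h}" "x2 \<in> {6*h+1..7*h}" "y \<in> {2*h+1..3*h}"
      "Q = {x1,x2,y,x1+x2-y}" by auto
    have "x1 + x2 = y + (x1 + x2 - y)" using b by auto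
    note sq = separated_quadruple[OF b(1-3) this]
    show "Q \<in> additive_quadruples {1..n}"
      using sq b assms additive_quadruples_subset[of "{1..n}" UNIV] by auto
  qed
  then have "card ?T \<le> card (additive_quadruples {1..n})"
    by (rule card_inj_on_le[OF inj]) (simp add: finite_additive_quadruples)
  then show ?thesis unfolding num_quadruples_def by (simp add: card_cartesian_product power3_eq_cube)
qed

section \<open>Many distinct sums x1 + x2 - y from three short intervals\<close>

lemma card_le_card_image_plus_collisions:
  assumes "finite S"
  shows "card S \<le> card (f ` S) + card {(x,y) \<in> S \<times> S. x \<noteq> y \<and> f x = f y}"
proof -
  \<comment> \<open>\<open>\<rho>\<close> picks one representative per fibre of \<open>f\<close>.
    Representatives inject into the image, and every other \<open>x\<close> yields its own collision
    \<open>(x, \<rho> x)\<close>.\<close>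
  define \<rho> where "\<rho> x = (SOME y. y \<in> S \<and> f y = f x)" for x
  have \<rho>: "\<rho> x \<in> S" "f (\<rho> x) = f x" if "x \<in> S" for x
    using someI[of "\<lambda>y. y \<in> S \<and> f y = f x" x] that unfolding \<rho>_def by auto
  have \<rho>eq: "\<rho> x = \<rho> y" if "f x = f y" for x y using that unfolding \<rho>_def by simp
  let ?F = "{x \<in> S. \<rho> x = x}" and ?G = "{x \<in> S. \<rho> x \<noteq> x}"
  have "card ?F \<le> card (f ` S)"
  proof (rule card_inj_on_le[of f])
    show "inj_on f ?F"
    proof (rule inj_onI)
      fix x y assume a: "x \<in> ?F" "y \<in> ?F" "f x = f y"
      have "\<rho> x = \<rho> y" using a(3) by (rule \<rho>eq)
      then show "x = y" using a(1,2) by simp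
    qed
  qed (use assms in auto)
  moreover have "card ?G \<le> card {(x,y) \<in> S \<times> S. x \<noteq> y \<and> f x = f y}"
  proof (rule card_inj_on_le[of "\<lambda>x. (x, \<rho> x)"])
    show "(\<lambda>x. (x, \<rho> x)) ` ?G \<subseteq> {(x,y) \<in> S \<times> S. x \<noteq> y \<and> f x = f y}"
    proof
      fix z assume "z \<in> (\<lambda>x. (x, \<rho> x)) ` ?G"
      then obtain x where x: "z = (x, \<rho> x)" "x \<in> S" "\<rho> x \<noteq> x" by blast
      then show "z \<in> {(x,y) \<in> S \<times> S. x \<noteq> y \<and> f x = f y}" using \<rho>[OF x(2)] by simp
    qed
    show "finite {(x,y) \<in> S \<times> S. x \<noteq> y \<and> f x = f y}"
      by (rule finite_subset[of _ "S \<times> S"]) (use assms in auto)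
  qed (simp add: inj_on_def)
  moreover have "S = ?F \<union> ?G" by auto
  then have "card S \<le> card ?F + card ?G" by (metis card_Un_le)
  ultimately show ?thesis by linarith
qed

lemma bexp_card_inter:
  fixes p :: real
  assumes "finite V" "U \<subseteq> V"
  shows "bexp p V (\<lambda>A. real (card (A \<inter> U))) = card U * p"
proof -
  have fU: "finite U" using assms finite_subset by auto
  have "real (card (A \<inter> U)) = (\<Sum>u\<in>U. of_bool ({u} \<subseteq> A))" for A
    using fU by (simp only: sum_of_bool_card) (auto intro!: arg_cong[where f = card])
  then have "bexp p V (\<lambda>A. real (card (A \<inter> U))) = (\<Sum>u\<in>U. bexp p V (\<lambda>A. of_bool ({u} \<subseteq> A)))"
    by (simp only: bexp_sum)
  also have "\<dots> = (\<Sum>u\<in>U. p)"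
  proof (rule sum.cong[OF refl])
    fix u assume "u \<in> U"
    then show "bexp p V (\<lambda>A. of_bool ({u} \<subseteq> A)) = p"
      using assms by (subst bexp_superset) auto
  qed
  finally show ?thesis by simp
qed

lemma bexp_card_inter_squared_le:
  fixes p :: real
  assumes "finite V" "U \<subseteq> V" "0 \<le> p" "p \<le> 1"
  shows "bexp p V (\<lambda>A. (real (card (A \<inter> U)))\<^sup>2) \<le> card U * p + (card U * p)\<^sup>2"
proof -
  have fU: "finite U" using assms finite_subset by auto
  have e: "real (card (A \<inter> U)) = (\<Sum>u\<in>U. of_bool ({u} \<subseteq> A))" for A
    using fU by (simp only: sum_of_bool_card) (auto intro!: arg_cong[where f = card])
  have "(real (card (A \<inter> U)))\<^sup>2 = (\<Sum>u\<in>U. \<Sum>u'\<in>U. of_bool ({u,u'} \<subseteq> A))" for A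
    unfolding e power2_eq_square sum_product by (intro sum.cong refl) (auto simp: of_bool_def)
  then have "bexp p V (\<lambda>A. (real (card (A \<inter> U)))\<^sup>2) = (\<Sum>u\<in>U. \<Sum>u'\<in>U. bexp p V (\<lambda>A. of_bool ({u,u'} \<subseteq> A)))"
    by (simp only: bexp_sum)
  also have "\<dots> \<le> (\<Sum>u\<in>U. \<Sum>u'\<in>U. p\<^sup>2 + of_bool (u = u') * p)"
  proof (intro sum_mono)
    fix u u' assume "u \<in> U" "u' \<in> U"
    then have "bexp p V (\<lambda>A. of_bool ({u,u'} \<subseteq> A)) = p ^ card {u,u'}"
      using assms by (intro bexp_superset) auto
    then show "bexp p V (\<lambda>A. of_bool ({u,u'} \<subseteq> A)) \<le> p\<^sup>2 + of_bool (u = u') * p"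
      by (cases "u = u'") (auto simp: numeral_2_eq_2[symmetric])
  qed
  also have "\<dots> = (\<Sum>u\<in>U. card U * p\<^sup>2 + p)"
  proof (rule sum.cong[OF refl])
    fix u assume "u \<in> U"
    then show "(\<Sum>u'\<in>U. p\<^sup>2 + of_bool (u = u') * p) = card U * p\<^sup>2 + p"
      using fU by (simp add: sum.distrib sum_distrib_right[symmetric])
  qed
  finally show ?thesis by (simp add: power2_eq_square algebra_simps)
qed

lemma bexp_product:
  assumes "finite V" "finite W" "V \<inter> W = {}"
    and "\<And>A B. A \<subseteq> V \<Longrightarrow> B \<subseteq> W \<Longrightarrow> f (A \<union> B) = f A" "\<And>A B. A \<subseteq> V \<Longrightarrow> B \<subseteq> W \<Longrightarrow> g (A \<union> B) = g B"
  shows "bexp p (V \<union> W) (\<lambda>A. f A * g A) = bexp p V f * bexp p W g"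
proof -
  have "bexp p (V \<union> W) (\<lambda>A. f A * g A) = bexp p V (\<lambda>A. bexp p W (\<lambda>B. f A * g B))"
    unfolding bexp_union[OF assms(1-3)] using assms(4,5) by (intro bexp_cong) auto
  also have "\<dots> = bexp p V (\<lambda>A. bexp p W g * f A)" by (simp add: bexp_cmult mult.commute)
  finally show ?thesis by (simp add: bexp_cmult)
qed

lemma bexp_three_factors:
  assumes "finite V1" "finite V2" "finite V3" "V1 \<inter> V2 = {}" "V1 \<inter> V3 = {}" "V2 \<inter> V3 = {}"
  shows "bexp p (V1 \<union> (V2 \<union> V3)) (\<lambda>A. f (A \<inter> V1) * (g (A \<inter> V2) * k (A \<inter> V3)))
    = bexp p V1 (\<lambda>A. f (A \<inter> V1)) * (bexp p V2 (\<lambda>A. g (A \<inter> V2)) * bexp p V3 (\<lambda>A. k (A \<inter> V3)))"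
proof -
  have "bexp p (V1 \<union> (V2 \<union> V3)) (\<lambda>A. f (A \<inter> V1) * (g (A \<inter> V2) * k (A \<inter> V3)))
      = bexp p V1 (\<lambda>A. f (A \<inter> V1)) * bexp p (V2 \<union> V3) (\<lambda>A. g (A \<inter> V2) * k (A \<inter> V3))"
  proof (rule bexp_product)
    fix A B assume "A \<subseteq> V1" "B \<subseteq> V2 \<union> V3"
    then have "(A \<union> B) \<inter> V1 = A \<inter> V1" "(A \<union> B) \<inter> V2 = B \<inter> V2" "(A \<union> B) \<inter> V3 = B \<inter> V3" using assms by blast+
    then show "f ((A \<union> B) \<inter> V1) = f (A \<inter> V1)"
      "g ((A \<union> B) \<inter> V2) * k ((A \<union> B) \<inter> V3) = g (B \<inter> V2) * k (B \<inter> V3)" by simp_all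
  qed (use assms in auto)
  also have "bexp p (V2 \<union> V3) (\<lambda>A. g (A \<inter> V2) * k (A \<inter> V3))
      = bexp p V2 (\<lambda>A. g (A \<inter> V2)) * bexp p V3 (\<lambda>A. k (A \<inter> V3))"
  proof (rule bexp_product)
    fix A B assume "A \<subseteq> V2" "B \<subseteq> V3"
    then have "(A \<union> B) \<inter> V2 = A \<inter> V2" "(A \<union> B) \<inter> V3 = B \<inter> V3" using assms by blast+
    then show "g ((A \<union> B) \<inter> V2) = g (A \<inter> V2)" "k ((A \<union> B) \<inter> V3) = k (B \<inter> V3)" by simp_all
  qed (use assms in auto)
  finally show ?thesis .
qed

text \<open>The linear equation forbids two triples to differ in exactly one coordinate. If they
  differ in all three, they use six elements with five degrees of freedom; if in exactly two, five
  elements with four degrees of freedom, in three ways.\<close>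

lemma sum_collisions_le:
  fixes p :: real
  assumes "0 \<le> p" "finite V1" "finite V2" "finite V3" "card V1 = h" "card V2 = h" "card V3 = h"
    and disj: "V1 \<inter> V2 = {}" "V1 \<inter> V3 = {}" "V2 \<inter> V3 = {}"
  defines "\<C> \<equiv> {((x1,x2,y),(x1',x2',y')). x1 \<in> V1 \<and> x2 \<in> V2 \<and> y \<in> V3 \<and> x1' \<in> V1 \<and> x2' \<in> V2 \<and> y' \<in> V3 \<and>
      (x1,x2,y) \<noteq> (x1',x2',y') \<and> x1 + x2 + y' = x1' + x2' + (y::nat)}"
  shows "finite \<C>"
    and "(\<Sum>((x1,x2,y),(x1',x2',y'))\<in>\<C>. p ^ card {x1,x2,y,x1',x2',y'}) \<le> h ^ 5 * p ^ 6 + 3 * (h ^ 4 * p ^ 5)" (is ?g2)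
proof -
  let ?w = "\<lambda>((x1,x2,y),(x1',x2',y')). p ^ card {x1,x2,y,x1',x2',y'}"
  let ?f6 = "\<lambda>(x1,x2,y,x1',x2'). ((x1,x2,y),(x1',x2',x1'+x2'+y-(x1+x2)))"
  let ?fa = "\<lambda>(x1,x2,y,x2'). ((x1,x2,y),(x1,x2',x2'+y-x2))"
  let ?fb = "\<lambda>(x1,x2,y,x1'). ((x1,x2,y),(x1',x2,x1'+y-x1))"
  let ?fc = "\<lambda>(x1,x2,y,x1'). ((x1,x2,y),(x1',x1+x2-x1',y))"
  \<comment> \<open>In each of these four sets the condition on the weight makes the summand
    constant, and the image under a parametrisation by the free coordinates bounds the number of
    terms.\<close>
  let ?P6 = "{\<pi> \<in> \<C>. ?w \<pi> = p ^ 6} \<inter> ?f6 ` (V1 \<times> V2 \<times> V3 \<times> V1 \<times> V2)"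
  let ?Pa = "{\<pi> \<in> \<C>. ?w \<pi> = p ^ 5} \<inter> ?fa ` (V1 \<times> V2 \<times> V3 \<times> V2)"
  let ?Pb = "{\<pi> \<in> \<C>. ?w \<pi> = p ^ 5} \<inter> ?fb ` (V1 \<times> V2 \<times> V3 \<times> V1)"
  let ?Pc = "{\<pi> \<in> \<C>. ?w \<pi> = p ^ 5} \<inter> ?fc ` (V1 \<times> V2 \<times> V3 \<times> V1)"
  have cover: "\<C> \<subseteq> ?P6 \<union> (?Pa \<union> (?Pb \<union> ?Pc))"
  proof
    fix \<pi> assume "\<pi> \<in> \<C>"
    then obtain x1 x2 y x1' x2' y' where \<pi>: "\<pi> = ((x1,x2,y),(x1',x2',y'))" and
      V: "x1 \<in> V1" "x2 \<in> V2" "y \<in> V3" "x1' \<in> V1" "x2' \<in> V2" "y' \<in> V3" and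
      ne: "(x1,x2,y) \<noteq> (x1',x2',y')" and eq: "x1 + x2 + y' = x1' + x2' + y"
      unfolding \<C>_def by blast
    have d: "x1 \<noteq> x2" "x1 \<noteq> y" "x2 \<noteq> y" "x1' \<noteq> x2'" "x1' \<noteq> y'" "x2' \<noteq> y'" "x1 \<noteq> x2'" "x1 \<noteq> y'" "x2 \<noteq> x1'"
      "x2 \<noteq> y'" "y \<noteq> x1'" "y \<noteq> x2'" using V disj by blast+
    consider "x1 \<noteq> x1'" "x2 \<noteq> x2'" "y \<noteq> y'" | "x1 = x1'" "x2 \<noteq> x2'" "y \<noteq> y'"
      | "x1 \<noteq> x1'" "x2 = x2'" "y \<noteq> y'" | "x1 \<noteq> x1'" "x2 \<noteq> x2'" "y = y'"
      using ne eq by fastforce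
    then show "\<pi> \<in> ?P6 \<union> (?Pa \<union> (?Pb \<union> ?Pc))"
    proof cases
      case 1
      have "card {x1,x2,y,x1',x2',y'} = 6" using d 1 by simp
      moreover have "\<pi> = ?f6 (x1,x2,y,x1',x2')" using \<pi> eq by simp
      then have "\<pi> \<in> ?f6 ` (V1 \<times> V2 \<times> V3 \<times> V1 \<times> V2)" by (rule image_eqI) (use V in simp)
      ultimately have "\<pi> \<in> ?P6" using \<pi> \<open>\<pi> \<in> \<C>\<close> by simp
      then show ?thesis by blast
    next
      case 2
      have "card {x1,x2,y,x1',x2',y'} = 5" using d 2 by (simp add: insert_commute)
      moreover have "\<pi> = ?fa (x1,x2,y,x2')" using \<pi> eq 2 by simp
      then have "\<pi> \<in> ?fa ` (V1 \<times> V2 \<times> V3 \<times> V2)" by (rule image_eqI) (use V in simp)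
      ultimately have "\<pi> \<in> ?Pa" using \<pi> \<open>\<pi> \<in> \<C>\<close> by simp
      then show ?thesis by blast
    next
      case 3
      have "card {x1,x2,y,x1',x2',y'} = 5" using d 3 by (simp add: insert_commute)
      moreover have "\<pi> = ?fb (x1,x2,y,x1')" using \<pi> eq 3 by simp
      then have "\<pi> \<in> ?fb ` (V1 \<times> V2 \<times> V3 \<times> V1)" by (rule image_eqI) (use V in simp)
      ultimately have "\<pi> \<in> ?Pb" using \<pi> \<open>\<pi> \<in> \<C>\<close> by simp
      then show ?thesis by blast
    next
      case 4
      have "card {x1,x2,y,x1',x2',y'} = 5" using d 4 by (simp add: insert_commute)
      moreover have "\<pi> = ?fc (x1,x2,y,x1')" using \<pi> eq 4 by simp
      then have "\<pi> \<in> ?fc ` (V1 \<times> V2 \<times> V3 \<times> V1)" by (rule image_eqI) (use V in simp)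
      ultimately have "\<pi> \<in> ?Pc" using \<pi> \<open>\<pi> \<in> \<C>\<close> by simp
      then show ?thesis by blast
    qed
  qed
  have fin: "finite ?P6" "finite ?Pa" "finite ?Pb" "finite ?Pc"
    using assms(2-4) by (intro finite_Int disjI2 finite_imageI finite_cartesian_product; simp)+
  then show f\<C>: "finite \<C>" by (intro finite_subset[OF cover] finite_UnI)
  have c6: "card ?P6 \<le> h ^ 5"
  proof -
    have "card ?P6 \<le> card (V1 \<times> V2 \<times> V3 \<times> V1 \<times> V2)" by (rule surj_card_le[of _ _ ?f6]) (use assms(2-4) in auto)
    also have "\<dots> = h ^ 5" using assms(5-7) by (simp add: card_cartesian_product power_numeral_reduce)
    finally show ?thesis .
  qed
  have ca: "card ?Pa \<le> h ^ 4"
  proof -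
    have "card ?Pa \<le> card (V1 \<times> V2 \<times> V3 \<times> V2)" by (rule surj_card_le[of _ _ ?fa]) (use assms(2-4) in auto)
    also have "\<dots> = h ^ 4" using assms(5-7) by (simp add: card_cartesian_product power_numeral_reduce)
    finally show ?thesis .
  qed
  have cb: "card ?Pb \<le> h ^ 4"
  proof -
    have "card ?Pb \<le> card (V1 \<times> V2 \<times> V3 \<times> V1)" by (rule surj_card_le[of _ _ ?fb]) (use assms(2-4) in auto)
    also have "\<dots> = h ^ 4" using assms(5-7) by (simp add: card_cartesian_product power_numeral_reduce)
    finally show ?thesis .
  qed
  have cc: "card ?Pc \<le> h ^ 4"
  proof -
    have "card ?Pc \<le> card (V1 \<times> V2 \<times> V3 \<times> V1)" by (rule surj_card_le[of _ _ ?fc]) (use assms(2-4) in auto)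
    also have "\<dots> = h ^ 4" using assms(5-7) by (simp add: card_cartesian_product power_numeral_reduce)
    finally show ?thesis .
  qed
  have nn: "0 \<le> ?w \<pi>" for \<pi> using assms(1) by (auto simp: case_prod_unfold)
  have un: "sum ?w (A \<union> B) \<le> sum ?w A + sum ?w B" if "finite A" "finite B" for A B
    using that nn by (subst sum.union_inter[symmetric]) (auto intro!: sum_nonneg simp del: case_prod_conv)
  have "sum ?w \<C> \<le> sum ?w (?P6 \<union> (?Pa \<union> (?Pb \<union> ?Pc)))"
    by (rule sum_mono2[OF _ cover]) (use fin nn in blast)+
  also have "\<dots> \<le> sum ?w ?P6 + (sum ?w ?Pa + (sum ?w ?Pb + sum ?w ?Pc))"
    by (intro order.trans[OF un] add_left_mono finite_UnI fin order.refl)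
  also have "\<dots> \<le> h ^ 5 * p ^ 6 + (h ^ 4 * p ^ 5 + (h ^ 4 * p ^ 5 + h ^ 4 * p ^ 5))"
  proof -
    have "sum ?w ?P6 = (\<Sum>_\<in>?P6. p ^ 6)" by (rule sum.cong) auto
    then have "sum ?w ?P6 \<le> h ^ 5 * p ^ 6" using of_nat_mono[OF c6, where 'a = real] assms(1)
      by (simp add: mult_right_mono)
    moreover have "sum ?w ?Pa = (\<Sum>_\<in>?Pa. p ^ 5)" by (rule sum.cong) auto
    then have "sum ?w ?Pa \<le> h ^ 4 * p ^ 5" using of_nat_mono[OF ca, where 'a = real] assms(1)
      by (simp add: mult_right_mono)
    moreover have "sum ?w ?Pb = (\<Sum>_\<in>?Pb. p ^ 5)" by (rule sum.cong) auto
    then have "sum ?w ?Pb \<le> h ^ 4 * p ^ 5" using of_nat_mono[OF cb, where 'a = real] assms(1)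
      by (simp add: mult_right_mono)
    moreover have "sum ?w ?Pc = (\<Sum>_\<in>?Pc. p ^ 5)" by (rule sum.cong) auto
    then have "sum ?w ?Pc \<le> h ^ 4 * p ^ 5" using of_nat_mono[OF cc, where 'a = real] assms(1)
      by (simp add: mult_right_mono)
    ultimately show ?thesis by linarith
  qed
  also have "\<dots> = h ^ 5 * p ^ 6 + 3 * (h ^ 4 * p ^ 5)" by simp
  finally have "sum ?w \<C> \<le> h ^ 5 * p ^ 6 + 3 * (h ^ 4 * p ^ 5)" .
  then show ?g2 unfolding of_nat_power .
qed

lemma many_distinct_sums:
  fixes p :: real and h :: nat
  assumes p: "0 < p" "p \<le> 1" and hp: "1 \<le> h * p" and sparse: "real h ^ 2 * p ^ 3 + 3 * (real h * p ^ 2) \<le> 1 / 2"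
  defines "V1 \<equiv> {1..h}" and "V2 \<equiv> {6*h+1..7*h}" and "V3 \<equiv> {2*h+1..3*h}"
  defines "R \<equiv> \<lambda>A. (\<lambda>(x1,x2,y). x1 + x2 - y) ` ((A \<inter> V1) \<times> (A \<inter> V2) \<times> (A \<inter> V3))"
  shows "1 / 128 \<le> bexp p (V1 \<union> (V2 \<union> V3)) (\<lambda>A. of_bool ((h * p) ^ 3 / 4 \<le> real (card (R A))))"
proof -
  let ?V = "V1 \<union> (V2 \<union> V3)"
  define a where "a = (h * p) ^ 3"
  have a: "a > 0" using hp unfolding a_def by simp
  have fin: "finite V1" "finite V2" "finite V3" unfolding V1_def V2_def V3_def by auto
  have crd: "card V1 = h" "card V2 = h" "card V3 = h" unfolding V1_def V2_def V3_def by auto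
  have disj: "V1 \<inter> V2 = {}" "V1 \<inter> V3 = {}" "V2 \<inter> V3 = {}" unfolding V1_def V2_def V3_def by auto
  define T where "T A = real (card (A \<inter> V1)) * (real (card (A \<inter> V2)) * real (card (A \<inter> V3)))" for A
  define \<C> where "\<C> = {((x1,x2,y),(x1',x2',y')). x1 \<in> V1 \<and> x2 \<in> V2 \<and> y \<in> V3 \<and> x1' \<in> V1 \<and> x2' \<in> V2 \<and> y' \<in> V3 \<and>
      (x1,x2,y) \<noteq> (x1',x2',y') \<and> x1 + x2 + y' = x1' + x2' + (y::nat)}"
  let ?pts = "\<lambda>((x1,x2,y),(x1',x2',y')). {x1,x2,y,x1',x2',y'}"
  note coll = sum_collisions_le[OF less_imp_le[OF p(1)] fin crd disj, folded \<C>_def]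
  have ET: "bexp p ?V T = a"
    unfolding T_def
    using bexp_three_factors[OF fin disj, of p "\<lambda>X. real (card X)" "\<lambda>X. real (card X)" "\<lambda>X. real (card X)"]
      bexp_card_inter[OF fin(1) order.refl, of p] bexp_card_inter[OF fin(2) order.refl, of p]
      bexp_card_inter[OF fin(3) order.refl, of p] crd
    by (simp add: a_def power3_eq_cube mult.assoc)
  have ET2: "bexp p ?V (\<lambda>A. (T A)\<^sup>2) \<le> 8 * a\<^sup>2"
  proof -
    have sq: "bexp p V (\<lambda>A. (real (card (A \<inter> V)))\<^sup>2) \<le> 2 * (h * p)\<^sup>2" if "finite V" "card V = h" for V
    proof -
      have "bexp p V (\<lambda>A. (real (card (A \<inter> V)))\<^sup>2) \<le> h * p + (h * p)\<^sup>2"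
        using bexp_card_inter_squared_le[OF that(1) order.refl] p that(2) by simp
      moreover have "h * p * 1 \<le> h * p * (h * p)" using hp by (intro mult_left_mono) auto
      ultimately show ?thesis by (simp add: power2_eq_square)
    qed
    have nn: "0 \<le> bexp p V (\<lambda>A. (real (card (A \<inter> V)))\<^sup>2)" for V :: "nat set"
      using p by (intro bexp_nonneg) auto
    have "bexp p ?V (\<lambda>A. (T A)\<^sup>2) = bexp p V1 (\<lambda>A. (real (card (A \<inter> V1)))\<^sup>2)
       * (bexp p V2 (\<lambda>A. (real (card (A \<inter> V2)))\<^sup>2) * bexp p V3 (\<lambda>A. (real (card (A \<inter> V3)))\<^sup>2))"
      unfolding T_def power_mult_distrib
      using bexp_three_factors[OF fin disj, of p "\<lambda>X. (real (card X))\<^sup>2" "\<lambda>X. (real (card X))\<^sup>2" "\<lambda>X. (real (card X))\<^sup>2"] .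
    also have "\<dots> \<le> (2 * (h * p)\<^sup>2) * ((2 * (h * p)\<^sup>2) * (2 * (h * p)\<^sup>2))"
      using fin crd nn by (intro mult_mono sq mult_nonneg_nonneg) auto
    also have "\<dots> = 8 * a\<^sup>2" unfolding a_def by (simp add: power2_eq_square power3_eq_cube)
    finally show ?thesis .
  qed
  have bounds: "real (card (R A)) \<le> T A" "T A - (\<Sum>\<pi>\<in>\<C>. of_bool (?pts \<pi> \<subseteq> A)) \<le> real (card (R A))"
    if A: "A \<subseteq> ?V" for A
  proof -
    let ?S = "(A \<inter> V1) \<times> (A \<inter> V2) \<times> (A \<inter> V3)"
    let ?f = "\<lambda>(x1,x2,y). x1 + x2 - (y::nat)"
    have fS: "finite ?S" using fin by auto
    have cS: "real (card ?S) = T A" unfolding T_def by (simp add: card_cartesian_product)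
    show "real (card (R A)) \<le> T A"
      unfolding R_def cS[symmetric] by (intro of_nat_mono card_image_le fS)
    have "{(\<sigma>,\<tau>) \<in> ?S \<times> ?S. \<sigma> \<noteq> \<tau> \<and> ?f \<sigma> = ?f \<tau>} \<subseteq> {\<pi> \<in> \<C>. ?pts \<pi> \<subseteq> A}"
    proof
      fix \<pi> assume "\<pi> \<in> {(\<sigma>,\<tau>) \<in> ?S \<times> ?S. \<sigma> \<noteq> \<tau> \<and> ?f \<sigma> = ?f \<tau>}"
      then obtain \<sigma> \<tau> where st: "\<pi> = (\<sigma>, \<tau>)" "\<sigma> \<in> ?S" "\<tau> \<in> ?S" "\<sigma> \<noteq> \<tau>" "?f \<sigma> = ?f \<tau>" by blast
      obtain x1 x2 y where \<sigma>: "\<sigma> = (x1,x2,y)" by (cases \<sigma>)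
      obtain x1' x2' y' where \<tau>: "\<tau> = (x1',x2',y')" by (cases \<tau>)
      have \<pi>: "\<pi> = ((x1,x2,y),(x1',x2',y'))"
        "(x1,x2,y) \<in> ?S" "(x1',x2',y') \<in> ?S" "(x1,x2,y) \<noteq> (x1',x2',y')" "x1 + x2 - y = x1' + x2' - y'"
        using st unfolding \<sigma> \<tau> by simp_all
      have "y \<le> x1 + x2" "y' \<le> x1' + x2'" using \<pi>(2,3) unfolding V2_def V3_def by auto
      then have "x1 + x2 + y' = x1' + x2' + y" using \<pi>(5) by linarith
      then show "\<pi> \<in> {\<pi> \<in> \<C>. ?pts \<pi> \<subseteq> A}" using \<pi>(1-4) unfolding \<C>_def by simp
    qed
    then have "card {(\<sigma>,\<tau>) \<in> ?S \<times> ?S. \<sigma> \<noteq> \<tau> \<and> ?f \<sigma> = ?f \<tau>} \<le> card {\<pi> \<in> \<C>. ?pts \<pi> \<subseteq> A}"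
      using coll(1) by (intro card_mono) auto
    then have "card ?S \<le> card (R A) + card {\<pi> \<in> \<C>. ?pts \<pi> \<subseteq> A}"
      using card_le_card_image_plus_collisions[OF fS, of ?f] unfolding R_def by linarith
    then show "T A - (\<Sum>\<pi>\<in>\<C>. of_bool (?pts \<pi> \<subseteq> A)) \<le> real (card (R A))"
      unfolding cS[symmetric] sum_of_bool_card[OF coll(1)] by linarith
  qed
  have Ecoll: "bexp p ?V (\<lambda>A. \<Sum>\<pi>\<in>\<C>. of_bool (?pts \<pi> \<subseteq> A)) \<le> a / 2"
  proof -
    have "bexp p ?V (\<lambda>A. of_bool (?pts \<pi> \<subseteq> A)) = p ^ card (?pts \<pi>)" if "\<pi> \<in> \<C>" for \<pi>
      using fin that by (intro bexp_superset) (auto simp: \<C>_def)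
    then have "bexp p ?V (\<lambda>A. \<Sum>\<pi>\<in>\<C>. of_bool (?pts \<pi> \<subseteq> A)) = (\<Sum>\<pi>\<in>\<C>. p ^ card (?pts \<pi>))"
      unfolding bexp_sum by (rule sum.cong[OF refl])
    also have "\<dots> = (\<Sum>((x1,x2,y),(x1',x2',y'))\<in>\<C>. p ^ card {x1,x2,y,x1',x2',y'})"
      by (rule sum.cong) auto
    also have "\<dots> \<le> real h ^ 5 * p ^ 6 + 3 * (real h ^ 4 * p ^ 5)" by (rule coll(2))
    also have "\<dots> = a * (real h ^ 2 * p ^ 3 + 3 * (real h * p ^ 2))"
      unfolding a_def by (simp add: power_mult_distrib power_numeral_reduce algebra_simps)
    also have "\<dots> \<le> a * (1 / 2)" using sparse a by (intro mult_left_mono) auto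
    finally show ?thesis by simp
  qed
  have "a - a / 2 \<le> bexp p ?V (\<lambda>A. T A - (\<Sum>\<pi>\<in>\<C>. of_bool (?pts \<pi> \<subseteq> A)))"
    unfolding bexp_diff ET using Ecoll by linarith
  also have "\<dots> \<le> bexp p ?V (\<lambda>A. real (card (R A)))"
    using p bounds(2) by (intro bexp_mono) auto
  \<comment> \<open>A linear form of the Paley-Zygmund argument: T \<le> 16 a + T^2 / (64 a) on the
    good event, by completing the square. As T^2 has mean at most 8 a^2, the three terms give a/2
    \<le> a/4 + a/8 + 16 a P, so the probability P of the good event is at least 1/128.\<close>
  also have "\<dots> \<le> bexp p ?V (\<lambda>A. a / 4 + (1 / (64 * a)) * (T A)\<^sup>2 + 16 * a * of_bool (a / 4 \<le> real (card (R A))))"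
  proof (rule bexp_mono)
    fix A assume A: "A \<subseteq> ?V"
    show "real (card (R A)) \<le> a / 4 + (1 / (64 * a)) * (T A)\<^sup>2 + 16 * a * of_bool (a / 4 \<le> real (card (R A)))"
    proof (cases "a / 4 \<le> real (card (R A))")
      case True
      have "0 \<le> (T A - 32 * a)\<^sup>2 / (64 * a)" using a by simp
      also have "(T A - 32 * a)\<^sup>2 / (64 * a) = (1 / (64 * a)) * (T A)\<^sup>2 - T A + 16 * a"
        using a by (simp add: field_simps power2_eq_square)
      finally show ?thesis using bounds(1)[OF A] True a by simp
    next
      case False
      have "0 \<le> (1 / (64 * a)) * (T A)\<^sup>2" using a by simp
      then have "real (card (R A)) \<le> a / 4 + (1 / (64 * a)) * (T A)\<^sup>2" using False by linarith
      then show ?thesis using False by simp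
    qed
  qed (use p in auto)
  also have "\<dots> = a / 4 + (1 / (64 * a)) * bexp p ?V (\<lambda>A. (T A)\<^sup>2)
      + 16 * a * bexp p ?V (\<lambda>A. of_bool (a / 4 \<le> real (card (R A))))"
    using fin by (simp only: bexp_add bexp_cmult bexp_const finite_Un)
  also have "\<dots> \<le> a / 4 + (1 / (64 * a)) * (8 * a\<^sup>2) + 16 * a * bexp p ?V (\<lambda>A. of_bool (a / 4 \<le> real (card (R A))))"
    using ET2 a by (intro add_right_mono add_left_mono mult_left_mono) auto
  also have "(1 / (64 * a)) * (8 * a\<^sup>2) = a / 8" using a by (simp add: power2_eq_square)
  finally have "a * (1 / 128) \<le> a * bexp p ?V (\<lambda>A. of_bool (a / 4 \<le> real (card (R A))))" by simp
  then show ?thesis using a unfolding a_def[symmetric] by (simp only: mult_le_cancel_left_pos)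
qed

text \<open>Each \<open>z\<close> in \<open>B\<close> completes a quadruple whose only element in
  the fourth range is \<open>z\<close>, so different \<open>z\<close> give different
  quadruples.\<close>

lemma card_le_num_quadruples:
  assumes "finite A" "B \<subseteq> A \<inter> {3*h+1..6*h}"
    and B: "B \<subseteq> (\<lambda>(x1,x2,y). x1 + x2 - y) ` ((A \<inter> {1..h}) \<times> (A \<inter> {6*h+1..7*h}) \<times> (A \<inter> {2*h+1..3*h}))"
  shows "card B \<le> num_quadruples A"
proof -
  have "\<exists>Q\<in>additive_quadruples A. Q \<inter> {3*h+1..6*h} = {z}" if z: "z \<in> B" for z
  proof -
    obtain x1 x2 y where x: "x1 \<in> A \<inter> {1..h}" "x2 \<in> A \<inter> {6*h+1..7*h}" "y \<in> A \<inter> {2*h+1..3*h}" "z = x1 + x2 - y"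
      using subsetD[OF B z] by (auto elim!: imageE)
    have "x1 + x2 = y + z" using x by auto
    then have "{x1,x2,y,z} \<in> additive_quadruples UNIV"
      using x by (intro separated_quadruple(2)[of x1 h]) auto
    moreover have "{x1,x2,y,z} \<subseteq> A" using x z assms(2) by blast
    ultimately have "{x1,x2,y,z} \<in> additive_quadruples A"
      using additive_quadruples_subset[of A UNIV] by blast
    moreover have "{x1,x2,y,z} \<inter> {3*h+1..6*h} = {z}" using x z assms(2) by auto
    ultimately show ?thesis by blast
  qed
  then obtain q where q: "\<And>z. z \<in> B \<Longrightarrow> q z \<in> additive_quadruples A \<and> q z \<inter> {3*h+1..6*h} = {z}" by metis
  have "inj_on q B" by (rule inj_onI) (metis q singleton_inject)
  then show ?thesis unfolding num_quadruples_def
    using q finite_additive_quadruples[OF assms(1)] by (intro card_inj_on_le) auto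
qed

text \<open>Condition on the outer three ranges. With probability at least 1/128 they offer
  \<open>r\<close> targets in the fourth range, whose elements are independent of them, and exactly
  \<open>k\<close> of the \<open>r\<close> targets are hit with at least the stated binomial
  weight.\<close>

lemma upper_tail_ge_poisson:
  fixes p :: real and h n r k :: nat
  assumes p: "0 < p" "p \<le> 1" and n: "7 * h \<le> n" and hp: "1 \<le> h * p"
    and sparse: "real h ^ 2 * p ^ 3 + 3 * (real h * p ^ 2) \<le> 1 / 2"
    and r: "real r < (h * p) ^ 3 / 4 + 1"
  shows "real (r choose k) * p ^ k * (1 - p) ^ r / 128 \<le> bexp p {1..n} (\<lambda>A. of_bool (real k \<le> real (num_quadruples A)))"
proof -
  let ?V1 = "{1..h}" and ?V2 = "{6*h+1..7*h}" and ?V3 = "{2*h+1..3*h}" and ?V4 = "{3*h+1..6*h}"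
  let ?V = "?V1 \<union> (?V2 \<union> ?V3)"
  let ?R = "\<lambda>A. (\<lambda>(x1,x2,y). x1 + x2 - y) ` ((A \<inter> ?V1) \<times> (A \<inter> ?V2) \<times> (A \<inter> ?V3))"
  let ?b = "real (r choose k) * p ^ k * (1 - p) ^ r"
  have p': "0 \<le> p" "p \<le> 1" using p by auto
  have b0: "0 \<le> ?b" using p by simp
  have bin: "?b \<le> bexp p R' (\<lambda>B. of_bool (k \<le> card (B \<inter> R')))" if "finite R'" "card R' = r" for R' :: "nat set"
  proof (cases "k \<le> r")
    case True
    have "bexp p R' (\<lambda>B. of_bool (card B = k)) = (\<Sum>B\<in>Pow R'. of_bool (card B = k) * (p ^ k * (1 - p) ^ (r - k)))"
      unfolding bexp_def
    proof (rule sum.cong[OF refl])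
      fix B assume "B \<in> Pow R'"
      then have "card (R' - B) = r - card B" using that finite_subset[of B R'] by (simp add: card_Diff_subset)
      then show "p ^ card B * (1 - p) ^ card (R' - B) * of_bool (card B = k)
        = of_bool (card B = k) * (p ^ k * (1 - p) ^ (r - k))" by (auto simp: of_bool_def)
    qed
    also have "\<dots> = real (card {B \<in> Pow R'. card B = k}) * (p ^ k * (1 - p) ^ (r - k))"
      unfolding sum_distrib_right[symmetric] using that by (subst sum_of_bool_card) auto
    also have "{B \<in> Pow R'. card B = k} = {B. B \<subseteq> R' \<and> card B = k}" by auto
    also have "card \<dots> = r choose k" using n_subsets[OF that(1)] that(2) by simp
    finally have "real (r choose k) * (p ^ k * (1 - p) ^ (r - k)) = bexp p R' (\<lambda>B. of_bool (card B = k))" by simp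
    moreover have "(1 - p) ^ r \<le> (1 - p) ^ (r - k)" using p by (intro power_decreasing) auto
    then have "?b \<le> real (r choose k) * (p ^ k * (1 - p) ^ (r - k))"
      using p by (simp add: mult.assoc mult_left_mono)
    moreover have "bexp p R' (\<lambda>B. of_bool (card B = k)) \<le> bexp p R' (\<lambda>B. of_bool (k \<le> card (B \<inter> R')))"
      by (rule bexp_mono[OF p']) (auto simp: inf.absorb1)
    ultimately show ?thesis by linarith
  next
    case False
    then show ?thesis using p' by (simp add: binomial_eq_0 bexp_nonneg)
  qed
  have inner: "of_bool ((h * p) ^ 3 / 4 \<le> real (card (?R A))) * ?b
      \<le> bexp p ?V4 (\<lambda>B. of_bool (real k \<le> real (num_quadruples (A \<union> B))))" if A: "A \<subseteq> ?V" for A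
  proof (cases "(h * p) ^ 3 / 4 \<le> real (card (?R A))")
    case True
    \<comment> \<open>Integrality: \<open>real r < (h * p) ^ 3 / 4 + 1\<close> together with the
      case assumption gives \<open>r < card (?R A) + 1\<close>.\<close>
    then have "r \<le> card (?R A)" using r by linarith
    then obtain R' where R': "R' \<subseteq> ?R A" "card R' = r" "finite R'" by (rule obtain_subset_with_card_n)
    have RV: "R' \<subseteq> ?V4"
    proof
      fix z assume "z \<in> R'"
      then obtain x1 x2 y where x: "x1 \<in> ?V1" "x2 \<in> ?V2" "y \<in> ?V3" "z = x1 + x2 - y"
        using subsetD[OF R'(1) \<open>z \<in> R'\<close>] by (auto elim!: imageE)
      then have "x1 + x2 = y + z" by auto
      then show "z \<in> ?V4" using x by (intro separated_quadruple(1)[of x1 h x2 y]) auto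
    qed
    have "?b \<le> bexp p R' (\<lambda>B. of_bool (k \<le> card (B \<inter> R')))" by (rule bin[OF R'(3,2)])
    also have "\<dots> \<le> bexp p ?V4 (\<lambda>B. of_bool (k \<le> card (B \<inter> R')))"
    proof (rule bexp_domain_mono[OF p' _ RV])
      fix B B' assume "B \<subseteq> B'" "B' \<subseteq> ?V4"
      then have "card (B \<inter> R') \<le> card (B' \<inter> R')" using R'(3) by (intro card_mono) auto
      then show "(of_bool (k \<le> card (B \<inter> R')) :: real) \<le> of_bool (k \<le> card (B' \<inter> R'))" by auto
    qed simp
    also have "\<dots> \<le> bexp p ?V4 (\<lambda>B. of_bool (real k \<le> real (num_quadruples (A \<union> B))))"
    proof (rule bexp_mono[OF p'])
      fix B assume B: "B \<subseteq> ?V4"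
      have "card (B \<inter> R') \<le> num_quadruples (A \<union> B)"
      proof (rule card_le_num_quadruples)
        show "finite (A \<union> B)" using A B finite_subset[of A ?V] finite_subset[of B ?V4] by simp
        show "B \<inter> R' \<subseteq> (A \<union> B) \<inter> ?V4" using RV by blast
        have "?R A \<subseteq> ?R (A \<union> B)" by (intro image_mono Sigma_mono) auto
        then show "B \<inter> R' \<subseteq> ?R (A \<union> B)" using R'(1) by blast
      qed
      then show "(of_bool (k \<le> card (B \<inter> R')) :: real) \<le> of_bool (real k \<le> real (num_quadruples (A \<union> B)))" by auto
    qed
    finally show ?thesis using True by simp
  next
    case False
    then show ?thesis using p' by (simp add: bexp_nonneg)
  qed
  have "1 / 128 * ?b \<le> bexp p ?V (\<lambda>A. of_bool ((h * p) ^ 3 / 4 \<le> real (card (?R A)))) * ?b"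
    using many_distinct_sums[OF p hp sparse] b0 by (rule mult_right_mono)
  also have "\<dots> = bexp p ?V (\<lambda>A. of_bool ((h * p) ^ 3 / 4 \<le> real (card (?R A))) * ?b)"
    unfolding mult.commute[of _ ?b] bexp_cmult ..
  also have "\<dots> \<le> bexp p ?V (\<lambda>A. bexp p ?V4 (\<lambda>B. of_bool (real k \<le> real (num_quadruples (A \<union> B)))))"
    by (rule bexp_mono[OF p']) (rule inner)
  also have "\<dots> = bexp p (?V \<union> ?V4) (\<lambda>A. of_bool (real k \<le> real (num_quadruples A)))"
    by (intro bexp_union[symmetric]) auto
  also have "\<dots> \<le> bexp p {1..n} (\<lambda>A. of_bool (real k \<le> real (num_quadruples A)))"
  proof (rule bexp_domain_mono[OF p'])
    fix A B :: "nat set" assume "A \<subseteq> B" "B \<subseteq> {1..n}"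
    then have "num_quadruples A \<le> num_quadruples B" using finite_subset by (intro num_quadruples_mono) auto
    then show "(of_bool (real k \<le> real (num_quadruples A)) :: real) \<le> of_bool (real k \<le> real (num_quadruples B))" by auto
  qed (use n in auto)
  finally show ?thesis by simp
qed

subsection \<open>The upper bound\<close>

text \<open>Trades a logarithm for a small power of \<open>p\<close> with an explicit constant; used
  with a = 1/3 in the partial overlaps and with a = 1/36 in the dense case.\<close>

lemma powr_mult_ln_inverse_le:
  fixes p a :: real
  assumes "0 < p" "p \<le> 1" "0 < a"
  shows "p powr a * ln (1 / p) \<le> 1 / a"
proof -
  have "ln (1 / p) \<le> (1 / p) powr a / a" using assms by (intro ln_powr_bound) auto
  then have "p powr a * ln (1 / p) \<le> p powr a * ((1 / p) powr a / a)" by (intro mult_left_mono) auto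
  also have "\<dots> = 1 / a" using assms by (simp add: powr_divide)
  finally show ?thesis .
qed

lemma cube_le_mean_quadruples:
  fixes p :: real
  assumes "7 \<le> n" "0 \<le> p" "p \<le> 1"
  shows "real n ^ 3 * p ^ 4 \<le> 2744 * mean_quadruples n p"
proof -
  let ?h = "n div 7"
  \<comment> \<open>Rounding in \<open>n div 7\<close> costs at most a factor 2 when n \<ge> 7,
    hence 2744 = 14^3.\<close>
  have "n \<le> 14 * ?h" using assms(1) by presburger
  then have "real n ^ 3 \<le> real (14 * ?h) ^ 3" by (intro power_mono) auto
  also have "\<dots> = 2744 * real (?h ^ 3)" by simp
  also have "?h ^ 3 \<le> num_quadruples {1..n}" by (rule num_quadruples_ge_cube) auto
  finally have "real n ^ 3 \<le> 2744 * real (num_quadruples {1..n})" by simp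
  then have "real n ^ 3 * p ^ 4 \<le> 2744 * real (num_quadruples {1..n}) * p ^ 4"
    using assms by (intro mult_right_mono) auto
  then show ?thesis using assms by (simp add: mean_quadruples_eq)
qed

lemma mean_quadruples_le:
  fixes p :: real
  assumes "0 \<le> p" "p \<le> 1"
  shows "mean_quadruples n p \<le> 3 * real n ^ 3 * p ^ 4"
proof -
  have "num_quadruples {1..n} \<le> 3 * n ^ 3" using num_quadruples_le[of "{1..n}"] by simp
  then have "real (num_quadruples {1..n}) \<le> real (3 * n ^ 3)" by (rule of_nat_mono)
  then have "real (num_quadruples {1..n}) \<le> 3 * real n ^ 3" by simp
  then show ?thesis using assms by (simp add: mean_quadruples_eq mult_right_mono)
qed

text \<open>For \<open>p\<close> bounded away from 0 the mean tends to infinity uniformly in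
  \<open>p\<close>. Hence, for large \<open>n\<close>, a mean bounded by a function of ln(1/p)
  forces \<open>p\<close> to be small, where asymptotic estimates in \<open>p\<close> apply.\<close>

lemma mean_quadruples_large:
  fixes p0 :: real
  assumes "0 < p0"
  shows "\<exists>n0. \<forall>n\<ge>n0. \<forall>p. p0 \<le> p \<and> p \<le> 1 \<longrightarrow> B < mean_quadruples n p"
proof -
  obtain n1 :: nat where n1: "2744 * \<bar>B\<bar> / p0 ^ 4 < real n1" using reals_Archimedean2 by blast
  have "B < mean_quadruples n p" if n: "max n1 7 \<le> n" and p: "p0 \<le> p" "p \<le> 1" for n p
  proof -
    have "2744 * \<bar>B\<bar> < real n1 * p0 ^ 4" using n1 assms by (simp add: field_simps)
    also have "\<dots> \<le> real n ^ 3 * p ^ 4"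
    proof (rule mult_mono)
      have "real n1 \<le> real n" using n by simp
      also have "\<dots> \<le> real n ^ 3" using n by (intro self_le_power) auto
      finally show "real n1 \<le> real n ^ 3" .
    qed (use p assms in \<open>auto intro: power_mono\<close>)
    also have "\<dots> \<le> 2744 * mean_quadruples n p" using n p assms by (intro cube_le_mean_quadruples) auto
    finally show ?thesis by simp
  qed
  then show ?thesis by blast
qed

text \<open>Taking \<open>x\<close> and \<open>y\<close> as the cube roots of the mean and of \<open>p\<close> makes the estimates polynomial.\<close>

lemma partial_overlaps_le:
  fixes c x y L p u n :: real
  assumes "p = y ^ 3" "0 < y" "0 \<le> x" "n * p * y \<le> 14 * x" "y * L \<le> 3" "0 \<le> L" "0 \<le> c" "c \<le> 1"
    "0 \<le> u" "u \<le> c * (x * L)" "0 \<le> n"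
  shows "3 * (u * n ^ 2 * p ^ 3 + u ^ 2 * n * p ^ 2 + u ^ 3 * p) \<le> 2223 * c * x ^ 3"
proof -
  have p: "0 \<le> p" using assms by simp
  \<comment> \<open>Each term is regrouped into factors \<open>n * p * y \<le> 14 * x\<close>. The
    powers of \<open>y\<close> left over match the powers of \<open>L\<close> coming from
    \<open>u\<close>, so \<open>y * L \<le> 3\<close> removes the logarithms. The three constants
    add up to 588 + 126 + 27 = 741, and 2223 = 3 * 741.\<close>
  have "u * n ^ 2 * p ^ 3 = u * (n * p * y) ^ 2 * y" unfolding assms(1) by algebra
  also have "\<dots> \<le> (c * (x * L)) * (14 * x) ^ 2 * y"
    using assms p by (intro mult_right_mono[OF mult_mono[OF assms(10) power_mono[OF assms(4)]]]) auto
  also have "\<dots> = (196 * c * x ^ 3) * (y * L)" by algebra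
  also have "\<dots> \<le> (196 * c * x ^ 3) * 3" using assms by (intro mult_left_mono) auto
  finally have 1: "u * n ^ 2 * p ^ 3 \<le> 588 * c * x ^ 3" by simp
  have "u ^ 2 * n * p ^ 2 = u ^ 2 * (n * p * y) * y ^ 2" unfolding assms(1) by algebra
  also have "\<dots> \<le> (c * (x * L)) ^ 2 * (14 * x) * y ^ 2"
    using assms p by (intro mult_right_mono[OF mult_mono[OF power_mono assms(4)]]) auto
  also have "\<dots> = (14 * c ^ 2 * x ^ 3) * (y * L) ^ 2" by algebra
  also have "\<dots> \<le> (14 * c ^ 2 * x ^ 3) * 3 ^ 2" using assms by (intro mult_left_mono power_mono) auto
  also have "\<dots> \<le> (14 * c * x ^ 3) * 3 ^ 2"
    using assms power_decreasing[of 1 2 c] by (intro mult_right_mono mult_left_mono) auto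
  finally have 2: "u ^ 2 * n * p ^ 2 \<le> 126 * c * x ^ 3" by simp
  have "u ^ 3 * p \<le> (c * (x * L)) ^ 3 * p" using assms p by (intro mult_right_mono power_mono) auto
  also have "\<dots> = (c ^ 3 * x ^ 3) * (y * L) ^ 3" unfolding assms(1) by algebra
  also have "\<dots> \<le> (c ^ 3 * x ^ 3) * 3 ^ 3" using assms by (intro mult_left_mono power_mono) auto
  also have "\<dots> \<le> (c * x ^ 3) * 3 ^ 3"
    using assms power_decreasing[of 1 3 c] by (intro mult_right_mono) auto
  finally have 3: "u ^ 3 * p \<le> 27 * c * x ^ 3" by simp
  show ?thesis using 1 2 3 by (simp add: algebra_simps)
qed

section \<open>Dense cores and the weight of their union bound\<close>

definition dense_cores :: "nat \<Rightarrow> real \<Rightarrow> real \<Rightarrow> real \<Rightarrow> nat set set" where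
  "dense_cores n K E D = {I. I \<subseteq> {1..n} \<and> real (card I) \<le> K \<and> E \<le> real (num_quadruples I) \<and>
     (\<forall>v\<in>I. D \<le> real (card {Q \<in> additive_quadruples I. v \<in> Q}))}"

lemma finite_dense_cores: "finite (dense_cores n K E D)"
  by (rule finite_subset[of _ "Pow {1..n}"]) (auto simp: dense_cores_def)

text \<open>The excess of \<epsilon>/2 \<mu> is split in two: partial overlaps take at most
  \<epsilon>/4 \<mu>, so a violation leaves more than \<epsilon>/4 \<mu> quadruples inside
  \<open>U\<close>. Pruning may destroy half of these, and the degree threshold is this half divided
  by \<open>K\<close> because \<open>U\<close> has at most \<open>K\<close> elements.\<close>

lemma conditional_mean_le_of_no_core:
  fixes p K \<epsilon> :: real and n :: nat
  defines "\<mu> \<equiv> mean_quadruples n p"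
  assumes p: "0 \<le> p" "p \<le> 1" and "0 < K" "0 < \<epsilon>" "0 \<le> \<mu>" and U: "U \<subseteq> {1..n}" "real (card U) \<le> K"
    and small: "3 * (real (card U) * real n ^ 2 * p ^ 3 + real (card U) ^ 2 * real n * p ^ 2 + real (card U) ^ 3 * p) \<le> \<epsilon> / 4 * \<mu>"
    and no_core: "\<not> (\<exists>I\<in>dense_cores n K (\<epsilon> / 8 * \<mu>) (\<epsilon> * \<mu> / (8 * K)). I \<subseteq> U)"
  shows "(\<Sum>Q\<in>additive_quadruples {1..n}. p ^ card (Q - U)) \<le> (1 + \<epsilon> / 2) * \<mu>"
proof (rule ccontr)
  assume "\<not> ?thesis"
  then have "(1 + \<epsilon> / 2) * \<mu> < \<mu> + \<epsilon> / 4 * \<mu> + real (num_quadruples U)"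
    using conditional_mean_le[OF U(1) p] small
    by (simp add: \<mu>_def mean_quadruples_eq[OF p])
  then have "2 * (\<epsilon> / 8 * \<mu>) \<le> real (num_quadruples U)" by (simp add: algebra_simps)
  moreover have "real (card U) * (\<epsilon> * \<mu> / (8 * K)) \<le> K * (\<epsilon> * \<mu> / (8 * K))"
    using assms by (intro mult_right_mono) auto
  then have "real (card U) * (\<epsilon> * \<mu> / (8 * K)) \<le> \<epsilon> / 8 * \<mu>" using assms by simp
  moreover have "finite U" using U finite_subset by auto
  ultimately obtain I where I: "I \<subseteq> U" "\<epsilon> / 8 * \<mu> \<le> real (num_quadruples I)"
    "\<forall>v\<in>I. \<epsilon> * \<mu> / (8 * K) \<le> real (card {Q \<in> additive_quadruples I. v \<in> Q})"
    using exists_min_degree_subset[of U "\<epsilon> / 8 * \<mu>" "\<epsilon> * \<mu> / (8 * K)"] assms by auto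
  have "card I \<le> card U" using I \<open>finite U\<close> by (intro card_mono) auto
  then have "I \<in> dense_cores n K (\<epsilon> / 8 * \<mu>) (\<epsilon> * \<mu> / (8 * K))"
    using I U unfolding dense_cores_def by auto
  then show False using no_core I(1) by blast
qed

text \<open>\<open>N\<close> bounds \<open>n\<close> when \<mu> < L^6. The exponent 29/30 of
  \<open>q\<close> keeps every term a positive power of \<open>p\<close>: up to logarithms N^2 q^3
  is p^(7/30), and the most critical term N^5 q^7, from overlapping pairs, is p^(1/10).\<close>

lemma sparse_weight_eventually_small:
  "\<exists>p0>0. \<forall>p. 0 < p \<and> p < p0 \<longrightarrow>
    (let L = ln (1 / p); N = 14 * L ^ 2 * p powr (-4/3); q = p powr (29/30) in
      3 * (L ^ 6 * N ^ 2 * q ^ 3 + (L ^ 6) ^ 2 * N * q ^ 2 + (L ^ 6) ^ 3 * q)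
      + 3 * N ^ 3 * q ^ 4 * (3 * (4 * N ^ 2 * q ^ 3 + 16 * N * q ^ 2 + 64 * q)) \<le> (1 / 2 :: real))"
proof -
  have "((\<lambda>p::real. (let L = ln (1 / p); N = 14 * L ^ 2 * p powr (-4/3); q = p powr (29/30) in
      3 * (L ^ 6 * N ^ 2 * q ^ 3 + (L ^ 6) ^ 2 * N * q ^ 2 + (L ^ 6) ^ 3 * q)
      + 3 * N ^ 3 * q ^ 4 * (3 * (4 * N ^ 2 * q ^ 3 + 16 * N * q ^ 2 + 64 * q)))) \<longlongrightarrow> 0) (at_right 0)"
    unfolding Let_def by real_asymp
  then have "eventually (\<lambda>p::real. (let L = ln (1 / p); N = 14 * L ^ 2 * p powr (-4/3); q = p powr (29/30) in
      3 * (L ^ 6 * N ^ 2 * q ^ 3 + (L ^ 6) ^ 2 * N * q ^ 2 + (L ^ 6) ^ 3 * q)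
      + 3 * N ^ 3 * q ^ 4 * (3 * (4 * N ^ 2 * q ^ 3 + 16 * N * q ^ 2 + 64 * q))) < 1 / 2) (at_right 0)"
    by (rule order_tendstoD) simp
  then show ?thesis unfolding eventually_at_right_field by (auto simp: Let_def intro: less_imp_le)
qed

text \<open>Each \<open>p ^ card I\<close> is split as p^(card I / 30) times
  \<open>q ^ card I\<close>. The first factor is the exponential gain, by the lower bound
  \<open>m0\<close> on the size of a core; the second is summed over all extensions of the empty
  set.\<close>

lemma sum_dense_cores_le_sparse:
  fixes p K E D m0 :: real
  defines "q \<equiv> p powr (29/30)" and "M \<equiv> nat \<lfloor>K\<rfloor>"
  assumes p: "0 < p" "p \<le> 1" and K: "0 \<le> K" and D: "2 \<le> D"
    and small: "3 * (real M * n ^ 2 * q ^ 3 + real M ^ 2 * n * q ^ 2 + real M ^ 3 * q)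
      + 3 * n ^ 3 * q ^ 4 * (3 * (4 * n ^ 2 * q ^ 3 + 16 * n * q ^ 2 + 64 * q)) \<le> 1 / 2"
    and m0: "\<And>I. I \<in> dense_cores n K E D \<Longrightarrow> m0 \<le> real (card I)"
  shows "(\<Sum>I\<in>dense_cores n K E D. p ^ card I) \<le> 2 * p powr (m0 / 30)"
proof -
  have q: "0 \<le> q" unfolding q_def by simp
  have sub: "dense_cores n K E D \<subseteq> degree_two_extensions n M {}"
  proof
    fix I assume "I \<in> dense_cores n K E D"
    then have I: "I \<subseteq> {1..n}" "real (card I) \<le> K" "\<And>v. v \<in> I \<Longrightarrow> D \<le> real (card {Q \<in> additive_quadruples I. v \<in> Q})"
      unfolding dense_cores_def by auto
    have "card I \<le> M" unfolding M_def using I(2) by (simp add: le_nat_floor)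
    moreover have "2 \<le> card {Q \<in> additive_quadruples I. v \<in> Q}" if "v \<in> I" for v
      using I(3)[OF that] D by linarith
    ultimately show "I \<in> degree_two_extensions n M {}" using I(1) unfolding degree_two_extensions_def by simp
  qed
  have "(\<Sum>I\<in>dense_cores n K E D. p ^ card I) \<le> (\<Sum>I\<in>dense_cores n K E D. p powr (m0 / 30) * q ^ card I)"
  proof (rule sum_mono)
    fix I assume I: "I \<in> dense_cores n K E D"
    have "p ^ card I = p powr (real (card I) / 30) * q ^ card I"
      using p unfolding q_def by (simp add: powr_realpow[symmetric] powr_powr powr_add[symmetric] field_simps)
    also have "\<dots> \<le> p powr (m0 / 30) * q ^ card I"
      using m0[OF I] p q by (intro mult_right_mono powr_mono') auto
    finally show "p ^ card I \<le> p powr (m0 / 30) * q ^ card I" .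
  qed
  also have "\<dots> = p powr (m0 / 30) * (\<Sum>I\<in>dense_cores n K E D. q ^ card I)" by (simp add: sum_distrib_left)
  also have "\<dots> \<le> p powr (m0 / 30) * (\<Sum>I\<in>degree_two_extensions n M {}. q ^ card (I - {}))"
    using sub q by (intro mult_left_mono order.trans[OF sum_mono2[OF _ sub]]) auto
  also have "\<dots> \<le> p powr (m0 / 30) * 2"
    using sum_degree_two_extensions_le[OF q small, of "{}"] by (intro mult_left_mono) auto
  finally show ?thesis by simp
qed

text \<open>Exponent count: at most 2/3 of the elements are free, each with weight
  \<open>B * p powr (-1/3)\<close>, and at least 1/3 are determined, each with weight
  \<open>\<eta> * p powr (11/12)\<close>. This gives -2/9 + 11/36 = 1/12 per element. The constants
  combine to \<open>(B ^ 2 * \<eta>) powr (m / 3)\<close>, at most 2^(-m), so that the sum over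
  \<open>m\<close> is geometric.\<close>

lemma high_degree_sets_weight_le:
  fixes p B D \<eta> :: real
  assumes p: "0 < p" "p \<le> 1" and m: "24 \<le> m" and D: "0 < D" "18432 * real m \<le> D" and B: "1 \<le> B"
    and \<eta>: "0 < \<eta>" "B ^ 2 * \<eta> \<le> 1 / 8"
    and h1: "6 * real n * p / m \<le> B * p powr (-1/3)"
    and h2: "432 * real m ^ 2 * p / D \<le> \<eta> * p powr (11/12)"
  shows "real (card {I. I \<subseteq> {1..n} \<and> card I = m \<and> (\<forall>v\<in>I. D \<le> real (card {Q \<in> additive_quadruples I. v \<in> Q}))}) * p ^ m
    \<le> (1 / 2) ^ m * p powr (m / 12)"
proof -
  define t where "t = (m + 2) div 3"
  define s where "s = m - t"
  have st: "m = s + t" "m \<le> 3 * t" "3 * s \<le> 2 * m" "m \<le> 2 * s" "0 < s" "0 < t"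
    using m unfolding s_def t_def by linarith+
  have st': "real m \<le> 3 * real t" "3 * real s \<le> 2 * real m" "real m \<le> 2 * real s" "0 < real s" "0 < real t" "0 < real m"
    using st m by linarith+
  define b where "b = B * p powr (-1/3)"
  define z where "z = \<eta> * p powr (11/12)"
  have b1: "1 \<le> b" unfolding b_def using B p mult_mono[of 1 B 1 "p powr (-1/3)"] powr_mono'[of "-1/3" 0 p] by auto
  have B2: "1 \<le> B ^ 2" using B by simp
  have "1 * \<eta> \<le> B ^ 2 * \<eta>" using B2 \<eta>(1) by (intro mult_right_mono) auto
  then have "\<eta> \<le> 1" using \<eta> by linarith
  then have z1: "0 < z" "z \<le> 1" unfolding z_def using \<eta> p mult_mono[of \<eta> 1 "p powr (11/12)" 1] powr_mono'[of 0 "11/12" p] by auto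
  have "real (card {I. I \<subseteq> {1..n} \<and> card I = m \<and> (\<forall>v\<in>I. D \<le> real (card {Q \<in> additive_quadruples I. v \<in> Q}))}) * p ^ m
      \<le> ((3 * real n / s) ^ s * (144 * real s ^ 3 / (D * t)) ^ t) * p ^ m"
    using card_high_degree_sets_le[of m D n] m D(2) p unfolding s_def t_def by (intro mult_right_mono) auto
  also have "\<dots> = (3 * real n * p / s) ^ s * (144 * real s ^ 3 * p / (D * t)) ^ t"
    unfolding st(1) power_add by (simp add: power_mult_distrib power_divide)
  also have "\<dots> \<le> b ^ s * z ^ t"
  proof (intro mult_mono power_mono)
    have "1 / real s \<le> 2 / real m" using st' by (simp add: field_simps)
    then have "3 * real n * p * (1 / s) \<le> 3 * real n * p * (2 / m)" using p by (intro mult_left_mono) auto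
    then have "3 * real n * p / s \<le> 6 * real n * p / m" by simp
    then show "3 * real n * p / s \<le> b" using h1 unfolding b_def by linarith
    have "real s ^ 3 \<le> real m ^ 3" using st by (intro power_mono) auto
    then have "144 * real s ^ 3 * p / (D * t) \<le> 144 * real m ^ 3 * p / (D * (m / 3))"
      using st' D p by (intro frac_le mult_left_mono mult_right_mono) auto
    also have "\<dots> = 432 * real m ^ 2 * p / D" using st' D by (simp add: field_simps power2_eq_square power3_eq_cube)
    finally show "144 * real s ^ 3 * p / (D * t) \<le> z" using h2 unfolding z_def by linarith
  qed (use p D b1 in auto)
  also have "\<dots> = b powr s * z powr t" using b1 z1 by (simp add: powr_realpow)
  also have "\<dots> \<le> b powr (2 * m / 3) * z powr (m / 3)"
    using b1 z1 st' by (intro mult_mono powr_mono powr_mono') auto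
  also have "\<dots> = (B powr (2 * m / 3) * \<eta> powr (m / 3)) * (p powr (-1/3 * (2 * m / 3)) * p powr (11/12 * (m / 3)))"
    unfolding b_def z_def using B \<eta> p by (simp add: powr_mult powr_powr)
  also have "B powr (2 * m / 3) = (B ^ 2) powr (m / 3)"
  proof -
    have "B ^ 2 = B powr 2" using B by simp
    then show ?thesis by (simp only: powr_powr) simp
  qed
  also have "(B ^ 2) powr (m / 3) * \<eta> powr (m / 3) = (B ^ 2 * \<eta>) powr (m / 3)" using B \<eta> by (simp add: powr_mult)
  also have "p powr (-1/3 * (2 * m / 3)) * p powr (11/12 * (m / 3)) = p powr (m / 12)"
    unfolding powr_add[symmetric] by (rule arg_cong[where f = "(powr) p"]) (simp add: field_simps)
  also have "(B ^ 2 * \<eta>) powr (m / 3) * p powr (m / 12) \<le> (1 / 8) powr (m / 3) * p powr (m / 12)"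
    using \<eta> B by (intro mult_right_mono powr_mono2) auto
  also have "(1 / 8 :: real) powr (m / 3) = ((1 / 2) powr 3) powr (m / 3)" by (simp add: power_divide)
  also have "\<dots> = (1 / 2) ^ m" by (simp only: powr_powr) (simp add: powr_realpow)
  finally show ?thesis .
qed

lemma sum_dense_cores_le_dense:
  fixes p K E D m0 W :: real
  assumes p: "0 < p" "p \<le> 1" and K: "0 \<le> K" and W: "0 \<le> W"
    and m0: "\<And>I. I \<in> dense_cores n K E D \<Longrightarrow> m0 \<le> real (card I)"
    and level: "\<And>m. m0 \<le> real m \<Longrightarrow> real m \<le> K \<Longrightarrow>
      real (card {I. I \<subseteq> {1..n} \<and> card I = m \<and> (\<forall>v\<in>I. D \<le> real (card {Q \<in> additive_quadruples I. v \<in> Q}))}) * p ^ m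
      \<le> (1 / 2) ^ m * W"
  shows "(\<Sum>I\<in>dense_cores n K E D. p ^ card I) \<le> 2 * W"
proof -
  define M where "M = nat \<lfloor>K\<rfloor>"
  have gp: "(\<Sum>m\<le>M. (1 / 2 :: real) ^ m) \<le> 2"
  proof -
    have "(\<Sum>m\<le>M. (1 / 2 :: real) ^ m) = 2 - (1 / 2) ^ M" by (induction M) auto
    then show ?thesis by simp
  qed
  have "(\<Sum>I\<in>dense_cores n K E D. p ^ card I) = (\<Sum>m\<le>M. \<Sum>I | I \<in> dense_cores n K E D \<and> card I = m. p ^ card I)"
  proof (rule sum.group[symmetric, OF finite_dense_cores])
    show "card ` dense_cores n K E D \<subseteq> {..M}"
      unfolding M_def dense_cores_def by (auto simp: le_nat_floor)
  qed simp
  also have "\<dots> \<le> (\<Sum>m\<le>M. (1 / 2) ^ m * W)"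
  proof (rule sum_mono)
    fix m assume "m \<in> {..M}"
    then have mK: "real m \<le> K" unfolding M_def using K by (auto simp: le_nat_iff le_floor_iff)
    let ?C = "{I. I \<subseteq> {1..n} \<and> card I = m \<and> (\<forall>v\<in>I. D \<le> real (card {Q \<in> additive_quadruples I. v \<in> Q}))}"
    let ?S = "{I. I \<in> dense_cores n K E D \<and> card I = m}"
    show "(\<Sum>I\<in>?S. p ^ card I) \<le> (1 / 2) ^ m * W"
    proof (cases "?S = {}")
      case True
      then show ?thesis by (simp only: sum.empty) (use W in simp)
    next
      case False
      then have "m0 \<le> real m" using m0 by auto
      have "finite ?C" by (rule finite_subset[of _ "Pow {1..n}"]) auto
      then have "card ?S \<le> card ?C" by (intro card_mono) (auto simp: dense_cores_def)
      have "(\<Sum>I\<in>?S. p ^ card I) = real (card ?S) * p ^ m" by simp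
      also have "\<dots> \<le> real (card ?C) * p ^ m" using \<open>card ?S \<le> card ?C\<close> p by (intro mult_right_mono) auto
      also have "\<dots> \<le> (1 / 2) ^ m * W" by (rule level) fact+
      finally show ?thesis .
    qed
  qed
  also have "\<dots> = (\<Sum>m\<le>M. (1 / 2) ^ m) * W" by (simp add: sum_distrib_right)
  also have "\<dots> \<le> 2 * W" using gp W by (intro mult_right_mono) auto
  finally show ?thesis .
qed

section \<open>Assembly of the upper bound\<close>

lemma powr_inverse_power: "0 \<le> (x::real) \<Longrightarrow> 0 < k \<Longrightarrow> (x powr (1 / real k)) ^ k = x"
  by (cases "x = 0") (simp_all add: powr_realpow[symmetric] powr_powr)

lemma cube_root_le_mean_quadruples:
  fixes p :: real
  assumes "7 \<le> n" "0 < p" "p \<le> 1"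
  shows "real n * p * p powr (1/3) \<le> 14 * mean_quadruples n p powr (1/3)"
proof (rule power_le_imp_le_base[of _ 2])
  have y: "(p powr (1/3)) ^ 3 = p" using assms powr_inverse_power[of p 3] by simp
  have c: "real n ^ 3 * p ^ 4 \<le> 2744 * mean_quadruples n p" using assms by (intro cube_le_mean_quadruples) auto
  moreover have "0 \<le> real n ^ 3 * p ^ 4" using assms by simp
  ultimately have "0 \<le> mean_quadruples n p" by linarith
  then have x: "(mean_quadruples n p powr (1/3)) ^ 3 = mean_quadruples n p"
    using powr_inverse_power[of "mean_quadruples n p" 3] by simp
  have "(real n * p * p powr (1/3)) ^ 3 = real n ^ 3 * p ^ 3 * p" by (simp only: power_mult_distrib y)
  also have "\<dots> = real n ^ 3 * p ^ 4" by (simp add: power_numeral_reduce)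
  also have "\<dots> \<le> 14 ^ 3 * mean_quadruples n p" using c by simp
  also have "\<dots> = (14 * mean_quadruples n p powr (1/3)) ^ 3" by (simp only: power_mult_distrib x)
  finally show "(real n * p * p powr (1/3)) ^ Suc 2 \<le> (14 * mean_quadruples n p powr (1/3)) ^ Suc 2" by simp
qed simp

text \<open>The first term is the restricted moment bound, the second the union bound over cores.
  The size of \<open>c\<close> is dictated by the dense case, which needs
  \<open>B ^ 2 * \<eta> \<le> 1 / 8\<close> for \<eta> = 3456 * 36^3 * c^3 / \<epsilon>; here
  1289945088 = 8 * 3456 * 36^3. The other requirements on \<open>c\<close> are weaker and follow
  from \<open>c\<epsilon>\<close>.\<close>

lemma upper_tail_le_two_terms:
  fixes \<epsilon> p :: real and n :: nat
  defines "\<mu> \<equiv> mean_quadruples n p" and "L \<equiv> ln (1 / p)"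
  defines "x \<equiv> \<mu> powr (1/3)"
  defines "\<Phi> \<equiv> min \<mu> (x * L)"
  defines "a \<equiv> (\<epsilon> / 24) powr (1/3)"
  defines "B \<equiv> 1 + 84 / a"
  defines "c \<equiv> min 1 (\<epsilon> / (1289945088 * B ^ 2))"
  assumes \<epsilon>: "0 < \<epsilon>" and n: "7 \<le> n" and p: "0 < p" "p < 1" and \<mu>: "0 < \<mu>" and big: "24 \<le> a * x"
    and sparse: "\<mu> < L ^ 6 \<Longrightarrow> (let L = ln (1 / p); N = 14 * L ^ 2 * p powr (-4/3); q = p powr (29/30) in
      3 * (L ^ 6 * N ^ 2 * q ^ 3 + (L ^ 6) ^ 2 * N * q ^ 2 + (L ^ 6) ^ 3 * q)
      + 3 * N ^ 3 * q ^ 4 * (3 * (4 * N ^ 2 * q ^ 3 + 16 * N * q ^ 2 + 64 * q)) \<le> 1 / 2)"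
  shows "bexp p {1..n} (\<lambda>A. of_bool ((1 + \<epsilon>) * \<mu> \<le> real (num_quadruples A)))
    \<le> ((1 + \<epsilon> / 2) / (1 + \<epsilon>)) ^ nat \<lfloor>c * \<Phi> / 4\<rfloor> + 2 * exp (- (a / 30) * (x * L))"
proof -
  have p': "0 \<le> p" "p \<le> 1" using p by auto
  have L: "0 < L" unfolding L_def using p by simp
  have x: "0 < x" "x ^ 3 = \<mu>" unfolding x_def using \<mu> powr_inverse_power[of \<mu> 3] by simp_all
  have a: "0 < a" "a ^ 3 = \<epsilon> / 24" unfolding a_def using \<epsilon> powr_inverse_power[of "\<epsilon> / 24" 3] by simp_all
  have B: "1 \<le> B" "84 / a \<le> B" unfolding B_def using a by simp_all
  have B2: "1 \<le> B ^ 2" using B by simp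
  have c0: "0 < c" "c \<le> 1" unfolding c_def using \<epsilon> B by auto
  have cB: "c * (1289945088 * B ^ 2) \<le> \<epsilon>"
  proof -
    have "c \<le> \<epsilon> / (1289945088 * B ^ 2)" unfolding c_def by simp
    then show ?thesis using B by (simp add: field_simps)
  qed
  have c\<epsilon>: "1289945088 * c \<le> \<epsilon>"
  proof -
    have "c * (1289945088 * 1) \<le> c * (1289945088 * B ^ 2)" using c0 B2 by (intro mult_left_mono) auto
    then show ?thesis using cB by linarith
  qed
  define y where "y = p powr (1/3)"
  have y: "0 < y" "y ^ 3 = p" unfolding y_def using p powr_inverse_power[of p 3] by simp_all
  have yL: "y * L \<le> 3" using powr_mult_ln_inverse_le[of p "1/3"] p unfolding y_def L_def by simp
  have npy: "real n * p * y \<le> 14 * x"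
    using cube_root_le_mean_quadruples[OF n p(1) p'(2)] unfolding y_def x_def \<mu>_def .
  have \<Phi>: "0 < \<Phi>" "\<Phi> \<le> \<mu>" "\<Phi> \<le> x * L" unfolding \<Phi>_def using \<mu> x L by auto
  define K where "K = c * \<Phi>"
  have K: "0 < K" "K \<le> c * \<mu>" "K \<le> c * (x * L)" unfolding K_def using c0 \<Phi> by auto
  define D where "D = \<epsilon> * \<mu> / (8 * K)"
  have D0: "0 < D" unfolding D_def using \<epsilon> \<mu> K by simp
  let ?cores = "dense_cores n K (\<epsilon> / 8 * \<mu>) D"
  define Z where "Z A \<longleftrightarrow> \<not> (\<exists>I\<in>?cores. I \<subseteq> A)" for A
  have tail: "bexp p {1..n} (\<lambda>A. of_bool ((1 + \<epsilon>) * \<mu> \<le> real (num_quadruples A)))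
      \<le> ((1 + \<epsilon> / 2) * \<mu> / ((1 + \<epsilon>) * \<mu>)) ^ nat \<lfloor>K / 4\<rfloor> + bexp p {1..n} (\<lambda>A. of_bool (\<not> Z A))"
  proof (rule restricted_upper_tail_le[OF p', where K = "nat \<lfloor>K\<rfloor>"])
    show "4 * nat \<lfloor>K / 4\<rfloor> \<le> nat \<lfloor>K\<rfloor>" using K(1) by linarith
    fix U assume U: "U \<subseteq> {1..n}" "Z U" "card U \<le> nat \<lfloor>K\<rfloor>"
    have UK: "real (card U) \<le> K" using U(3) K(1) by linarith
    have "3 * (real (card U) * real n ^ 2 * p ^ 3 + real (card U) ^ 2 * real n * p ^ 2 + real (card U) ^ 3 * p)
        \<le> 2223 * c * x ^ 3"
      by (rule partial_overlaps_le[where y = y and L = L]) (use y x npy yL L c0 UK K in auto)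
    also have "\<dots> \<le> \<epsilon> / 4 * \<mu>" unfolding x(2) using c\<epsilon> \<mu> c0 by (intro mult_right_mono) auto
    finally show "(\<Sum>Q\<in>additive_quadruples {1..n}. p ^ card (Q - U)) \<le> (1 + \<epsilon> / 2) * \<mu>"
      using conditional_mean_le_of_no_core[OF p' K(1) \<epsilon> _ U(1) UK] U(2) \<mu> unfolding Z_def D_def \<mu>_def by simp
  next
    fix U A :: "nat set" assume "U \<subseteq> A" "Z A"
    then show "Z U" unfolding Z_def by blast
  qed (use \<epsilon> \<mu> in auto)
  \<comment> \<open>A set of m elements spans at most 3 m^3 quadruples, and a core spans at least
    \<epsilon>/8 \<mu>; the cube root of \<epsilon>/24 is \<open>a\<close>.\<close>
  have m0: "a * x \<le> real (card I)" if "I \<in> ?cores" for I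
  proof (rule power_le_imp_le_base[of _ 2])
    have I: "I \<subseteq> {1..n}" "\<epsilon> / 8 * \<mu> \<le> real (num_quadruples I)" using that unfolding dense_cores_def by auto
    have "finite I" using I(1) finite_subset by auto
    then have "real (num_quadruples I) \<le> real (3 * card I ^ 3)" using num_quadruples_le by (intro of_nat_mono) auto
    then have "\<epsilon> / 24 * \<mu> \<le> real (card I) ^ 3" using I(2) by simp
    moreover have "(a * x) ^ 3 = \<epsilon> / 24 * \<mu>" by (simp only: power_mult_distrib a(2) x(2))
    moreover have "Suc 2 = 3" by simp
    ultimately show "(a * x) ^ Suc 2 \<le> real (card I) ^ Suc 2" by (simp only:)
  qed simp
  have weight: "(\<Sum>I\<in>?cores. p ^ card I) \<le> 2 * p powr (a * x / 30)"
  proof (cases "\<mu> < L ^ 6")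
    case True
    \<comment> \<open>With x < L^2 the bound \<open>npy\<close> becomes n p^(4/3) < 14 L^2, so
      \<open>n\<close> is at most \<open>N\<close> and the estimate in terms of \<open>p\<close>
      alone applies by monotonicity.\<close>
    have "x ^ Suc 2 < (L ^ 2) ^ Suc 2" using True x(2) by (simp add: power_mult[symmetric] numeral_3_eq_3[symmetric])
    then have xL: "x < L ^ 2" by (rule power_less_imp_less_base) simp
    define N where "N = 14 * L ^ 2 * p powr (-4/3)"
    define q where "q = p powr (29/30)"
    have q0: "0 \<le> q" unfolding q_def by simp
    have nN: "real n \<le> N"
    proof -
      have "real n * (p * y) \<le> 14 * L ^ 2" using npy xL by (simp add: mult.assoc)
      moreover have py: "p * y = p powr (4/3)" unfolding y_def using p powr_add[of p 1 "1/3"] by simp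
      moreover have "p powr (4/3) * p powr (-4/3) = 1" using p by (simp add: powr_add[symmetric])
      ultimately have "real n * p powr (4/3) * p powr (-4/3) \<le> 14 * L ^ 2 * p powr (-4/3)"
        by (intro mult_right_mono) auto
      then show ?thesis using \<open>p powr (4/3) * p powr (-4/3) = 1\<close> unfolding N_def by (simp add: mult.assoc)
    qed
    have K_le: "real (nat \<lfloor>K\<rfloor>) \<le> L ^ 6"
    proof -
      have "real (nat \<lfloor>K\<rfloor>) \<le> K" using K(1) by linarith
      also have "\<dots> \<le> 1 * \<mu>" using K(2) c0 \<mu> by (intro order.trans[OF K(2)] mult_right_mono) auto
      finally show ?thesis using True by linarith
    qed
    show ?thesis
    proof (rule sum_dense_cores_le_sparse[OF p(1) p'(2)])
      have "K * 16 \<le> \<epsilon> * \<mu>"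
      proof -
        have "K * 16 \<le> (c * \<mu>) * 16" using K by simp
        also have "\<dots> = (16 * c) * \<mu>" by simp
        also have "\<dots> \<le> \<epsilon> * \<mu>" using c\<epsilon> c0 \<mu> by (intro mult_right_mono) auto
        finally show ?thesis .
      qed
      then show "2 \<le> D" unfolding D_def using K by (simp add: field_simps)
      have "3 * (real (nat \<lfloor>K\<rfloor>) * real n ^ 2 * q ^ 3 + real (nat \<lfloor>K\<rfloor>) ^ 2 * real n * q ^ 2 + real (nat \<lfloor>K\<rfloor>) ^ 3 * q)
        + 3 * real n ^ 3 * q ^ 4 * (3 * (4 * real n ^ 2 * q ^ 3 + 16 * real n * q ^ 2 + 64 * q))
        \<le> 3 * (L ^ 6 * N ^ 2 * q ^ 3 + (L ^ 6) ^ 2 * N * q ^ 2 + (L ^ 6) ^ 3 * q)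
        + 3 * N ^ 3 * q ^ 4 * (3 * (4 * N ^ 2 * q ^ 3 + 16 * N * q ^ 2 + 64 * q))"
        using q0 nN K_le L by (intro add_mono mult_mono power_mono order.refl) auto
      also have "\<dots> \<le> 1 / 2" using sparse[OF True] unfolding Let_def L_def N_def q_def .
      finally show "3 * (real (nat \<lfloor>K\<rfloor>) * real n ^ 2 * (p powr (29/30)) ^ 3 + real (nat \<lfloor>K\<rfloor>) ^ 2 * real n * (p powr (29/30)) ^ 2 + real (nat \<lfloor>K\<rfloor>) ^ 3 * p powr (29/30))
        + 3 * real n ^ 3 * (p powr (29/30)) ^ 4 * (3 * (4 * real n ^ 2 * (p powr (29/30)) ^ 3 + 16 * real n * (p powr (29/30)) ^ 2 + 64 * p powr (29/30))) \<le> 1 / 2"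
        unfolding q_def .
    qed (use K m0 in auto)
  next
    case False
    have "(L ^ 2) ^ Suc 2 \<le> x ^ Suc 2" using False x(2) by (simp add: power_mult[symmetric] numeral_3_eq_3[symmetric])
    then have Lx: "L ^ 2 \<le> x" by (rule power_le_imp_le_base) (use x in simp)
    define \<eta> where "\<eta> = 161243136 * c ^ 3 / \<epsilon>"
    have \<eta>: "0 < \<eta>" "B ^ 2 * \<eta> \<le> 1 / 8"
    proof -
      show "0 < \<eta>" unfolding \<eta>_def using c0 \<epsilon> by simp
      have "c ^ 3 \<le> c" using c0 power_decreasing[of 1 3 c] by simp
      then have "c ^ 3 * (1289945088 * B ^ 2) \<le> c * (1289945088 * B ^ 2)" by (intro mult_right_mono) auto
      then have "c ^ 3 * (1289945088 * B ^ 2) \<le> \<epsilon>" using cB by linarith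
      then show "B ^ 2 * \<eta> \<le> 1 / 8" unfolding \<eta>_def using \<epsilon> by (simp add: field_simps)
    qed
    have "(\<Sum>I\<in>?cores. p ^ card I) \<le> 2 * p powr (a * x / 12)"
    proof (rule sum_dense_cores_le_dense[OF p(1) p'(2)])
      fix m assume m: "a * x \<le> real m" "real m \<le> K"
      have m24: "24 \<le> m" using m big by linarith
      have K2: "real m * K \<le> (c * (x * L)) * (c * (x * L))" using m K by (intro mult_mono) auto
      \<comment> \<open>This is where the threshold L^6 is used: m K is at most c^2 x^2 L^2, and L^2
        \<le> x turns it into a small multiple of x^3 = \<mu>.\<close>
      have D: "18432 * real m \<le> D"
      proof -
        have "147456 * (real m * K) \<le> 147456 * ((c * (x * L)) * (c * (x * L)))" using K2 by simp
        also have "\<dots> = (147456 * c) * (c * (x ^ 2 * L ^ 2))" by (simp add: power2_eq_square)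
        also have "\<dots> \<le> \<epsilon> * (1 * (x ^ 2 * x))"
          using c\<epsilon> c0 Lx x \<epsilon> by (intro mult_mono mult_left_mono) auto
        also have "\<dots> = \<epsilon> * \<mu>" unfolding x(2)[symmetric] by (simp add: power2_eq_square power3_eq_cube)
        finally show ?thesis unfolding D_def using K by (simp add: field_simps)
      qed
      have h1: "6 * real n * p / m \<le> B * p powr (-1/3)"
      proof -
        have np: "real n * p \<le> 14 * x / y" using npy y by (simp add: field_simps)
        have "6 * real n * p / m \<le> 6 * (14 * x / y) / (a * x)"
          using np m a x p y by (intro frac_le) auto
        also have "\<dots> = (84 / a) * (1 / y)" using x by simp
        also have "\<dots> \<le> B * (1 / y)" using B y by (intro mult_right_mono) auto
        also have "1 / y = p powr (-1/3)" unfolding y_def using p powr_minus_divide[of p "1/3"] by simp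
        finally show ?thesis .
      qed
      have h2: "432 * real m ^ 2 * p / D \<le> \<eta> * p powr (11/12)"
      proof -
        have "432 * real m ^ 2 * p / D = 3456 * p * (real m ^ 2 * K) / (\<epsilon> * \<mu>)"
          unfolding D_def using K \<epsilon> \<mu> by simp
        also have "\<dots> \<le> 3456 * p * ((c * (x * L)) ^ 2 * (c * (x * L))) / (\<epsilon> * \<mu>)"
          using m K p \<epsilon> \<mu> by (intro divide_right_mono mult_left_mono mult_mono power_mono) auto
        also have "\<dots> = 3456 * c ^ 3 / \<epsilon> * (L ^ 3 * p)"
          unfolding x(2)[symmetric] using x(1) \<epsilon> by (simp add: field_simps power2_eq_square power3_eq_cube)
        \<comment> \<open>Giving up p^(1/12) pays for the three logarithms, at the price of the
          constant 36^3.\<close>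
        also have "L ^ 3 * p = (p powr (1/36) * L) ^ 3 * p powr (11/12)"
        proof -
          have "(p powr (1/36)) ^ 3 = p powr (1/12)" using p by (simp add: powr_powr flip: powr_realpow)
          moreover have "p powr (1/12) * p powr (11/12) = p" using p by (simp flip: powr_add)
          ultimately show ?thesis by (simp add: power_mult_distrib mult_ac)
        qed
        also have "3456 * c ^ 3 / \<epsilon> * ((p powr (1/36) * L) ^ 3 * p powr (11/12)) \<le> 3456 * c ^ 3 / \<epsilon> * (36 ^ 3 * p powr (11/12))"
        proof -
          have "p powr (1/36) * L \<le> 36" using powr_mult_ln_inverse_le[of p "1/36"] p unfolding L_def by simp
          then show ?thesis using L c0 \<epsilon> by (intro mult_left_mono mult_right_mono power_mono) auto
        qed
        also have "\<dots> = \<eta> * p powr (11/12)" unfolding \<eta>_def by simp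
        finally show ?thesis .
      qed
      have "real (card {I. I \<subseteq> {1..n} \<and> card I = m \<and> (\<forall>v\<in>I. D \<le> real (card {Q \<in> additive_quadruples I. v \<in> Q}))}) * p ^ m
          \<le> (1 / 2) ^ m * p powr (m / 12)"
        by (rule high_degree_sets_weight_le[OF p(1) p'(2) m24 D0 D B(1) \<eta> h1 h2])
      also have "\<dots> \<le> (1 / 2) ^ m * p powr (a * x / 12)" using m(1) p by (intro mult_left_mono powr_mono') auto
      finally show "real (card {I. I \<subseteq> {1..n} \<and> card I = m \<and> (\<forall>v\<in>I. D \<le> real (card {Q \<in> additive_quadruples I. v \<in> Q}))}) * p ^ m
          \<le> (1 / 2) ^ m * p powr (a * x / 12)" .
    qed (use K m0 in auto)
    also have "\<dots> \<le> 2 * p powr (a * x / 30)" using a x p by (intro mult_left_mono powr_mono') auto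
    finally show ?thesis .
  qed
  have "bexp p {1..n} (\<lambda>A. of_bool (\<not> Z A)) \<le> (\<Sum>I\<in>?cores. p ^ card I)"
    unfolding Z_def not_not
    by (rule bexp_union_bound[OF p']) (auto simp: finite_dense_cores, auto simp: dense_cores_def)
  also note weight
  also have "p powr (a * x / 30) = exp (- (a / 30) * (x * L))"
    unfolding powr_def L_def using p by (simp add: ln_div)
  finally have core_prob: "bexp p {1..n} (\<lambda>A. of_bool (\<not> Z A)) \<le> 2 * exp (- (a / 30) * (x * L))" .
  have "(1 + \<epsilon> / 2) * \<mu> / ((1 + \<epsilon>) * \<mu>) = (1 + \<epsilon> / 2) / (1 + \<epsilon>)" using \<mu> by simp
  then show ?thesis using tail core_prob unfolding K_def by simp
qed

text \<open>Settles bounded values of the exponent, where a constant factor below 1 is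
  enough.\<close>

lemma upper_tail_markov:
  fixes p \<epsilon> :: real
  assumes "0 \<le> p" "p \<le> 1" "0 < \<epsilon>" "0 < mean_quadruples n p"
  shows "bexp p {1..n} (\<lambda>A. of_bool ((1 + \<epsilon>) * mean_quadruples n p \<le> real (num_quadruples A))) \<le> 1 / (1 + \<epsilon>)"
proof -
  let ?\<mu> = "mean_quadruples n p"
  have "bexp p {1..n} (\<lambda>A. of_bool ((1 + \<epsilon>) * ?\<mu> \<le> real (num_quadruples A)))
      \<le> bexp p {1..n} (\<lambda>A. (1 / ((1 + \<epsilon>) * ?\<mu>)) * real (num_quadruples A))"
  proof (rule bexp_mono[OF assms(1,2)])
    fix A
    have "0 < (1 + \<epsilon>) * ?\<mu>" using assms by simp
    then show "of_bool ((1 + \<epsilon>) * ?\<mu> \<le> real (num_quadruples A)) \<le> (1 / ((1 + \<epsilon>) * ?\<mu>)) * real (num_quadruples A)"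
      by (auto simp: of_bool_def)
  qed
  also have "\<dots> = (1 / ((1 + \<epsilon>) * ?\<mu>)) * ?\<mu>"
    unfolding bexp_cmult expectation_binomial_subset[OF assms(1,2), symmetric] mean_quadruples_def ..
  also have "\<dots> = 1 / (1 + \<epsilon>)" using assms by simp
  finally show ?thesis .
qed

lemma upper_tail_upper_bound:
  fixes \<epsilon> :: real
  assumes \<epsilon>: "0 < \<epsilon>"
  shows "\<exists>c>0. \<exists>n0. \<forall>n\<ge>n0. \<forall>p. 0 < p \<and> p < 1 \<and> 0 < mean_quadruples n p \<longrightarrow>
    bexp p {1..n} (\<lambda>A. of_bool ((1 + \<epsilon>) * mean_quadruples n p \<le> real (num_quadruples A)))
    \<le> exp (- c * min (mean_quadruples n p) (mean_quadruples n p powr (1/3) * ln (1 / p)))"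
proof -
  define a where "a = (\<epsilon> / 24) powr (1/3)"
  define B where "B = 1 + 84 / a"
  define c where "c = min 1 (\<epsilon> / (1289945088 * B ^ 2))"
  define \<rho> where "\<rho> = (1 + \<epsilon> / 2) / (1 + \<epsilon>)"
  have a: "0 < a" unfolding a_def using \<epsilon> by simp
  have "0 < B" unfolding B_def using a by (simp add: add_pos_pos)
  then have c: "0 < c" unfolding c_def using \<epsilon> by simp
  have \<rho>: "0 < \<rho>" "\<rho> < 1" unfolding \<rho>_def using \<epsilon> by auto
  define c2 where "c2 = min (- ln \<rho> * c / 8) (a / 30)"
  have c2: "0 < c2" unfolding c2_def using \<rho> c a by (simp add: mult_neg_pos)
  \<comment> \<open>The threshold makes three effects harmless: \<open>8 / c\<close> the rounding in
    the moment order, \<open>4 / c2\<close> the leading factor 3, and \<open>(24 / a) ^ 3\<close>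
    the requirement \<open>24 \<le> a * x\<close>. Below the threshold Markov's inequality suffices,
    because c3 * M0 is at most ln (1 + \<epsilon>).\<close>
  define M0 where "M0 = max (8 / c) (max (4 / c2) ((24 / a) ^ 3))"
  have M0: "0 < M0" unfolding M0_def using c by (simp add: less_max_iff_disj)
  define c3 where "c3 = min (c2 / 2) (ln (1 + \<epsilon>) / M0)"
  have c3: "0 < c3" unfolding c3_def using c2 M0 \<epsilon> by simp
  obtain p0 :: real where p0: "0 < p0" and sparse: "\<forall>p. 0 < p \<and> p < p0 \<longrightarrow>
    (let L = ln (1 / p); N = 14 * L ^ 2 * p powr (-4/3); q = p powr (29/30) in
      3 * (L ^ 6 * N ^ 2 * q ^ 3 + (L ^ 6) ^ 2 * N * q ^ 2 + (L ^ 6) ^ 3 * q)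
      + 3 * N ^ 3 * q ^ 4 * (3 * (4 * N ^ 2 * q ^ 3 + 16 * N * q ^ 2 + 64 * q)) \<le> (1 / 2 :: real))"
    using sparse_weight_eventually_small by blast
  obtain n1 where n1: "\<forall>n\<ge>n1. \<forall>p. p0 \<le> p \<and> p \<le> 1 \<longrightarrow> ln (1 / p0) ^ 6 < mean_quadruples n p"
    using mean_quadruples_large[OF p0, of "ln (1 / p0) ^ 6"] by blast
  show ?thesis
  proof (intro exI[of _ c3] conjI c3 exI[of _ "max n1 7"] allI impI, elim conjE)
    fix n p assume n: "max n1 7 \<le> n" and p: "0 < (p::real)" "p < 1" and \<mu>0: "0 < mean_quadruples n p"
    define \<mu> where "\<mu> = mean_quadruples n p"
    define L where "L = ln (1 / p)"
    define x where "x = \<mu> powr (1/3)"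
    define \<Phi> where "\<Phi> = min \<mu> (x * L)"
    have L: "0 < L" unfolding L_def using p by simp
    have x: "0 < x" "x ^ 3 = \<mu>" unfolding x_def using \<mu>0 powr_inverse_power[of \<mu> 3] by (simp_all add: \<mu>_def)
    have \<Phi>: "0 < \<Phi>" "\<Phi> \<le> x * L" "\<Phi> \<le> \<mu>" unfolding \<Phi>_def using x L \<mu>0 by (simp_all add: \<mu>_def)
    let ?P = "bexp p {1..n} (\<lambda>A. of_bool ((1 + \<epsilon>) * \<mu> \<le> real (num_quadruples A)))"
    have "?P \<le> exp (- c3 * \<Phi>)"
    proof (cases "\<Phi> < M0")
      case True
      have "?P \<le> 1 / (1 + \<epsilon>)" unfolding \<mu>_def by (rule upper_tail_markov) (use p \<epsilon> \<mu>0 in auto)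
      also have "\<dots> = exp (- ln (1 + \<epsilon>))" using \<epsilon> by (simp add: exp_minus inverse_eq_divide)
      also have "c3 * \<Phi> \<le> (ln (1 + \<epsilon>) / M0) * M0"
        using True \<Phi> c3 M0 \<epsilon> by (intro mult_mono) (auto simp: c3_def)
      then have "exp (- ln (1 + \<epsilon>)) \<le> exp (- c3 * \<Phi>)" using M0 by simp
      finally show ?thesis .
    next
      case False
      have big: "24 \<le> a * x"
      proof -
        have "(24 / a) ^ Suc 2 \<le> x ^ Suc 2" using False \<Phi>(3) x(2) unfolding M0_def by (simp add: numeral_3_eq_3[symmetric])
        then have "24 / a \<le> x" by (rule power_le_imp_le_base) (use x in simp)
        then show ?thesis using a by (simp add: field_simps)
      qed
      have sp: "(let L = ln (1 / p); N = 14 * L ^ 2 * p powr (-4/3); q = p powr (29/30) in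
        3 * (L ^ 6 * N ^ 2 * q ^ 3 + (L ^ 6) ^ 2 * N * q ^ 2 + (L ^ 6) ^ 3 * q)
        + 3 * N ^ 3 * q ^ 4 * (3 * (4 * N ^ 2 * q ^ 3 + 16 * N * q ^ 2 + 64 * q)) \<le> 1 / 2)"
        if less: "\<mu> < L ^ 6"
      proof -
        \<comment> \<open>For p \<ge> p0 and large \<open>n\<close> the mean exceeds ln(1/p0)^6,
          which is at least L^6, so the sparse case occurs only for small \<open>p\<close>.\<close>
        have "p < p0"
        proof (rule ccontr)
          assume "\<not> p < p0"
          then have "L \<le> ln (1 / p0)" unfolding L_def using p p0 by (simp add: ln_div)
          then have "L ^ 6 \<le> ln (1 / p0) ^ 6" using L by (intro power_mono) auto
          moreover have "ln (1 / p0) ^ 6 < \<mu>" using n1 n p \<open>\<not> p < p0\<close> unfolding \<mu>_def by auto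
          ultimately show False using less by linarith
        qed
        then show ?thesis using sparse p(1) by blast
      qed
      have two: "?P \<le> \<rho> ^ nat \<lfloor>c * \<Phi> / 4\<rfloor> + 2 * exp (- (a / 30) * (x * L))"
        using upper_tail_le_two_terms[of \<epsilon> n p] \<epsilon> n p \<mu>0 big sp
        unfolding \<rho>_def c_def B_def a_def \<Phi>_def x_def L_def \<mu>_def by simp
      have cP: "8 \<le> c * \<Phi>"
      proof -
        have "8 / c \<le> \<Phi>" using False unfolding M0_def by simp
        then show ?thesis using c by (simp add: field_simps)
      qed
      have "c * \<Phi> / 8 \<le> real (nat \<lfloor>c * \<Phi> / 4\<rfloor>)" using cP by linarith
      then have "ln \<rho> * real (nat \<lfloor>c * \<Phi> / 4\<rfloor>) \<le> ln \<rho> * (c * \<Phi> / 8)" using \<rho> by (intro mult_left_mono_neg) auto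
      also have "\<dots> = - ((- ln \<rho> * c / 8) * \<Phi>)" by simp
      also have "\<dots> \<le> - (c2 * \<Phi>)" using \<Phi> unfolding c2_def by (intro le_imp_neg_le mult_right_mono) auto
      finally have "exp (ln \<rho> * real (nat \<lfloor>c * \<Phi> / 4\<rfloor>)) \<le> exp (- (c2 * \<Phi>))" by simp
      then have t1: "\<rho> ^ nat \<lfloor>c * \<Phi> / 4\<rfloor> \<le> exp (- (c2 * \<Phi>))"
        using \<rho> by (simp add: powr_realpow[symmetric] powr_def mult.commute)
      have "c2 * \<Phi> \<le> (a / 30) * (x * L)" using \<Phi> a c2 unfolding c2_def by (intro mult_mono) auto
      then have t2: "exp (- (a / 30) * (x * L)) \<le> exp (- (c2 * \<Phi>))" by simp
      have c2P: "4 \<le> c2 * \<Phi>"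
      proof -
        have "4 / c2 \<le> \<Phi>" using False unfolding M0_def by simp
        then show ?thesis using c2 by (simp add: field_simps)
      qed
      have "3 \<le> exp (2::real)" using exp_ge_add_one_self[of 2] by simp
      also have "\<dots> \<le> exp (c2 / 2 * \<Phi>)" using c2P by simp
      finally have e3: "3 \<le> exp (c2 / 2 * \<Phi>)" .
      have "?P \<le> 3 * exp (- (c2 * \<Phi>))" using two t1 t2 by linarith
      also have "\<dots> \<le> exp (c2 / 2 * \<Phi>) * exp (- (c2 * \<Phi>))" using e3 by (intro mult_right_mono) auto
      also have "\<dots> = exp (- (c2 / 2 * \<Phi>))" unfolding exp_add[symmetric] by (simp add: field_simps)
      also have "c3 \<le> c2 / 2" unfolding c3_def by (rule min.cobounded1)
      then have "c3 * \<Phi> \<le> c2 / 2 * \<Phi>" using \<Phi>(1) by (intro mult_right_mono) auto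
      then have "exp (- (c2 / 2 * \<Phi>)) \<le> exp (- c3 * \<Phi>)" by simp
      finally show ?thesis .
    qed
    then show "bexp p {1..n} (\<lambda>A. of_bool ((1 + \<epsilon>) * mean_quadruples n p \<le> real (num_quadruples A)))
      \<le> exp (- c3 * min (mean_quadruples n p) (mean_quadruples n p powr (1/3) * ln (1 / p)))"
      unfolding \<mu>_def \<Phi>_def x_def L_def .
  qed
qed

subsection \<open>The lower bound\<close>

text \<open>The shortest initial interval with enough quadruples is planted. Its length is of order
  \<mu>^(1/3) because the interval without its last element has too few quadruples, although it has
  at least \<open>h ^ 3\<close>. Rounding gives m \<le> 7 h + 7, and the additive 7 is absorbed
  since 1 \<le> (1 + \<epsilon>) \<mu> makes \<open>w\<close> at least 1.\<close>

lemma upper_tail_ge_exp_planted: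
  fixes p \<epsilon> :: real and n :: nat
  defines "\<mu> \<equiv> mean_quadruples n p"
  assumes p: "0 < p" "p \<le> 1" and \<epsilon>: "0 < \<epsilon>" and \<mu>: "1 \<le> (1 + \<epsilon>) * \<mu>" "(1 + \<epsilon>) * \<mu> \<le> real (num_quadruples {1..n})"
  shows "exp (- (15 * (1 + \<epsilon>)) * (\<mu> powr (1/3) * ln (1 / p)))
    \<le> bexp p {1..n} (\<lambda>A. of_bool ((1 + \<epsilon>) * \<mu> \<le> real (num_quadruples A)))"
proof -
  have "0 < (1 + \<epsilon>) * \<mu>" using \<mu>(1) by linarith
  then have \<mu>0: "0 < \<mu>" using \<epsilon> by (simp add: zero_less_mult_iff)
  define x where "x = \<mu> powr (1/3)"
  define w where "w = ((1 + \<epsilon>) * \<mu>) powr (1/3)"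
  have x: "0 < x" "x ^ 3 = \<mu>" unfolding x_def using \<mu>0 powr_inverse_power[of \<mu> 3] by simp_all
  have w: "1 \<le> w" "w ^ 3 = (1 + \<epsilon>) * \<mu>" unfolding w_def
    using \<mu>(1) powr_inverse_power[of "(1 + \<epsilon>) * \<mu>" 3] ge_one_powr_ge_zero by simp_all
  have wx: "w \<le> (1 + \<epsilon>) * x"
  proof (rule power_le_imp_le_base[of _ 2])
    have "w ^ 3 = (1 + \<epsilon>) * x ^ 3" using w(2) x(2) by simp
    also have "\<dots> \<le> (1 + \<epsilon>) ^ 3 * x ^ 3" using x \<epsilon> self_le_power[of "1 + \<epsilon>" 3] by (intro mult_right_mono) auto
    also have "\<dots> = ((1 + \<epsilon>) * x) ^ 3" by (simp only: power_mult_distrib)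
    finally show "w ^ Suc 2 \<le> ((1 + \<epsilon>) * x) ^ Suc 2" by simp
  qed (use x \<epsilon> in simp)
  define m where "m = (LEAST m. (1 + \<epsilon>) * \<mu> \<le> real (num_quadruples {1..m}))"
  have m: "(1 + \<epsilon>) * \<mu> \<le> real (num_quadruples {1..m})" "m \<le> n"
    unfolding m_def using LeastI[where P = "\<lambda>m. (1 + \<epsilon>) * \<mu> \<le> real (num_quadruples {1..m})", OF \<mu>(2)]
      Least_le[where P = "\<lambda>m. (1 + \<epsilon>) * \<mu> \<le> real (num_quadruples {1..m})", OF \<mu>(2)] by auto
  have mw: "real m \<le> 15 * w"
  proof (cases "m = 0")
    case False
    define h where "h = (m - 1) div 7"
    have "m - 1 < m" using False by simp
    then have "\<not> (1 + \<epsilon>) * \<mu> \<le> real (num_quadruples {1..m - 1})"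
      unfolding m_def by (rule not_less_Least)
    moreover have "h ^ 3 \<le> num_quadruples {1..m - 1}" unfolding h_def by (rule num_quadruples_ge_cube) auto
    then have "real h ^ 3 \<le> real (num_quadruples {1..m - 1})" by (metis of_nat_le_iff of_nat_power)
    ultimately have "real h ^ 3 < w ^ 3" using w(2) by linarith
    then have "real h < w" by (rule power_less_imp_less_base) (use w(1) in simp)
    moreover have "m \<le> 7 * h + 7" unfolding h_def using False by linarith
    then have "real m \<le> 7 * real h + 7" by linarith
    ultimately show ?thesis using w(1) by linarith
  qed (use w in simp)
  have L: "0 \<le> ln (1 / p)" using p by simp
  have "real m * ln (1 / p) \<le> (15 * ((1 + \<epsilon>) * x)) * ln (1 / p)"
    using mw wx L by (intro mult_right_mono) auto
  then have "exp (- (15 * (1 + \<epsilon>)) * (x * ln (1 / p))) \<le> exp (real m * ln p)"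
    using p by (simp add: ln_div algebra_simps)
  also have "\<dots> = p ^ m" using p by (simp add: exp_of_nat_mult)
  also have "\<dots> \<le> bexp p {1..n} (\<lambda>A. of_bool ((1 + \<epsilon>) * \<mu> \<le> real (num_quadruples A)))"
    using p m by (intro upper_tail_ge_planted) auto
  finally show ?thesis unfolding x_def .
qed

text \<open>With \<open>r\<close> about a quarter of (h p)^3, the expected number
  \<open>r * p\<close> of hits has order \<mu>, so hitting k of order \<mu> targets costs a constant
  factor per hit. The three summands of the constant belong to three factors: (r p / k)^k \<ge>
  G^(-k) from the binomial coefficient, (1 - p)^r \<ge> exp(-2 r p) with r p \<le> 10 \<mu>, and the
  probability 1/128, which is affordable because (1 + \<epsilon>) \<mu> is at least 1.\<close>

lemma upper_tail_ge_exp_mean: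
  fixes p \<epsilon> :: real and n :: nat
  defines "\<mu> \<equiv> mean_quadruples n p" and "L \<equiv> ln (1 / p)" and "y \<equiv> p powr (1/3)"
  assumes \<epsilon>: "0 < \<epsilon>" and n: "7 \<le> n" and \<mu>1: "1 \<le> (1 + \<epsilon>) * \<mu>"
    and p: "0 < p" "p * (65856 * (1 + \<epsilon>)) \<le> 1" "196 * L ^ 2 * y + 42 * L * y ^ 2 \<le> 1 / 2" and L: "1 \<le> L"
    and sparse: "\<mu> < \<mu> powr (1/3) * L"
  shows "exp (- (2 * (1 + \<epsilon>) * ln (65856 * (1 + \<epsilon>)) + 20 + (1 + \<epsilon>) * ln 128) * \<mu>)
    \<le> bexp p {1..n} (\<lambda>A. of_bool ((1 + \<epsilon>) * \<mu> \<le> real (num_quadruples A)))"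
proof -
  have "p * 1 \<le> p * (65856 * (1 + \<epsilon>))" using p \<epsilon> by (intro mult_left_mono) auto
  have "p * 65856 \<le> p * (65856 * (1 + \<epsilon>))" using p(1) \<epsilon> by (intro mult_left_mono) auto
  then have p': "p \<le> 1 / 2" "p \<le> 1" using p by linarith+
  have "0 < (1 + \<epsilon>) * \<mu>" using \<mu>1 by linarith
  then have \<mu>0: "0 < \<mu>" using \<epsilon> by (simp add: zero_less_mult_iff)
  define x where "x = \<mu> powr (1/3)"
  have x: "0 < x" "x ^ 3 = \<mu>" unfolding x_def using \<mu>0 powr_inverse_power[of \<mu> 3] by simp_all
  have y: "0 < y" "y ^ 3 = p" unfolding y_def using p powr_inverse_power[of p 3] by simp_all
  \<comment> \<open>The hypothesis says x^2 < L; with 1 \<le> L this weakens to x \<le> L. It makes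
    h p^(4/3) at most 14 L, so collisions between sums are rare for small \<open>p\<close>.\<close>
  have xL: "x \<le> L"
  proof (rule ccontr)
    assume "\<not> x \<le> L"
    then have "1 < x" "L < x" using L by linarith+
    then have "x * L < x * x" "1 * (x * x) < x * (x * x)" by (intro mult_strict_left_mono mult_strict_right_mono; simp)+
    then have "x * L < x ^ 3" by (simp add: power3_eq_cube)
    then show False using sparse x(2) unfolding x_def[symmetric] by linarith
  qed
  define h where "h = n div 7"
  have "n \<le> 14 * h" "7 * h \<le> n" using n unfolding h_def by presburger+
  then have h: "real n \<le> 14 * real h" "7 * real h \<le> real n" "7 * h \<le> n" by linarith+
  have npy: "real n * p * y \<le> 14 * L"
    using cube_root_le_mean_quadruples[OF n p(1) p'(2)] xL unfolding y_def x_def \<mu>_def by linarith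
  have hpy: "real h * p * y \<le> 14 * L"
  proof -
    have "real h * p * y \<le> real n * p * y" using h p y by (intro mult_right_mono) auto
    then show ?thesis using npy by linarith
  qed
  have sp: "real h ^ 2 * p ^ 3 + 3 * (real h * p ^ 2) \<le> 1 / 2"
  proof -
    have "real h ^ 2 * p ^ 3 = (real h * p * y) ^ 2 * y" unfolding y(2)[symmetric] by algebra
    also have "\<dots> \<le> (14 * L) ^ 2 * y" using hpy y p by (intro mult_right_mono power_mono) auto
    finally have 1: "real h ^ 2 * p ^ 3 \<le> 196 * L ^ 2 * y" by (simp add: power_mult_distrib)
    have "real h * p ^ 2 = (real h * p * y) * y ^ 2" unfolding y(2)[symmetric] by algebra
    also have "\<dots> \<le> (14 * L) * y ^ 2" using hpy y by (intro mult_right_mono) auto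
    finally have "real h * p ^ 2 \<le> 14 * L * y ^ 2" by simp
    then show ?thesis using 1 p(3) by linarith
  qed
  define a where "a = (real h * p) ^ 3"
  have a_mean: "\<mu> \<le> 8232 * (a * p)" "a * p \<le> 8 * \<mu>"
  proof -
    have "\<mu> \<le> 3 * real n ^ 3 * p ^ 4" unfolding \<mu>_def using p p' by (intro mean_quadruples_le) auto
    also have "\<dots> \<le> 3 * (14 * real h) ^ 3 * p ^ 4" using h p by (intro mult_right_mono mult_left_mono power_mono) auto
    also have "\<dots> = 8232 * (a * p)" unfolding a_def by (simp add: power_mult_distrib power_numeral_reduce)
    finally show "\<mu> \<le> 8232 * (a * p)" .
    have "343 * (a * p) = (7 * real h) ^ 3 * p ^ 4" unfolding a_def by (simp add: power_mult_distrib power_numeral_reduce)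
    also have "\<dots> \<le> real n ^ 3 * p ^ 4" using h p by (intro mult_right_mono power_mono) auto
    also have "\<dots> \<le> 2744 * \<mu>" unfolding \<mu>_def using p p' n by (intro cube_le_mean_quadruples) auto
    finally show "a * p \<le> 8 * \<mu>" by simp
  qed
  have a1: "1 \<le> a"
  proof (rule ccontr)
    assume "\<not> 1 \<le> a"
    then have "a * p \<le> 1 * p" using p by (intro mult_right_mono) auto
    then have "\<mu> \<le> 8232 * p" using a_mean(1) by linarith
    then have "(1 + \<epsilon>) * \<mu> \<le> (1 + \<epsilon>) * (8232 * p)" using \<epsilon> by (intro mult_left_mono) auto
    then show False using \<mu>1 p \<epsilon> by (simp add: algebra_simps)
  qed
  have hp: "1 \<le> real h * p"
  proof (rule ccontr)
    assume "\<not> 1 \<le> real h * p"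
    then have "(real h * p) ^ 3 < 1 ^ 3" using p by (intro power_strict_mono) auto
    then show False using a1 unfolding a_def by simp
  qed
  define r where "r = nat \<lceil>a / 4\<rceil>"
  define k where "k = nat \<lceil>(1 + \<epsilon>) * \<mu>\<rceil>"
  have r: "a / 4 \<le> real r" "real r < a / 4 + 1" unfolding r_def using a1 by linarith+
  have k: "(1 + \<epsilon>) * \<mu> \<le> real k" "real k \<le> 2 * ((1 + \<epsilon>) * \<mu>)" "1 \<le> k" unfolding k_def using \<mu>1 by linarith+
  have rp: "\<mu> \<le> 32928 * (real r * p)" "real r * p \<le> 10 * \<mu>"
  proof -
    have "a / 4 * p \<le> real r * p" using r p by (intro mult_right_mono) auto
    then show "\<mu> \<le> 32928 * (real r * p)" using a_mean(1) by simp
    have "real r \<le> 5 / 4 * a" using r a1 by linarith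
    then have "real r * p \<le> 5 / 4 * a * p" using p by (intro mult_right_mono) auto
    then show "real r * p \<le> 10 * \<mu>" using a_mean(2) by simp
  qed
  \<comment> \<open>65856 = 2 * 4 * 3 * 14^3: a factor 2 from rounding k up, 4 from r about a/4, 3
    from the upper bound on the number of quadruples, and 14^3 from n \<le> 14 h.\<close>
  define G where "G = 65856 * (1 + \<epsilon>)"
  have G: "1 \<le> G" unfolding G_def using \<epsilon> by simp
  have kG: "real k \<le> G * (real r * p)"
  proof -
    have "(1 + \<epsilon>) * \<mu> \<le> (1 + \<epsilon>) * (32928 * (real r * p))" using rp(1) \<epsilon> by (intro mult_left_mono) auto
    then show ?thesis using k(2) unfolding G_def by linarith
  qed
  have kr: "k \<le> r"
  proof -
    have "G * (real r * p) = real r * (p * G)" by simp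
    also have "\<dots> \<le> real r * 1" using p(2) unfolding G_def by (intro mult_left_mono) auto
    finally show ?thesis using kG by linarith
  qed
  have "exp (- (2 * (1 + \<epsilon>) * ln G) * \<mu>) \<le> exp (- (real k * ln G))"
  proof -
    have "real k * ln G \<le> 2 * ((1 + \<epsilon>) * \<mu>) * ln G" using k(2) G by (intro mult_right_mono) auto
    then show ?thesis by (simp add: mult_ac)
  qed
  also have "\<dots> = (1 / G) ^ k" using G by (simp add: exp_minus exp_of_nat_mult power_one_over inverse_eq_divide)
  also have "\<dots> \<le> (real r / real k * p) ^ k"
  proof (rule power_mono)
    show "1 / G \<le> real r / real k * p" using kG k(3) G by (simp add: field_simps)
  qed (use G in simp)
  also have "\<dots> = (real r / real k) ^ k * p ^ k" by (rule power_mult_distrib)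
  also have "\<dots> \<le> real (r choose k) * p ^ k"
    using binomial_ge_n_over_k_pow_k[OF kr, where 'a = real] p by (intro mult_right_mono) auto
  finally have f1: "exp (- (2 * (1 + \<epsilon>) * ln G) * \<mu>) \<le> real (r choose k) * p ^ k" .
  have f2: "exp (- 20 * \<mu>) \<le> (1 - p) ^ r"
  proof -
    have "p ^ 2 * 2 \<le> p" using p p' by (simp add: power2_eq_square)
    then have "- 2 * p \<le> ln (1 - p)" using ln_one_minus_pos_lower_bound[of p] p p' by simp
    then have "real r * (- 2 * p) \<le> real r * ln (1 - p)" by (intro mult_left_mono) auto
    then have "- 20 * \<mu> \<le> real r * ln (1 - p)" using rp(2) by simp
    then have "exp (- 20 * \<mu>) \<le> exp (real r * ln (1 - p))" by simp
    also have "\<dots> = (1 - p) ^ r" using p' by (simp add: exp_of_nat_mult)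
    finally show ?thesis .
  qed
  have f3: "exp (- ((1 + \<epsilon>) * ln 128) * \<mu>) \<le> 1 / 128"
  proof -
    have "1 * ln 128 \<le> ((1 + \<epsilon>) * \<mu>) * ln (128::real)" using \<mu>1 by (intro mult_right_mono) auto
    then have "exp (- ((1 + \<epsilon>) * ln 128) * \<mu>) \<le> exp (- ln 128)" by (simp add: mult_ac)
    then show ?thesis by (simp add: exp_minus)
  qed
  have "exp (- (2 * (1 + \<epsilon>) * ln G + 20 + (1 + \<epsilon>) * ln 128) * \<mu>)
      = (exp (- (2 * (1 + \<epsilon>) * ln G) * \<mu>) * exp (- 20 * \<mu>)) * exp (- ((1 + \<epsilon>) * ln 128) * \<mu>)"
    unfolding exp_add[symmetric] by (simp add: algebra_simps)
  also have "\<dots> \<le> (real (r choose k) * p ^ k * (1 - p) ^ r) * (1 / 128)"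
    using f1 f2 f3 p p' by (intro mult_mono) auto
  also have "\<dots> = real (r choose k) * p ^ k * (1 - p) ^ r / 128" by simp
  also have "\<dots> \<le> bexp p {1..n} (\<lambda>A. of_bool (real k \<le> real (num_quadruples A)))"
    by (rule upper_tail_ge_poisson[OF p(1) p'(2) h(3) hp sp r(2)[unfolded a_def]])
  also have "\<dots> \<le> bexp p {1..n} (\<lambda>A. of_bool ((1 + \<epsilon>) * \<mu> \<le> real (num_quadruples A)))"
    using p p' k(1) by (intro bexp_mono) auto
  finally show ?thesis unfolding G_def .
qed

lemma poisson_range_eventually:
  fixes G :: real
  assumes "0 < G"
  shows "\<exists>p0>0. \<forall>p. 0 < p \<and> p < p0 \<longrightarrow> p * G \<le> 1 \<and> 1 \<le> ln (1 / p) \<and>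
    196 * ln (1 / p) ^ 2 * p powr (1/3) + 42 * ln (1 / p) * (p powr (1/3)) ^ 2 \<le> 1 / 2"
proof -
  have "eventually (\<lambda>p. p * G < 1) (at_right 0)"
    by (rule order_tendstoD(2)[of _ 0]) (auto intro!: tendsto_eq_intros)
  moreover have "filterlim (\<lambda>p::real. ln (1 / p)) at_top (at_right 0)" by real_asymp
  then have "eventually (\<lambda>p::real. 1 \<le> ln (1 / p)) (at_right 0)" by (simp add: filterlim_at_top)
  moreover have "((\<lambda>p::real. 196 * ln (1 / p) ^ 2 * p powr (1/3) + 42 * ln (1 / p) * (p powr (1/3)) ^ 2) \<longlongrightarrow> 0) (at_right 0)"
    by real_asymp
  then have "eventually (\<lambda>p::real. 196 * ln (1 / p) ^ 2 * p powr (1/3) + 42 * ln (1 / p) * (p powr (1/3)) ^ 2 < 1 / 2) (at_right 0)"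
    by (rule order_tendstoD) simp
  ultimately have "eventually (\<lambda>p. p * G \<le> 1 \<and> 1 \<le> ln (1 / p) \<and>
    196 * ln (1 / p) ^ 2 * p powr (1/3) + 42 * ln (1 / p) * (p powr (1/3)) ^ 2 \<le> 1 / 2) (at_right 0)"
    by eventually_elim auto
  then show ?thesis unfolding eventually_at_right_field by blast
qed

lemma upper_tail_lower_bound:
  fixes \<epsilon> :: real
  assumes \<epsilon>: "0 < \<epsilon>"
  shows "\<exists>C>0. \<exists>n0. \<forall>n\<ge>n0. \<forall>p. 0 < p \<and> p \<le> 1 \<and> 1 \<le> (1 + \<epsilon>) * mean_quadruples n p \<and>
      (1 + \<epsilon>) * mean_quadruples n p \<le> real (num_quadruples {1..n}) \<longrightarrow>
    exp (- C * min (mean_quadruples n p) (mean_quadruples n p powr (1/3) * ln (1 / p)))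
    \<le> bexp p {1..n} (\<lambda>A. of_bool ((1 + \<epsilon>) * mean_quadruples n p \<le> real (num_quadruples A)))"
proof -
  define C1 where "C1 = 15 * (1 + \<epsilon>)"
  define C2 where "C2 = 2 * (1 + \<epsilon>) * ln (65856 * (1 + \<epsilon>)) + 20 + (1 + \<epsilon>) * ln 128"
  define C where "C = max C1 C2"
  have C: "0 < C" unfolding C_def C1_def using \<epsilon> by (simp add: less_max_iff_disj)
  obtain p0 :: real where p0: "0 < p0" and small: "\<forall>p. 0 < p \<and> p < p0 \<longrightarrow> p * (65856 * (1 + \<epsilon>)) \<le> 1 \<and> 1 \<le> ln (1 / p) \<and>
    196 * ln (1 / p) ^ 2 * p powr (1/3) + 42 * ln (1 / p) * (p powr (1/3)) ^ 2 \<le> 1 / 2"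
    using poisson_range_eventually[of "65856 * (1 + \<epsilon>)"] \<epsilon> by auto
  obtain n1 where n1: "\<forall>n\<ge>n1. \<forall>p. p0 \<le> p \<and> p \<le> 1 \<longrightarrow> (1 + \<bar>ln (1 / p0)\<bar>) ^ 3 < mean_quadruples n p"
    using mean_quadruples_large[OF p0, of "(1 + \<bar>ln (1 / p0)\<bar>) ^ 3"] by blast
  show ?thesis
  proof (intro exI[of _ C] conjI C exI[of _ "max n1 7"] allI impI, elim conjE)
    fix n p assume n: "max n1 7 \<le> n" and p: "0 < (p::real)" "p \<le> 1" and
      \<mu>: "1 \<le> (1 + \<epsilon>) * mean_quadruples n p" "(1 + \<epsilon>) * mean_quadruples n p \<le> real (num_quadruples {1..n})"
    define \<mu> where "\<mu> = mean_quadruples n p"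
    define L where "L = ln (1 / p)"
    define x where "x = \<mu> powr (1/3)"
    have "0 < (1 + \<epsilon>) * \<mu>" using \<mu>(1) unfolding \<mu>_def by linarith
    then have \<mu>0: "0 < \<mu>" using \<epsilon> by (simp add: zero_less_mult_iff)
    have L0: "0 \<le> L" unfolding L_def using p by simp
    have x: "0 < x" "x ^ 3 = \<mu>" unfolding x_def using \<mu>0 powr_inverse_power[of \<mu> 3] by simp_all
    let ?P = "bexp p {1..n} (\<lambda>A. of_bool ((1 + \<epsilon>) * \<mu> \<le> real (num_quadruples A)))"
    have "exp (- C * min \<mu> (x * L)) \<le> ?P"
    proof (cases "\<mu> < x * L")
      case False
      have "C1 * (x * L) \<le> C * (x * L)" unfolding C_def using x L0 by (intro mult_right_mono) auto
      then have "exp (- C * (x * L)) \<le> exp (- C1 * (x * L))" by simp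
      also have "\<dots> \<le> ?P"
        using upper_tail_ge_exp_planted[OF p \<epsilon> \<mu>] unfolding C1_def x_def L_def \<mu>_def .
      finally show ?thesis using False by (simp only: min_absorb2 not_less)
    next
      case True
      \<comment> \<open>For p \<ge> p0 and large \<open>n\<close> the cube root x exceeds both 1 and
        L, so x L < x^3 = \<mu>, against the case assumption. The absolute value allows for p0 >
        1.\<close>
      have "p < p0"
      proof (rule ccontr)
        assume np: "\<not> p < p0"
        then have "L \<le> ln (1 / p0)" unfolding L_def using p p0 by (simp add: ln_div)
        then have LL: "L < 1 + \<bar>ln (1 / p0)\<bar>" by linarith
        have "(1 + \<bar>ln (1 / p0)\<bar>) ^ 3 < x ^ 3" using n1 n p np x(2) unfolding \<mu>_def by auto
        then have lx: "1 + \<bar>ln (1 / p0)\<bar> < x" by (rule power_less_imp_less_base) (use x in simp)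
        then have "L < x" "1 < x" using LL by linarith+
        then have "x * L < x * x" "1 * (x * x) < x * (x * x)" by (intro mult_strict_left_mono mult_strict_right_mono; simp)+
        then have "x * L < x ^ 3" by (simp add: power3_eq_cube)
        then show False using True x(2) by linarith
      qed
      then have s: "p * (65856 * (1 + \<epsilon>)) \<le> 1" "1 \<le> L" "196 * L ^ 2 * p powr (1/3) + 42 * L * (p powr (1/3)) ^ 2 \<le> 1 / 2"
        using small p(1) unfolding L_def by blast+
      have "C2 * \<mu> \<le> C * \<mu>" unfolding C_def using \<mu>0 by (intro mult_right_mono) auto
      then have "exp (- C * \<mu>) \<le> exp (- C2 * \<mu>)" by simp
      also have "\<dots> \<le> ?P"
        using upper_tail_ge_exp_mean[OF \<epsilon> _ \<mu>(1) p(1) s(1) s(3)[unfolded L_def] s(2)[unfolded L_def]] n True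
        unfolding C2_def x_def L_def \<mu>_def by simp
      finally show ?thesis using True by (simp only: min_absorb1 less_imp_le)
    qed
    then show "exp (- C * min (mean_quadruples n p) (mean_quadruples n p powr (1/3) * ln (1 / p)))
      \<le> bexp p {1..n} (\<lambda>A. of_bool ((1 + \<epsilon>) * mean_quadruples n p \<le> real (num_quadruples A)))"
      unfolding \<mu>_def x_def L_def .
  qed
qed

theorem mainTheorem5:
  fixes \<epsilon> :: real
  assumes "\<epsilon> > 0"
  shows "\<exists>(c::real) (C::real) (n0::nat). c > 0 \<and> C > 0 \<and>
    (\<forall>n\<ge>n0. \<forall>p::real. 0 < p \<and> p \<le> 1 \<longrightarrow>
      (let \<mu> = mean_quadruples n p;
           P = measure_pmf.prob (binomial_subset n p)
                 {A. real (num_quadruples A) \<ge> (1 + \<epsilon>) * \<mu>};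
           \<Phi> = min \<mu> (\<mu> powr (1/3) * ln (1 / p))
       in 1 \<le> (1 + \<epsilon>) * \<mu> \<and> (1 + \<epsilon>) * \<mu> \<le> real (num_quadruples {1..n}) \<longrightarrow>
          exp (- C * \<Phi>) \<le> P \<and> P \<le> exp (- c * \<Phi>)))"
proof -
  obtain c n1 where c: "0 < c" and upper: "\<And>n p. n1 \<le> n \<Longrightarrow> 0 < p \<Longrightarrow> p < 1 \<Longrightarrow> 0 < mean_quadruples n p \<Longrightarrow>
    bexp p {1..n} (\<lambda>A. of_bool ((1 + \<epsilon>) * mean_quadruples n p \<le> real (num_quadruples A)))
    \<le> exp (- c * min (mean_quadruples n p) (mean_quadruples n p powr (1/3) * ln (1 / p)))"
    using upper_tail_upper_bound[OF assms] by blast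
  obtain C n2 where C: "0 < C" and lower: "\<And>n p. n2 \<le> n \<Longrightarrow> 0 < p \<Longrightarrow> p \<le> 1 \<Longrightarrow>
    1 \<le> (1 + \<epsilon>) * mean_quadruples n p \<Longrightarrow> (1 + \<epsilon>) * mean_quadruples n p \<le> real (num_quadruples {1..n}) \<Longrightarrow>
    exp (- C * min (mean_quadruples n p) (mean_quadruples n p powr (1/3) * ln (1 / p)))
    \<le> bexp p {1..n} (\<lambda>A. of_bool ((1 + \<epsilon>) * mean_quadruples n p \<le> real (num_quadruples A)))"
    using upper_tail_lower_bound[OF assms] by blast
  show ?thesis
    unfolding Let_def
  proof (rule exI[of _ c], rule exI[of _ C], rule exI[of _ "max n1 n2"], intro conjI c C allI impI, goal_cases)
    case (1 n p)
    then show ?case using lower[of n p] by (subst prob_binomial_subset) auto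
  next
    case (2 n p)
    then have "0 < (1 + \<epsilon>) * mean_quadruples n p" by linarith
    then have \<mu>0: "0 < mean_quadruples n p" using assms by (simp add: zero_less_mult_iff)
    \<comment> \<open>At p = 1 the mean equals the total number of quadruples, so (1 + \<epsilon>)
      \<mu> cannot be at most that number. The upper bound was only proved for p < 1, where ln(1/p)
      is positive.\<close>
    have "p \<noteq> 1"
    proof
      assume "p = 1"
      then have "mean_quadruples n p = real (num_quadruples {1..n})" by (simp add: mean_quadruples_eq)
      then have "(1 + \<epsilon>) * mean_quadruples n p \<le> mean_quadruples n p" using 2 by linarith
      then have "\<epsilon> * mean_quadruples n p \<le> 0" by (simp add: algebra_simps)
      then show False using mult_pos_pos[OF assms \<mu>0] by linarith
    qed
    then show ?case using 2 \<mu>0 upper[of n p] by (subst prob_binomial_subset) auto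
  qed
qed

end
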